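(* Let $G$ be a locally compact Hausdorff group, $\mu_G$ a left Haar measure on $G$, and $H$ a unimodular closed subgroup of $G$ such that $\mu_G(H)=0$. Let $\Gamma$ be a lattice in $G$ such that $H\cap\Gamma=\{e\}$. Let $\mu_{G/\Gamma}$ be the unique $G$-invariant regular Borel probability measure on $G/\Gamma$. Consider the action of $H$ on $G/\Gamma$ by left translations, which preserves $\mu_{G/\Gamma}$, and let $\pi_0$ be the corresponding Koopman representation of $H$ on $L^2_0(G/\Gamma,\mu_{G/\Gamma})$. Then any finite positive regular Borel measure $\mu$ on $H$ satisfies $\|\pi_0(\mu)\|\geq\|\lambda_H(\mu)\|$.
   Context: A lattice in $G$ is a discrete subgroup $\Gamma$ such that $G/\Gamma$ carries a finite nonzero $G$-invariant regular Borel measure. For a measure-preserving action of a group $H$ on a probability space $(X,\nu)$, $L^2_0(X,\nu)$ is the subspace of $L^2(X,\nu)$ of functions of zero integral, and the Koopman representation $\pi_0:H\to U(L^2_0(X,\nu))$ is $(\pi_0(h)\phi)(x)=\phi(h^{-1}x)$. The left regular representation $\lambda_H$ of $H$ on $L^2(H,\mu_H)$ ($\mu_H$ a left Haar measure on $H$) is $(\lambda_H(g)\phi)(h)=\phi(g^{-1}h)$. Unitary representations, including Koopman representations, are always assumed strongly continuous. For a unitary representation $\pi$ of $H$ on a Hilbert space $\mathcal{H}$ and a finite regular Borel measure $\mu$ on $H$, $\pi(\mu)$ is the unique bounded operator on $\mathcal{H}$ with $\langle\pi(\mu)\xi,\eta\rangle=\int_H\langle\pi(g)\xi,\eta\rangle\,\mathrm{d}\mu(g)$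 for all $\xi,\eta\in\mathcal{H}$; $\|\cdot\|$ is the operator norm. *)

theory Defs
  imports "HOL-Probability.Probability" "HOL-Algebra.Left_Coset"
begin

section \<open>Topological groups and coset spaces\<close>

locale topological_group = group G for G (structure) +
  fixes T :: "'a topology"
  assumes topspace_eq: "topspace T = carrier G"
    and continuous_mult: "continuous_map (prod_topology T T) T (\<lambda>(x, y). x \<otimes> y)"
    and continuous_inv: "continuous_map T T (\<lambda>x. inv x)"

text \<open>The quotient topology on the set of left cosets: the finest topology for which
  the projection of a group element to its coset is continuous.\<close>

definition coset_topology :: "('a, 'b) monoid_scheme \<Rightarrow> 'a topology \<Rightarrow> 'a set \<Rightarrow> 'a set topology"
  where "coset_topology G T K =
    topology (\<lambda>U. U \<subseteq> lcosets\<^bsub>G\<^esub> K \<and> openin T {x \<in> topspace T. x <#\<^bsub>G\<^esub> K \<in> U})"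

lemma openin_coset_topology:
  "openin (coset_topology G T K) U \<longleftrightarrow>
    U \<subseteq> lcosets\<^bsub>G\<^esub> K \<and> openin T {x \<in> topspace T. x <#\<^bsub>G\<^esub> K \<in> U}"
proof -
  let ?p = "\<lambda>U. {x \<in> topspace T. x <#\<^bsub>G\<^esub> K \<in> U}"
  have 1: "?p (U \<inter> V) = ?p U \<inter> ?p V" for U V
    by blast
  have 2: "?p (\<Union>\<U>) = (\<Union>U\<in>\<U>. ?p U)" for \<U>
    by blast
  have "istopology (\<lambda>U. U \<subseteq> lcosets\<^bsub>G\<^esub> K \<and> openin T (?p U))"
    unfolding istopology_def 1 2 by (auto intro!: openin_Union)
  then show ?thesis
    by (simp add: coset_topology_def topology_inverse')
qed

lemma (in topological_group) quotient_map_coset_topology: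
  "quotient_map T (coset_topology G T K) (\<lambda>x. x <# K)"
proof -
  have im: "(\<lambda>x. x <# K) ` topspace T = lcosets K"
    by (auto simp: LCOSETS_def topspace_eq)
  have "openin (coset_topology G T K) (lcosets K)"
  proof -
    have "{x \<in> topspace T. x <# K \<in> lcosets K} = topspace T"
      using im by blast
    then show ?thesis
      by (simp add: openin_coset_topology)
  qed
  then have "topspace (coset_topology G T K) = lcosets K"
    by (metis openin_coset_topology openin_subset openin_topspace subset_antisym)
  then show ?thesis
    using im by (auto simp: quotient_map_def openin_coset_topology)
qed


section \<open>Regular Borel measures, Haar measures, lattices\<close>

definition borel_of :: "'a topology \<Rightarrow> 'a measure"
  where "borel_of T = sigma (topspace T) {U. openin T U}"

text \<open>Finite on compact sets, outer regular on Borel sets, inner regular on open sets.\<close>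

definition regular_borel_measure :: "'a topology \<Rightarrow> 'a measure \<Rightarrow> bool"
  where "regular_borel_measure T M \<longleftrightarrow>
    sets M = sets (borel_of T) \<and>
    (\<forall>K. compactin T K \<longrightarrow> emeasure M K < \<infinity>) \<and>
    (\<forall>A\<in>sets M. emeasure M A = (INF U\<in>{U. openin T U \<and> A \<subseteq> U}. emeasure M U)) \<and>
    (\<forall>U. openin T U \<longrightarrow> emeasure M U = (SUP K\<in>{K. compactin T K \<and> K \<subseteq> U}. emeasure M K))"

definition invariant_measure ::
    "('g, 'b) monoid_scheme \<Rightarrow> ('g \<Rightarrow> 'x \<Rightarrow> 'x) \<Rightarrow> 'x measure \<Rightarrow> bool"
  where "invariant_measure G act M \<longleftrightarrow>
    (\<forall>g\<in>carrier G. \<forall>A\<in>sets M. emeasure M (act g ` A) = emeasure M A)"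

definition left_haar_measure :: "('a, 'b) monoid_scheme \<Rightarrow> 'a topology \<Rightarrow> 'a measure \<Rightarrow> bool"
  where "left_haar_measure G T M \<longleftrightarrow>
    regular_borel_measure T M \<and> emeasure M (space M) \<noteq> 0 \<and>
    invariant_measure G (\<lambda>g x. g \<otimes>\<^bsub>G\<^esub> x) M"

definition unimodular :: "('a, 'b) monoid_scheme \<Rightarrow> 'a topology \<Rightarrow> bool"
  where "unimodular G T \<longleftrightarrow>
    (\<forall>M. left_haar_measure G T M \<longrightarrow> invariant_measure G (\<lambda>g x. x \<otimes>\<^bsub>G\<^esub> g) M)"

definition lattice_in :: "('a, 'b) monoid_scheme \<Rightarrow> 'a topology \<Rightarrow> 'a set \<Rightarrow> bool"
  where "lattice_in G T \<Gamma> \<longleftrightarrow>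
    subgroup \<Gamma> G \<and> subtopology T \<Gamma> = discrete_topology \<Gamma> \<and>
    (\<exists>M. regular_borel_measure (coset_topology G T \<Gamma>) M \<and> finite_measure M \<and>
      emeasure M (space M) \<noteq> 0 \<and> invariant_measure G (\<lambda>g C. g <#\<^bsub>G\<^esub> C) M)"


section \<open>Complex Hilbert spaces with explicit carrier\<close>

record 'v hspace =
  hcarrier :: "'v set"
  hadd :: "'v \<Rightarrow> 'v \<Rightarrow> 'v"
  hscale :: "complex \<Rightarrow> 'v \<Rightarrow> 'v"
  hinner :: "'v \<Rightarrow> 'v \<Rightarrow> complex"

definition hnorm :: "'v hspace \<Rightarrow> 'v \<Rightarrow> real"
  where "hnorm E \<xi> = sqrt (Re (hinner E \<xi> \<xi>))"

text \<open>Operators are functions on the type of vectors; requiring them to be extensional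
  makes equality of operators mean equality on the carrier.\<close>

definition bounded_op :: "'v hspace \<Rightarrow> ('v \<Rightarrow> 'v) \<Rightarrow> bool"
  where "bounded_op E A \<longleftrightarrow>
    A \<in> hcarrier E \<rightarrow>\<^sub>E hcarrier E \<and>
    (\<forall>\<xi>\<in>hcarrier E. \<forall>\<eta>\<in>hcarrier E. A (hadd E \<xi> \<eta>) = hadd E (A \<xi>) (A \<eta>)) \<and>
    (\<forall>c. \<forall>\<xi>\<in>hcarrier E. A (hscale E c \<xi>) = hscale E c (A \<xi>)) \<and>
    (\<exists>B. \<forall>\<xi>\<in>hcarrier E. hnorm E (A \<xi>) \<le> B * hnorm E \<xi>)"

definition opnorm :: "'v hspace \<Rightarrow> ('v \<Rightarrow> 'v) \<Rightarrow> real"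
  where "opnorm E A = (SUP \<xi>\<in>{\<xi> \<in> hcarrier E. hnorm E \<xi> \<le> 1}. hnorm E (A \<xi>))"

text \<open>The operator \<open>\<pi>(\<mu>)\<close> of a representation \<open>\<pi>\<close> and a finite measure \<open>\<mu>\<close>.\<close>

definition integrated_op :: "'v hspace \<Rightarrow> ('g \<Rightarrow> 'v \<Rightarrow> 'v) \<Rightarrow> 'g measure \<Rightarrow> 'v \<Rightarrow> 'v"
  where "integrated_op E \<pi> \<mu> = (THE A. bounded_op E A \<and>
    (\<forall>\<xi>\<in>hcarrier E. \<forall>\<eta>\<in>hcarrier E.
      hinner E (A \<xi>) \<eta> = (LINT g|\<mu>. hinner E (\<pi> g \<xi>) \<eta>)))"


section \<open>The spaces \<open>L\<^sup>2\<close> and \<open>L\<^sup>2\<^sub>0\<close>\<close>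

definition l2_fun :: "'x measure \<Rightarrow> ('x \<Rightarrow> complex) set"
  where "l2_fun M = {f \<in> borel_measurable M. integrable M (\<lambda>x. (cmod (f x))\<^sup>2)}"

definition l2_rel :: "'x measure \<Rightarrow> (('x \<Rightarrow> complex) \<times> ('x \<Rightarrow> complex)) set"
  where "l2_rel M = {(f, g). f \<in> l2_fun M \<and> g \<in> l2_fun M \<and> (AE x in M. f x = g x)}"

definition l2_class :: "'x measure \<Rightarrow> ('x \<Rightarrow> complex) \<Rightarrow> ('x \<Rightarrow> complex) set"
  where "l2_class M f = l2_rel M `` {f}"

definition l2_rep :: "('x \<Rightarrow> complex) set \<Rightarrow> 'x \<Rightarrow> complex"
  where "l2_rep \<xi> = (SOME f. f \<in> \<xi>)"

definition L2 :: "'x measure \<Rightarrow> ('x \<Rightarrow> complex) set hspace"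
  where "L2 M = \<lparr>
    hcarrier = l2_fun M // l2_rel M,
    hadd = (\<lambda>\<xi> \<eta>. l2_class M (\<lambda>x. l2_rep \<xi> x + l2_rep \<eta> x)),
    hscale = (\<lambda>c \<xi>. l2_class M (\<lambda>x. c * l2_rep \<xi> x)),
    hinner = (\<lambda>\<xi> \<eta>. LINT x|M. l2_rep \<xi> x * cnj (l2_rep \<eta> x))\<rparr>"

definition L2_0 :: "'x measure \<Rightarrow> ('x \<Rightarrow> complex) set hspace"
  where "L2_0 M = (L2 M)\<lparr>hcarrier := {\<xi> \<in> hcarrier (L2 M). (LINT x|M. l2_rep \<xi> x) = 0}\<rparr>"

definition koopman ::
    "('g, 'b) monoid_scheme \<Rightarrow> ('g \<Rightarrow> 'x \<Rightarrow> 'x) \<Rightarrow> 'x measure \<Rightarrow>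
     'g \<Rightarrow> ('x \<Rightarrow> complex) set \<Rightarrow> ('x \<Rightarrow> complex) set"
  where "koopman G act M h \<xi> = l2_class M (\<lambda>x. l2_rep \<xi> (act (inv\<^bsub>G\<^esub> h) x))"

definition left_regular ::
    "('g, 'b) monoid_scheme \<Rightarrow> 'g measure \<Rightarrow>
     'g \<Rightarrow> ('g \<Rightarrow> complex) set \<Rightarrow> ('g \<Rightarrow> complex) set"
  where "left_regular G M g \<xi> = l2_class M (\<lambda>h. l2_rep \<xi> (inv\<^bsub>G\<^esub> g \<otimes>\<^bsub>G\<^esub> h))"

text \<open>The choice of representatives is immaterial.\<close>

lemma equiv_l2_rel: "equiv (l2_fun M) (l2_rel M)"
proof (rule equivI)
  show "trans (l2_rel M)"
    unfolding trans_def l2_rel_def by (auto elim: eventually_elim2)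
qed (auto simp: l2_rel_def refl_on_def sym_def eq_commute)

lemma l2_class_in_L2: "f \<in> l2_fun M \<Longrightarrow> l2_class M f \<in> hcarrier (L2 M)"
  by (simp add: L2_def l2_class_def quotientI)

lemma L2_rep:
  assumes "\<xi> \<in> hcarrier (L2 M)"
  shows "l2_rep \<xi> \<in> l2_fun M" and "l2_class M (l2_rep \<xi>) = \<xi>"
proof -
  obtain f where f: "f \<in> l2_fun M" "\<xi> = l2_rel M `` {f}"
    using assms by (auto simp: L2_def elim: quotientE)
  then have "f \<in> \<xi>"
    using equiv_class_self[OF equiv_l2_rel] by blast
  then have *: "(f, l2_rep \<xi>) \<in> l2_rel M"
    using f(2) by (metis Image_singleton_iff l2_rep_def someI)
  then show "l2_rep \<xi> \<in> l2_fun M"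
    by (auto simp: l2_rel_def)
  show "l2_class M (l2_rep \<xi>) = \<xi>"
    using equiv_class_eq[OF equiv_l2_rel *] f(2) by (simp add: l2_class_def)
qed

lemma l2_rep_class_AE:
  assumes "f \<in> l2_fun M"
  shows "AE x in M. l2_rep (l2_class M f) x = f x"
proof -
  have "f \<in> l2_class M f"
    using equiv_class_self[OF equiv_l2_rel assms] by (simp add: l2_class_def)
  then have "l2_rep (l2_class M f) \<in> l2_class M f"
    by (metis l2_rep_def someI)
  then show ?thesis
    by (auto simp: l2_class_def l2_rel_def elim: eventually_mono)
qed

lemma hinner_L2_class:
  assumes "f \<in> l2_fun M" "g \<in> l2_fun M"
  shows "hinner (L2 M) (l2_class M f) (l2_class M g) = (LINT x|M. f x * cnj (g x))"
proof -
  have "l2_rep (l2_class M f) \<in> l2_fun M" "l2_rep (l2_class M g) \<in> l2_fun M"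
    by (simp_all add: assms l2_class_in_L2 L2_rep)
  then have [measurable]: "l2_rep (l2_class M f) \<in> borel_measurable M"
      "l2_rep (l2_class M g) \<in> borel_measurable M"
      "f \<in> borel_measurable M" "g \<in> borel_measurable M"
    using assms by (simp_all add: l2_fun_def)
  have [measurable]: "cnj \<in> borel_measurable borel"
    by (intro borel_measurable_continuous_onI continuous_intros)
  have "AE x in M. l2_rep (l2_class M f) x * cnj (l2_rep (l2_class M g) x) = f x * cnj (g x)"
    using l2_rep_class_AE[OF assms(1)] l2_rep_class_AE[OF assms(2)] by eventually_elim simp
  then show ?thesis
    unfolding L2_def hspace.simps by (intro integral_cong_AE) measurable
qed

lemma koopman_class:
  assumes f: "f \<in> l2_fun M"
    and p: "act (inv\<^bsub>G\<^esub> h) \<in> measurable M M" "distr M M (act (inv\<^bsub>G\<^esub> h)) = M"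
  shows "koopman G act M h (l2_class M f) = l2_class M (\<lambda>x. f (act (inv\<^bsub>G\<^esub> h) x))"
proof -
  let ?p = "act (inv\<^bsub>G\<^esub> h)" and ?r = "l2_rep (l2_class M f)"
  have r: "?r \<in> l2_fun M"
    by (simp add: f l2_class_in_L2 L2_rep)
  have comp: "(\<lambda>x. k (?p x)) \<in> l2_fun M" if "k \<in> l2_fun M" for k
  proof -
    have "k \<in> borel_measurable M" "integrable (distr M M ?p) (\<lambda>x. (cmod (k x))\<^sup>2)"
      using that p(2) by (simp_all add: l2_fun_def)
    then show ?thesis
      using p(1) by (auto simp: l2_fun_def integrable_distr_eq)
  qed
  have "AE x in distr M M ?p. ?r x = f x"
    unfolding p(2) by (rule l2_rep_class_AE[OF f])
  moreover have "{x \<in> space M. ?r x = f x} \<in> sets M"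
    using f r by (auto simp: l2_fun_def)
  ultimately have "AE x in M. ?r (?p x) = f (?p x)"
    using p(1) by (simp add: AE_distr_iff)
  then have "((\<lambda>x. ?r (?p x)), (\<lambda>x. f (?p x))) \<in> l2_rel M"
    using comp f r by (simp add: l2_rel_def)
  then show ?thesis
    unfolding koopman_def l2_class_def by (rule equiv_class_eq[OF equiv_l2_rel])
qed

end

theory Submission
  imports Defs
begin

text \<open>
  The idea is to find, in \<open>L\<^sup>2\<close> of \<open>X = G/\<Gamma>\<close>, almost exact copies of nonnegative functions on \<open>H\<close>. Let \<open>x\<^sub>0 = \<Gamma>\<close> be the
  base point, \<open>U\<close> a small open neighbourhood of it, and spread the indicator of \<open>U\<close> along the orbit \<open>H x\<^sub>0\<close>:
  for a continuous \<open>\<phi> \<ge> 0\<close> with compact support on \<open>H\<close> put \<open>F\<^sub>\<phi> = \<integral> \<phi>(h) \<pi>(h) 1\<^sub>U dh\<close>. With the overlap function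
  \<open>p(k) = \<nu>(k U \<inter> U)\<close> one computes
  \<open>\<langle>\<pi>(g) F\<^sub>\<phi>, F\<^sub>\<psi>\<rangle> = \<integral> \<phi>(g\<^sup>-\<^sup>1 h) (\<integral> \<psi>(h k) p(k) dk) dh\<close> (lemma \<open>ip_smear_smear\<close>).
  Since \<open>H \<inter> \<Gamma> = {e}\<close>, the stabiliser of \<open>x\<^sub>0\<close> in \<open>H\<close> is trivial, so for small \<open>U\<close> the function \<open>p\<close> vanishes on any
  prescribed compact set that avoids a neighbourhood of \<open>e\<close> (lemma \<open>small_neighbourhood\<close>). If \<open>c\<close> is the mass of
  \<open>p\<close> near \<open>e\<close>, uniform continuity turns the inner integral into \<open>c \<psi>(h)\<close> up to a small error. So, for \<open>g\<close> in a
  compact set, the coefficient is close to \<open>c \<langle>\<lambda>(g) \<phi>, \<psi>\<rangle>\<close>, and \<open>\<parallel>F\<^sub>\<phi>\<parallel>\<^sup>2\<close> is close to \<open>c \<parallel>\<phi>\<parallel>\<^sup>2\<close>. For the remaining \<open>g\<close>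
  only the inequality \<open>\<langle>\<pi>(g) F\<^sub>\<phi>, F\<^sub>\<psi>\<rangle> \<ge> 0\<close> is needed, because \<open>\<mu>\<close> is positive.

  Passing to \<open>L\<^sup>2\<^sub>0\<close> means subtracting the mean of \<open>F\<^sub>\<phi>\<close>. This vector lives on the tube \<open>Q U\<close>, where \<open>Q\<close> contains the
  support of \<open>\<phi>\<close>, so its mean is at most \<open>\<parallel>F\<^sub>\<phi>\<parallel> \<nu>(Q U)\<^sup>1\<^sup>/\<^sup>2\<close> (lemma \<open>smear_mean\<close>), and \<open>\<nu>(Q U)\<close> tends to \<open>0\<close> as \<open>U\<close>
  shrinks. The last fact is where \<open>\<mu>\<^sub>G(H) = 0\<close> enters (lemma \<open>coset_small_tube\<close>): integrating \<open>\<nu>(g Q x\<^sub>0)\<close> over \<open>g\<close> in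
  a compact set \<open>K\<close> gives \<open>\<mu>\<^sub>G(K) \<nu>(Q x\<^sub>0)\<close>, while in the other order one integrates the measures of the sets
  \<open>{g \<in> K. g\<^sup>-\<^sup>1 x \<in> Q x\<^sub>0}\<close>, which lie in finitely many left translates of \<open>Q\<^sup>-\<^sup>1 \<subseteq> H\<close>.

  Altogether \<open>\<langle>\<lambda>(\<mu>) \<phi>, \<psi>\<rangle> \<le> \<parallel>\<pi>\<^sub>0(\<mu>)\<parallel> \<parallel>\<phi>\<parallel> \<parallel>\<psi>\<parallel>\<close> for nonnegative \<open>\<phi>\<close>, \<open>\<psi>\<close> (lemma \<open>pairing_bound\<close>). Positivity of
  \<open>\<mu>\<close> gives \<open>\<bar>\<langle>\<lambda>(\<mu>) f, g\<rangle>\<bar> \<le> \<langle>\<lambda>(\<mu>) \<bar>f\<bar>, \<bar>g\<bar>\<rangle>\<close>, and density of the compactly supported continuous functions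
  extends the bound to \<open>L\<^sup>2\<close>.

  Both the operators \<open>\<pi>(\<mu>)\<close> and the vectors \<open>F\<^sub>\<phi>\<close> are defined weakly, by the Riesz representation theorem. Inner
  products of such vectors then unfold one integral at a time and no integrals have to be interchanged. This
  matters because the topologies need not have a countable base, so that Borel sets of a product can fail to be
  measurable for the product \<open>\<sigma>\<close>-algebra.
\<close>


section \<open>Square-integrable functions\<close>

definition ip :: "'x measure \<Rightarrow> ('x \<Rightarrow> complex) \<Rightarrow> ('x \<Rightarrow> complex) \<Rightarrow> complex"
  where "ip M f g = (LINT x|M. f x * cnj (g x))"

definition l2n :: "'x measure \<Rightarrow> ('x \<Rightarrow> complex) \<Rightarrow> real"
  where "l2n M f = sqrt (LINT x|M. (cmod (f x))\<^sup>2)"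

lemmas lint_cong = Bochner_Integration.integral_cong[OF refl]

lemma borel_measurable_cnj [measurable]: "cnj \<in> borel_measurable borel"
  by (intro borel_measurable_continuous_onI continuous_intros)

lemma l2_funD:
  assumes "f \<in> l2_fun M"
  shows "f \<in> borel_measurable M" "integrable M (\<lambda>x. (cmod (f x))\<^sup>2)"
  using assms by (auto simp: l2_fun_def)

lemma l2_fun_add:
  assumes "f \<in> l2_fun M" "g \<in> l2_fun M"
  shows "(\<lambda>x. f x + g x) \<in> l2_fun M"
proof -
  note [measurable] = l2_funD(1)[OF assms(1)] l2_funD(1)[OF assms(2)]
  have "integrable M (\<lambda>x. (cmod (f x + g x))\<^sup>2)"
  proof (rule Bochner_Integration.integrable_bound)
    show "integrable M (\<lambda>x. 2 * (cmod (f x))\<^sup>2 + 2 * (cmod (g x))\<^sup>2)"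
      using l2_funD(2)[OF assms(1)] l2_funD(2)[OF assms(2)] by auto
    have "(cmod (f x + g x))\<^sup>2 \<le> 2 * (cmod (f x))\<^sup>2 + 2 * (cmod (g x))\<^sup>2" for x
    proof -
      have "(cmod (f x + g x))\<^sup>2 \<le> (cmod (f x) + cmod (g x))\<^sup>2"
        by (simp add: norm_triangle_ineq power_mono)
      also have "\<dots> \<le> 2 * (cmod (f x))\<^sup>2 + 2 * (cmod (g x))\<^sup>2"
        using sum_squares_bound[of "cmod (f x)" "cmod (g x)"] by (simp add: power2_sum)
      finally show ?thesis .
    qed
    then show "AE x in M. norm ((cmod (f x + g x))\<^sup>2) \<le> norm (2 * (cmod (f x))\<^sup>2 + 2 * (cmod (g x))\<^sup>2)"
      by (auto intro!: AE_I2)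
  qed measurable
  then show ?thesis
    by (simp add: l2_fun_def)
qed

lemma l2_fun_scale:
  assumes "f \<in> l2_fun M"
  shows "(\<lambda>x. c * f x) \<in> l2_fun M"
  using assms by (auto simp: l2_fun_def norm_mult power_mult_distrib)

lemma l2_fun_diff:
  assumes "f \<in> l2_fun M" "g \<in> l2_fun M"
  shows "(\<lambda>x. f x - g x) \<in> l2_fun M"
  using l2_fun_add[OF assms(1) l2_fun_scale[OF assms(2), of "-1"]] by simp

lemma l2_fun_zero [simp]: "(\<lambda>x. 0) \<in> l2_fun M"
  by (simp add: l2_fun_def)

lemma integrable_l2_mult:
  assumes "f \<in> l2_fun M" "g \<in> l2_fun M"
  shows "integrable M (\<lambda>x. f x * cnj (g x))" and "integrable M (\<lambda>x. cmod (f x) * cmod (g x))"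
proof -
  note [measurable] = l2_funD(1)[OF assms(1)] l2_funD(1)[OF assms(2)]
  have b: "cmod (f x) * cmod (g x) \<le> (cmod (f x))\<^sup>2 + (cmod (g x))\<^sup>2" for x
  proof -
    have "0 \<le> cmod (f x) * cmod (g x)" by simp
    then show ?thesis
      using sum_squares_bound[of "cmod (f x)" "cmod (g x)"] by linarith
  qed
  have i: "integrable M (\<lambda>x. (cmod (f x))\<^sup>2 + (cmod (g x))\<^sup>2)"
    using l2_funD(2)[OF assms(1)] l2_funD(2)[OF assms(2)] by auto
  show "integrable M (\<lambda>x. f x * cnj (g x))"
    by (rule Bochner_Integration.integrable_bound[OF i]) (use b in \<open>auto simp: norm_mult intro!: AE_I2\<close>)
  show "integrable M (\<lambda>x. cmod (f x) * cmod (g x))"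
    by (rule Bochner_Integration.integrable_bound[OF i]) (use b in \<open>auto simp: norm_mult intro!: AE_I2\<close>)
qed

lemma ip_add_left:
  assumes "f \<in> l2_fun M" "g \<in> l2_fun M" "h \<in> l2_fun M"
  shows "ip M (\<lambda>x. f x + g x) h = ip M f h + ip M g h"
  unfolding ip_def ring_distribs
  by (rule Bochner_Integration.integral_add) (simp_all add: integrable_l2_mult assms)

lemma ip_scale_left: "ip M (\<lambda>x. c * f x) h = c * ip M f h"
  unfolding ip_def mult.assoc by simp

lemma ip_commute: "ip M g f = cnj (ip M f g)"
  unfolding ip_def
  using Bochner_Integration.integral_cnj[of M "\<lambda>x. f x * cnj (g x)"] by (simp add: mult.commute)

lemma ip_diff_left:
  assumes "f \<in> l2_fun M" "g \<in> l2_fun M" "h \<in> l2_fun M"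
  shows "ip M (\<lambda>x. f x - g x) h = ip M f h - ip M g h"
  using ip_add_left[OF assms(1) l2_fun_scale[OF assms(2), of "-1"] assms(3)]
    ip_scale_left[of M "-1" g h] by simp

lemma ip_add_right:
  assumes "f \<in> l2_fun M" "g \<in> l2_fun M" "h \<in> l2_fun M"
  shows "ip M h (\<lambda>x. f x + g x) = ip M h f + ip M h g"
  unfolding ip_commute[of M h] by (simp add: ip_add_left assms)

lemma ip_scale_right: "ip M h (\<lambda>x. c * f x) = cnj c * ip M h f"
  unfolding ip_commute[of M h] by (simp add: ip_scale_left)

lemma ip_diff_right:
  assumes "f \<in> l2_fun M" "g \<in> l2_fun M" "h \<in> l2_fun M"
  shows "ip M h (\<lambda>x. f x - g x) = ip M h f - ip M h g"
  unfolding ip_commute[of M h] by (simp add: ip_diff_left assms)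

lemma ip_cong_AE:
  assumes "f \<in> l2_fun M" "f' \<in> l2_fun M" "g \<in> l2_fun M" "g' \<in> l2_fun M"
    and "AE x in M. f x = f' x" "AE x in M. g x = g' x"
  shows "ip M f g = ip M f' g'"
proof -
  note [measurable] = assms(1-4)[THEN l2_funD(1)]
  show ?thesis
    unfolding ip_def by (rule integral_cong_AE) (use assms(5,6) in auto)
qed

lemma l2n_nonneg [simp]: "0 \<le> l2n M f"
  by (simp add: l2n_def)

lemma l2n_power2: "(l2n M f)\<^sup>2 = (LINT x|M. (cmod (f x))\<^sup>2)"
  by (simp add: l2n_def)

lemma ip_self: "ip M f f = of_real ((l2n M f)\<^sup>2)"
  unfolding ip_def l2n_power2 integral_complex_of_real[symmetric] complex_norm_square ..

lemma l2n_scale: "l2n M (\<lambda>x. c * f x) = cmod c * l2n M f"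
  by (simp add: l2n_def norm_mult power_mult_distrib real_sqrt_mult)

lemma l2n_minus_commute: "l2n M (\<lambda>x. f x - g x) = l2n M (\<lambda>x. g x - f x)"
  by (simp add: l2n_def norm_minus_commute)

lemma discriminant_bound:
  fixes a b d :: real
  assumes "\<And>t. 0 \<le> a * t\<^sup>2 - 2 * b * t + d" "0 \<le> a"
  shows "b\<^sup>2 \<le> a * d"
proof (cases "a = 0")
  case True
  have "b = 0"
  proof (rule ccontr)
    assume "b \<noteq> 0"
    then have "2 * b * ((d + 1) / (2 * b)) = d + 1" by simp
    with assms(1)[of "(d + 1) / (2 * b)"] True show False by simp
  qed
  with True show ?thesis by simp
next
  case False
  then have a: "a > 0" using assms by simp
  have "0 \<le> a * (b/a)\<^sup>2 - 2 * b * (b/a) + d" by (rule assms)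
  also have "\<dots> = (a * d - b\<^sup>2) / a"
    using a by (simp add: field_simps power2_eq_square)
  finally show ?thesis using a by (simp add: field_simps)
qed

lemma l2_cauchy_schwarz_abs:
  assumes f: "f \<in> l2_fun M" and g: "g \<in> l2_fun M"
  shows "(LINT x|M. cmod (f x) * cmod (g x)) \<le> l2n M f * l2n M g"
proof -
  let ?b = "LINT x|M. cmod (f x) * cmod (g x)"
  note int = integrable_l2_mult(2)[OF f g] l2_funD(2)[OF f] l2_funD(2)[OF g]
  have "0 \<le> (l2n M f)\<^sup>2 * t\<^sup>2 - 2 * ?b * t + (l2n M g)\<^sup>2" for t
  proof -
    have "0 \<le> (LINT x|M. (cmod (f x) * t - cmod (g x))\<^sup>2)" by simp
    also have "\<dots> = (LINT x|M. t\<^sup>2 * (cmod (f x))\<^sup>2 - 2 * t * (cmod (f x) * cmod (g x)) + (cmod (g x))\<^sup>2)"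
      by (intro Bochner_Integration.integral_cong) (auto simp: power2_eq_square algebra_simps)
    also have "\<dots> = t\<^sup>2 * (l2n M f)\<^sup>2 - 2 * t * ?b + (l2n M g)\<^sup>2"
      using int by (simp add: l2n_power2)
    finally show ?thesis by (simp add: mult.commute mult.left_commute)
  qed
  then have "?b\<^sup>2 \<le> (l2n M f)\<^sup>2 * (l2n M g)\<^sup>2"
    by (rule discriminant_bound) simp
  then have "?b\<^sup>2 \<le> (l2n M f * l2n M g)\<^sup>2" by (simp add: power_mult_distrib)
  then show ?thesis by (rule power2_le_imp_le) simp
qed

lemma l2_cauchy_schwarz:
  assumes f: "f \<in> l2_fun M" and g: "g \<in> l2_fun M"
  shows "cmod (ip M f g) \<le> l2n M f * l2n M g"
proof -
  have "cmod (ip M f g) \<le> (LINT x|M. cmod (f x * cnj (g x)))"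
    unfolding ip_def by (rule integral_norm_bound)
  also have "\<dots> \<le> l2n M f * l2n M g"
    using l2_cauchy_schwarz_abs[OF f g] by (simp add: norm_mult)
  finally show ?thesis .
qed

lemma l2n_add_power2:
  assumes f: "f \<in> l2_fun M" and g: "g \<in> l2_fun M"
  shows "(l2n M (\<lambda>x. f x + g x))\<^sup>2 = (l2n M f)\<^sup>2 + 2 * Re (ip M f g) + (l2n M g)\<^sup>2"
proof -
  have fg: "(\<lambda>x. f x + g x) \<in> l2_fun M" by (simp add: f g l2_fun_add)
  have "ip M (\<lambda>x. f x + g x) (\<lambda>x. f x + g x) = ip M f f + ip M f g + ip M g f + ip M g g"
    using f g fg by (simp add: ip_add_left ip_add_right)
  then have "Re (of_real ((l2n M (\<lambda>x. f x + g x))\<^sup>2)) = Re (ip M f f + ip M f g + ip M g f + ip M g g)"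
    unfolding ip_self[symmetric] by simp
  then show ?thesis by (simp add: ip_self ip_commute[of M g f] del: of_real_power)
qed

lemma l2n_triangle:
  assumes f: "f \<in> l2_fun M" and g: "g \<in> l2_fun M"
  shows "l2n M (\<lambda>x. f x + g x) \<le> l2n M f + l2n M g"
proof (rule power2_le_imp_le)
  have "Re (ip M f g) \<le> l2n M f * l2n M g"
    using l2_cauchy_schwarz[OF f g] complex_Re_le_cmod order_trans by blast
  then show "(l2n M (\<lambda>x. f x + g x))\<^sup>2 \<le> (l2n M f + l2n M g)\<^sup>2"
    unfolding l2n_add_power2[OF f g] by (simp add: power2_sum)
qed simp

lemma l2n_triangle_diff:
  assumes "f \<in> l2_fun M" "g \<in> l2_fun M" "h \<in> l2_fun M"
  shows "l2n M (\<lambda>x. f x - h x) \<le> l2n M (\<lambda>x. f x - g x) + l2n M (\<lambda>x. g x - h x)"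
  using l2n_triangle[OF l2_fun_diff[OF assms(1,2)] l2_fun_diff[OF assms(2,3)]] by simp

lemma l2n_diff_ge:
  assumes "f \<in> l2_fun M" "g \<in> l2_fun M"
  shows "\<bar>l2n M f - l2n M g\<bar> \<le> l2n M (\<lambda>x. f x - g x)"
  using l2n_triangle[OF l2_fun_diff[OF assms] assms(2)]
    l2n_triangle[OF l2_fun_diff[OF assms(2,1)] assms(1)] l2n_minus_commute[of M f g] by simp

lemma parallelogram:
  assumes f: "f \<in> l2_fun M" and g: "g \<in> l2_fun M"
  shows "(l2n M (\<lambda>x. f x + g x))\<^sup>2 + (l2n M (\<lambda>x. f x - g x))\<^sup>2 = 2 * (l2n M f)\<^sup>2 + 2 * (l2n M g)\<^sup>2"
  using l2n_add_power2[OF f g] l2n_add_power2[OF f l2_fun_scale[OF g, of "-1"]]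
    ip_scale_right[of M f "-1" g] l2n_scale[of M "-1" g] by simp

lemma l2n_zero_iff:
  assumes f: "f \<in> l2_fun M"
  shows "l2n M f = 0 \<longleftrightarrow> (AE x in M. f x = 0)"
  using integral_nonneg_eq_0_iff_AE[OF l2_funD(2)[OF f]] by (simp add: l2n_def)

lemma tendsto_ip_left:
  assumes "\<And>n. s n \<in> l2_fun M" "f \<in> l2_fun M" "g \<in> l2_fun M"
    and lim: "(\<lambda>n. l2n M (\<lambda>x. s n x - f x)) \<longlonglongrightarrow> 0"
  shows "(\<lambda>n. ip M (s n) g) \<longlonglongrightarrow> ip M f g"
proof (rule LIM_zero_cancel, rule Lim_null_comparison)
  have "cmod (ip M (s n) g - ip M f g) \<le> l2n M (\<lambda>x. s n x - f x) * l2n M g" for n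
    using l2_cauchy_schwarz[OF l2_fun_diff[OF assms(1,2)] assms(3), of n]
    by (simp add: ip_diff_left assms)
  then show "\<forall>\<^sub>F n in sequentially. cmod (ip M (s n) g - ip M f g) \<le> l2n M (\<lambda>x. s n x - f x) * l2n M g"
    by simp
  show "(\<lambda>n. l2n M (\<lambda>x. s n x - f x) * l2n M g) \<longlonglongrightarrow> 0"
    using tendsto_mult_left_zero[OF lim] by simp
qed

lemma tendsto_l2n:
  assumes "\<And>n. s n \<in> l2_fun M" "f \<in> l2_fun M"
    and lim: "(\<lambda>n. l2n M (\<lambda>x. s n x - f x)) \<longlonglongrightarrow> 0"
  shows "(\<lambda>n. l2n M (s n)) \<longlonglongrightarrow> l2n M f"
proof (rule LIM_zero_cancel, rule Lim_null_comparison)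
  show "\<forall>\<^sub>F n in sequentially. norm (l2n M (s n) - l2n M f) \<le> l2n M (\<lambda>x. s n x - f x)"
    by (simp add: l2n_diff_ge assms)
qed (rule lim)


text \<open>Riesz--Fischer. Any complex numbers satisfy \<open>\<bar>a\<^sub>k\<bar> \<le> 2\<^sup>-\<^sup>k + 2\<^sup>k \<bar>a\<^sub>k\<bar>\<^sup>2\<close>; for the increments along a fast
  subsequence the second terms have summable integrals, so the subsequence converges almost everywhere.
  Fatou's lemma turns this into convergence in norm.\<close>

lemma l2_complete:
  assumes s: "\<And>n. s n \<in> l2_fun M"
    and cau: "\<And>e. e > 0 \<Longrightarrow> \<exists>N. \<forall>m\<ge>N. \<forall>n\<ge>N. l2n M (\<lambda>x. s m x - s n x) \<le> e"
  obtains f where "f \<in> l2_fun M" "(\<lambda>n. l2n M (\<lambda>x. s n x - f x)) \<longlonglongrightarrow> 0"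
proof -
  have "\<exists>N. \<forall>k::nat. \<forall>m\<ge>N k. \<forall>n\<ge>N k. l2n M (\<lambda>x. s m x - s n x) \<le> (1/2)^k"
    by (intro choice allI cau) simp
  then obtain N where N: "\<And>k m n. N k \<le> m \<Longrightarrow> N k \<le> n \<Longrightarrow> l2n M (\<lambda>x. s m x - s n x) \<le> (1/2)^k"
    by blast
  \<comment> \<open>The partial sums make the subsequence monotone, and adding \<open>k\<close> makes it tend to infinity.\<close>
  define r where "r k = (\<Sum>i\<le>k. N i) + k" for k
  have r: "N k \<le> r k" "r k \<le> r (Suc k)" "k \<le> r k" for k
    using member_le_sum[of k "{..k}" N] by (auto simp: r_def)
  define t where "t k = s (r k)" for k
  note [measurable] = l2_funD(1)[OF s]
  have t [measurable]: "t k \<in> borel_measurable M" for k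
    by (simp add: t_def)
  have tl2: "t k \<in> l2_fun M" for k
    by (simp add: t_def s)
  have geo: "summable (\<lambda>k. (1/2::real)^k)"
    by (rule summable_geometric) simp
  let ?d = "\<lambda>k x. 2^k * (cmod (t (Suc k) x - t k x))\<^sup>2"
  have d: "(\<integral>\<^sup>+x. ennreal (?d k x) \<partial>M) \<le> ennreal ((1/2)^k)" for k
  proof -
    have "l2n M (\<lambda>x. t (Suc k) x - t k x) \<le> (1/2)^k"
      unfolding t_def using r(1,2)[of k] by (intro N) auto
    then have "(l2n M (\<lambda>x. t (Suc k) x - t k x))\<^sup>2 \<le> ((1/2)^k)\<^sup>2"
      by (intro power_mono) auto
    then have "2^k * (LINT x|M. (cmod (t (Suc k) x - t k x))\<^sup>2) \<le> 2^k * ((1/2)^k)\<^sup>2"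
      by (simp add: l2n_power2)
    also have "\<dots> = (1/2::real)^k"
      by (simp add: power2_eq_square power_one_over)
    finally have "(LINT x|M. ?d k x) \<le> (1/2)^k" by simp
    moreover have "(\<integral>\<^sup>+x. ennreal (?d k x) \<partial>M) = ennreal (LINT x|M. ?d k x)"
      using l2_funD(2)[OF l2_fun_diff[OF tl2 tl2], of "Suc k" k]
      by (intro nn_integral_eq_integral) auto
    ultimately show ?thesis
      by (simp add: ennreal_leI)
  qed
  have "(\<integral>\<^sup>+x. (\<Sum>k. ennreal (?d k x)) \<partial>M) = (\<Sum>k. \<integral>\<^sup>+x. ennreal (?d k x) \<partial>M)"
    by (rule nn_integral_suminf) measurable
  also have "\<dots> \<le> (\<Sum>k. ennreal ((1/2)^k))"
    using d by (intro suminf_le) auto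
  also have "\<dots> < \<infinity>"
    unfolding infinity_ennreal_def less_top[symmetric] by (rule ennreal_suminf_neq_top[OF geo]) simp
  finally have "(\<integral>\<^sup>+x. (\<Sum>k. ennreal (?d k x)) \<partial>M) \<noteq> \<infinity>"
    by simp
  then have "AE x in M. (\<Sum>k. ennreal (?d k x)) \<noteq> \<infinity>"
    by (intro nn_integral_PInf_AE) measurable
  then have conv: "AE x in M. convergent (\<lambda>k. t k x)"
  proof eventually_elim
    case (elim x)
    then have "summable (\<lambda>k. ?d k x)"
      by (intro summable_suminf_not_top) auto
    then have sm: "summable (\<lambda>k. (1/2)^k + ?d k x)"
      by (rule summable_add[OF geo])
    have "norm (t (Suc k) x - t k x) \<le> (1/2)^k + ?d k x" for k
    proof -
      let ?a = "norm (t (Suc k) x - t k x)"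
      show ?thesis
      proof (cases "?a \<le> (1/2)^k")
        case True
        then show ?thesis by (simp add: add_increasing2)
      next
        case False
        then have "1 \<le> 2^k * ?a" by (simp add: power_one_over field_simps)
        then have "?a * 1 \<le> ?a * (2^k * ?a)" by (intro mult_left_mono) auto
        then show ?thesis
          by (simp add: power2_eq_square mult_ac add_increasing)
      qed
    qed
    then have "summable (\<lambda>k. t (Suc k) x - t k x)"
      by (intro summable_comparison_test'[OF sm]) auto
    then have "convergent (\<lambda>n. \<Sum>k<n. t (Suc k) x - t k x)"
      by (simp add: summable_iff_convergent)
    then have "convergent (\<lambda>n. t n x - t 0 x)"
      using sum_lessThan_telescope[of "\<lambda>k. t k x"] by simp
    then have "convergent (\<lambda>n. (t n x - t 0 x) + t 0 x)"
      by (intro convergent_add convergent_const)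
    then show ?case by simp
  qed
  define f where "f x = lim (\<lambda>k. t k x)" for x
  have f [measurable]: "f \<in> borel_measurable M"
    unfolding f_def by measurable
  have lim: "AE x in M. (\<lambda>k. t k x) \<longlonglongrightarrow> f x"
    using conv by eventually_elim (simp add: f_def convergent_LIMSEQ_iff)
  have fat: "(\<lambda>x. s n x - f x) \<in> l2_fun M \<and> l2n M (\<lambda>x. s n x - f x) \<le> (1/2)^k" if n: "N k \<le> n" for n k
  proof -
    have "(\<integral>\<^sup>+x. ennreal ((cmod (s n x - f x))\<^sup>2) \<partial>M)
        = (\<integral>\<^sup>+x. liminf (\<lambda>j. ennreal ((cmod (s n x - t j x))\<^sup>2)) \<partial>M)"
    proof (rule nn_integral_cong_AE, use lim in eventually_elim)
      case (elim x)
      then have "(\<lambda>j. ennreal ((cmod (s n x - t j x))\<^sup>2)) \<longlonglongrightarrow> ennreal ((cmod (s n x - f x))\<^sup>2)"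
        by (intro tendsto_ennrealI tendsto_intros)
      then show ?case
        by (rule lim_imp_Liminf[OF sequentially_bot, symmetric])
    qed
    also have "\<dots> \<le> liminf (\<lambda>j. \<integral>\<^sup>+x. ennreal ((cmod (s n x - t j x))\<^sup>2) \<partial>M)"
      by (rule nn_integral_liminf) measurable
    also have "\<dots> \<le> ennreal (((1/2)^k)\<^sup>2)"
    proof (rule Liminf_le)
      have "(\<integral>\<^sup>+x. ennreal ((cmod (s n x - t j x))\<^sup>2) \<partial>M) \<le> ennreal (((1/2)^k)\<^sup>2)" if "j \<ge> N k" for j
      proof -
        have "l2n M (\<lambda>x. s n x - t j x) \<le> (1/2)^k"
          unfolding t_def using r(3)[of j] n that by (intro N) auto
        then have "(l2n M (\<lambda>x. s n x - t j x))\<^sup>2 \<le> ((1/2)^k)\<^sup>2"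
          by (intro power_mono) auto
        then show ?thesis
          unfolding l2n_power2
          by (subst nn_integral_eq_integral) (auto simp: l2_funD(2)[OF l2_fun_diff[OF s tl2]] ennreal_leI)
      qed
      then show "\<forall>\<^sub>F j in sequentially. (\<integral>\<^sup>+x. ennreal ((cmod (s n x - t j x))\<^sup>2) \<partial>M) \<le> ennreal (((1/2)^k)\<^sup>2)"
        by (auto simp: eventually_sequentially)
    qed simp
    finally have le: "(\<integral>\<^sup>+x. ennreal ((cmod (s n x - f x))\<^sup>2) \<partial>M) \<le> ennreal (((1/2)^k)\<^sup>2)" .
    then have i: "integrable M (\<lambda>x. (cmod (s n x - f x))\<^sup>2)"
      by (intro integrableI_bounded) (auto simp: le_less_trans)
    then have "ennreal (LINT x|M. (cmod (s n x - f x))\<^sup>2) \<le> ennreal (((1/2)^k)\<^sup>2)"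
      using le by (subst (asm) nn_integral_eq_integral) auto
    then have "(l2n M (\<lambda>x. s n x - f x))\<^sup>2 \<le> ((1/2)^k)\<^sup>2"
      by (simp add: l2n_power2)
    then have "l2n M (\<lambda>x. s n x - f x) \<le> (1/2)^k"
      by (rule power2_le_imp_le) simp
    with i show ?thesis by (simp add: l2_fun_def)
  qed
  show thesis
  proof
    show "f \<in> l2_fun M"
      using l2_fun_diff[OF s[of "N 0"] conjunct1[OF fat[of 0 "N 0"]]] by simp
    show "(\<lambda>n. l2n M (\<lambda>x. s n x - f x)) \<longlonglongrightarrow> 0"
    proof (rule LIMSEQ_I)
      fix e :: real assume "e > 0"
      then obtain k where k: "(1/2)^k < e" using real_arch_pow_inv[of e "1/2"] by auto
      have "norm (l2n M (\<lambda>x. s n x - f x) - 0) < e" if "n \<ge> N k" for n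
        using fat[OF that] k by simp
      then show "\<exists>no. \<forall>n\<ge>no. norm (l2n M (\<lambda>x. s n x - f x) - 0) < e" by blast
    qed
  qed
qed

text \<open>The vector that represents \<open>L\<close> is the minimiser of \<open>\<parallel>f\<parallel>\<^sup>2 - 2 Re (L f)\<close>: minimising sequences are Cauchy by the
  parallelogram law, and at the minimum the first variation in the direction of every \<open>f\<close> vanishes.\<close>

lemma l2_riesz:
  assumes add: "\<And>f g. f \<in> l2_fun M \<Longrightarrow> g \<in> l2_fun M \<Longrightarrow> L (\<lambda>x. f x + g x) = L f + L g"
    and scale: "\<And>c f. f \<in> l2_fun M \<Longrightarrow> L (\<lambda>x. c * f x) = c * L f"
    and bound: "\<And>f. f \<in> l2_fun M \<Longrightarrow> cmod (L f) \<le> B * l2n M f"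
  obtains g where "g \<in> l2_fun M" "\<And>f. f \<in> l2_fun M \<Longrightarrow> L f = ip M f g"
proof -
  define J where "J f = (l2n M f)\<^sup>2 - 2 * Re (L f)" for f
  define d where "d = (INF f\<in>l2_fun M. J f)"
  have "- B\<^sup>2 \<le> J f" if "f \<in> l2_fun M" for f
  proof -
    have "Re (L f) \<le> B * l2n M f"
      using bound[OF that] complex_Re_le_cmod order_trans by blast
    moreover have "0 \<le> (l2n M f - B)\<^sup>2" by simp
    ultimately show ?thesis by (simp add: J_def power2_diff mult.commute)
  qed
  then have bdd: "bdd_below (J ` l2_fun M)"
    by (intro bdd_belowI) auto
  have ge: "d \<le> J f" if "f \<in> l2_fun M" for f
    unfolding d_def by (rule cINF_lower[OF bdd that])
  have "\<exists>f. f \<in> l2_fun M \<and> J f < d + 1 / Suc n" for n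
  proof (rule ccontr)
    assume "\<not> ?thesis"
    then have "d + 1 / Suc n \<le> d"
      unfolding d_def by (intro cINF_greatest) (use l2_fun_zero[of M] in \<open>auto simp: not_less d_def simp del: l2_fun_zero\<close>)
    then show False by (simp add: field_simps)
  qed
  then obtain s where s: "\<And>n. s n \<in> l2_fun M" and Js: "\<And>n. J (s n) < d + 1 / Suc n"
    by metis
  have gap: "(l2n M (\<lambda>x. s m x - s n x))\<^sup>2 \<le> 2 / Suc m + 2 / Suc n" for m n
  proof -
    have "d \<le> J (\<lambda>x. (1/2) * (s m x + s n x))"
      by (intro ge l2_fun_scale l2_fun_add s)
    also have "\<dots> = (l2n M (\<lambda>x. s m x + s n x))\<^sup>2 / 4 - Re (L (s m)) - Re (L (s n))"
      unfolding J_def l2n_scale scale[OF l2_fun_add[OF s s]] add[OF s s]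
      by (simp add: power_divide add_divide_distrib)
    finally have "4 * d \<le> (l2n M (\<lambda>x. s m x + s n x))\<^sup>2 - 4 * Re (L (s m)) - 4 * Re (L (s n))"
      by simp
    with parallelogram[OF s s, of m n] Js[of m] Js[of n] show ?thesis
      by (simp add: J_def)
  qed
  obtain g where g: "g \<in> l2_fun M" and lim: "(\<lambda>n. l2n M (\<lambda>x. s n x - g x)) \<longlonglongrightarrow> 0"
  proof (rule l2_complete[OF s])
    fix e :: real assume e: "e > 0"
    then obtain N where N: "inverse (Suc N) < e\<^sup>2 / 4"
      using reals_Archimedean[of "e\<^sup>2 / 4"] by auto
    have "l2n M (\<lambda>x. s m x - s n x) \<le> e" if "N \<le> m" "N \<le> n" for m n
    proof (rule power2_le_imp_le)
      have "inverse (Suc m) \<le> inverse (real (Suc N))" "inverse (Suc n) \<le> inverse (real (Suc N))"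
        using that by (auto intro!: le_imp_inverse_le)
      then show "(l2n M (\<lambda>x. s m x - s n x))\<^sup>2 \<le> e\<^sup>2"
        using gap[of m n, unfolded divide_inverse] N by linarith
    qed (use e in simp)
    then show "\<exists>N. \<forall>m\<ge>N. \<forall>n\<ge>N. l2n M (\<lambda>x. s m x - s n x) \<le> e" by blast
  qed
  have "(\<lambda>n. L (s n)) \<longlonglongrightarrow> L g"
  proof (rule LIM_zero_cancel, rule Lim_null_comparison)
    have "cmod (L (s n) - L g) \<le> B * l2n M (\<lambda>x. s n x - g x)" for n
      using bound[OF l2_fun_diff[OF s g], of n] add[OF s l2_fun_scale[OF g, of "-1"], of n]
        scale[OF g, of "-1"] by simp
    then show "\<forall>\<^sub>F n in sequentially. cmod (L (s n) - L g) \<le> B * l2n M (\<lambda>x. s n x - g x)" by simp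
    show "(\<lambda>n. B * l2n M (\<lambda>x. s n x - g x)) \<longlonglongrightarrow> 0"
      using tendsto_mult_right_zero[OF lim] by simp
  qed
  then have "(\<lambda>n. J (s n)) \<longlonglongrightarrow> J g"
    unfolding J_def by (intro tendsto_intros tendsto_l2n s g lim)
  moreover have "(\<lambda>n. d + 1 / Suc n) \<longlonglongrightarrow> d + 0"
    by (intro tendsto_intros LIMSEQ_Suc[OF lim_1_over_n])
  ultimately have Jg: "J g \<le> d"
    using Js by (intro LIMSEQ_le[of "\<lambda>n. J (s n)" _ "\<lambda>n. d + 1 / Suc n"]) (auto intro: less_imp_le)
  have Re: "Re (L f) = Re (ip M f g)" if f: "f \<in> l2_fun M" for f
  proof -
    let ?b = "Re (L f) - Re (ip M f g)"
    have "0 \<le> (l2n M f)\<^sup>2 * t\<^sup>2 - 2 * ?b * t + 0" for t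
    proof -
      have tf: "(\<lambda>x. of_real t * f x) \<in> l2_fun M" by (rule l2_fun_scale[OF f])
      have "J g \<le> J (\<lambda>x. g x + of_real t * f x)"
        using Jg ge[OF l2_fun_add[OF g tf]] by simp
      then show ?thesis
        unfolding J_def l2n_add_power2[OF g tf] add[OF g tf] scale[OF f] ip_scale_right l2n_scale
        by (simp add: power_mult_distrib ip_commute[of M g f] algebra_simps)
    qed
    then have "?b\<^sup>2 \<le> (l2n M f)\<^sup>2 * 0" by (rule discriminant_bound) simp
    then show ?thesis by simp
  qed
  show thesis
  proof (rule that[OF g])
    fix f assume f: "f \<in> l2_fun M"
    have "Re (L (\<lambda>x. \<i> * f x)) = Re (ip M (\<lambda>x. \<i> * f x) g)"
      by (rule Re[OF l2_fun_scale[OF f]])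
    then have "Im (L f) = Im (ip M f g)"
      by (simp add: scale[OF f] ip_scale_left)
    with Re[OF f] show "L f = ip M f g" by (simp add: complex_eq_iff)
  qed
qed


section \<open>Regular Borel measures\<close>

lemma sets_borel_of: "sets (borel_of T) = sigma_sets (topspace T) {U. openin T U}"
  unfolding borel_of_def by (rule sets_measure_of) (auto dest: openin_subset)

lemma space_borel_of [simp]: "space (borel_of T) = topspace T"
  unfolding borel_of_def by (rule space_measure_of) (auto dest: openin_subset)

lemma openin_borel_of: "openin T U \<Longrightarrow> U \<in> sets (borel_of T)"
  by (auto simp: sets_borel_of)

lemma closedin_borel_of:
  assumes "closedin T C"
  shows "C \<in> sets (borel_of T)"
proof -
  have "topspace T - (topspace T - C) \<in> sets (borel_of T)"
    using assms sets.compl_sets[of "topspace T - C" "borel_of T"]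
    by (simp add: openin_borel_of closedin_def)
  then show ?thesis
    using closedin_subset[OF assms] by (simp add: double_diff)
qed

lemma compactin_borel_of: "Hausdorff_space T \<Longrightarrow> compactin T K \<Longrightarrow> K \<in> sets (borel_of T)"
  by (simp add: closedin_borel_of compactin_imp_closedin)

lemma continuous_map_measurable:
  assumes "continuous_map S T f"
  shows "f \<in> measurable (borel_of S) (borel_of T)"
  unfolding borel_of_def[of T]
proof (rule measurable_measure_of)
  show "{U. openin T U} \<subseteq> Pow (topspace T)" by (auto dest: openin_subset)
  show "f \<in> space (borel_of S) \<rightarrow> topspace T"
    using assms by (auto simp: continuous_map_def)
  show "f -` U \<inter> space (borel_of S) \<in> sets (borel_of S)" if "U \<in> {U. openin T U}" for U
  proof -
    have "f -` U \<inter> space (borel_of S) = {x \<in> topspace S. f x \<in> U}" by auto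
    then show ?thesis
      using that assms by (auto simp: continuous_map_def intro: openin_borel_of)
  qed
qed

lemma continuous_map_borel_measurable:
  fixes f :: "'x \<Rightarrow> 'y::topological_space"
  assumes "continuous_map S euclidean f"
  shows "f \<in> borel_measurable (borel_of S)"
proof (rule borel_measurableI)
  fix U :: "'y set" assume "open U"
  moreover have "f -` U \<inter> space (borel_of S) = {x \<in> topspace S. f x \<in> U}" by auto
  ultimately show "f -` U \<inter> space (borel_of S) \<in> sets (borel_of S)"
    using assms by (auto simp: continuous_map_def intro: openin_borel_of)
qed

lemma regularD:
  assumes "regular_borel_measure T M"
  shows "sets M = sets (borel_of T)" "space M = topspace T"
    and "\<And>U. openin T U \<Longrightarrow> U \<in> sets M"
    and "\<And>K. compactin T K \<Longrightarrow> emeasure M K < \<infinity>"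
proof -
  show 1: "sets M = sets (borel_of T)"
    using assms by (simp add: regular_borel_measure_def)
  show "space M = topspace T"
    using sets_eq_imp_space_eq[OF 1] by simp
  show "\<And>U. openin T U \<Longrightarrow> U \<in> sets M"
    by (simp add: 1 openin_borel_of)
  show "\<And>K. compactin T K \<Longrightarrow> emeasure M K < \<infinity>"
    using assms by (simp add: regular_borel_measure_def)
qed

lemma regular_borel_measurable:
  assumes "regular_borel_measure T M"
  shows "borel_measurable M = borel_measurable (borel_of T)"
  by (rule measurable_cong_sets) (simp_all add: regularD[OF assms])

lemma outer_regular_open:
  assumes reg: "regular_borel_measure T M" and A: "A \<in> sets M" "emeasure M A < \<infinity>" and e: "e > 0"
  obtains U where "openin T U" "A \<subseteq> U" "emeasure M U < emeasure M A + ennreal e"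
proof -
  have "(INF U\<in>{U. openin T U \<and> A \<subseteq> U}. emeasure M U) = emeasure M A"
    using reg A by (simp add: regular_borel_measure_def)
  also have "\<dots> < emeasure M A + ennreal e"
    using A(2) e by (cases "emeasure M A") (auto simp flip: ennreal_plus simp: ennreal_less_iff)
  finally show thesis
    using that by (auto simp: INF_less_iff)
qed

lemma inner_regular_compact:
  assumes reg: "regular_borel_measure T M" and U: "openin T U" "emeasure M U < \<infinity>" and e: "e > 0"
  obtains K where "compactin T K" "K \<subseteq> U" "measure M U - e < measure M K"
proof (cases "measure M U < e")
  case True
  show thesis by (rule that[of "{}"]) (use True in auto)
next
  case False
  have mU: "emeasure M U = ennreal (measure M U)"
    using U(2) by (intro emeasure_eq_ennreal_measure) auto
  have "ennreal (measure M U - e) < emeasure M U"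
    unfolding mU using False e by (intro ennreal_lessI) auto
  also have "emeasure M U = (SUP K\<in>{K. compactin T K \<and> K \<subseteq> U}. emeasure M K)"
    using reg U by (simp add: regular_borel_measure_def)
  finally obtain K where K: "compactin T K" "K \<subseteq> U" "ennreal (measure M U - e) < emeasure M K"
    by (auto simp: less_SUP_iff)
  have "emeasure M K = ennreal (measure M K)"
    using regularD(4)[OF reg K(1)] by (intro emeasure_eq_ennreal_measure) auto
  with K(3) False have "measure M U - e < measure M K"
    by (simp add: ennreal_less_iff)
  with K that show thesis by blast
qed

lemma indicator_l2_fun:
  assumes "A \<in> sets M" "emeasure M A < \<infinity>"
  shows "(indicator A :: _ \<Rightarrow> complex) \<in> l2_fun M"
proof -
  have "(\<lambda>x. (cmod (indicator A x))\<^sup>2) = (\<lambda>x. indicator A x :: real)"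
    by (auto simp: indicator_def)
  then show ?thesis
    using assms by (simp add: l2_fun_def)
qed

lemma l2n_indicator:
  assumes "A \<in> sets M"
  shows "(l2n M (indicator A))\<^sup>2 = measure M A"
proof -
  have "(\<lambda>x. (cmod (indicator A x))\<^sup>2) = (\<lambda>x. indicator A x :: real)"
    by (auto simp: indicator_def)
  then show ?thesis
    using assms sets.sets_into_space by (simp add: l2n_power2 Int_absorb2)
qed

lemma l2_sum_induct:
  assumes zero: "P (\<lambda>x. 0)"
    and add: "\<And>f g. f \<in> l2_fun M \<Longrightarrow> P f \<Longrightarrow> g \<in> l2_fun M \<Longrightarrow> P g \<Longrightarrow> P (\<lambda>x. f x + g x)"
    and F: "finite F" "\<And>y. y \<in> F \<Longrightarrow> h y \<in> l2_fun M" "\<And>y. y \<in> F \<Longrightarrow> P (h y)"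
  shows "(\<lambda>x. \<Sum>y\<in>F. h y x) \<in> l2_fun M \<and> P (\<lambda>x. \<Sum>y\<in>F. h y x)"
  using F
proof (induction F rule: finite_induct)
  case empty
  then show ?case using zero by simp
next
  case (insert y F)
  then show ?case
    using add[of "h y" "\<lambda>x. \<Sum>y\<in>F. h y x"] l2_fun_add[of "h y" M "\<lambda>x. \<Sum>y\<in>F. h y x"] by simp
qed

text \<open>Simple functions are dense in \<open>L\<^sup>2\<close>, and outer regularity replaces a Borel set of finite measure by an open
  one; so properties that are linear and closed in \<open>L\<^sup>2\<close> need only be checked for open sets.\<close>

lemma l2_open_induct [consumes 2, case_names open_set add scale lim]:
  assumes reg: "regular_borel_measure T M" and f: "f \<in> l2_fun M"
    and opn: "\<And>U. openin T U \<Longrightarrow> emeasure M U < \<infinity> \<Longrightarrow> P (indicator U)"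
    and add: "\<And>f g. f \<in> l2_fun M \<Longrightarrow> P f \<Longrightarrow> g \<in> l2_fun M \<Longrightarrow> P g \<Longrightarrow> P (\<lambda>x. f x + g x)"
    and scale: "\<And>c f. f \<in> l2_fun M \<Longrightarrow> P f \<Longrightarrow> P (\<lambda>x. c * f x)"
    and lim: "\<And>s f. (\<And>n. s n \<in> l2_fun M) \<Longrightarrow> (\<And>n. P (s n)) \<Longrightarrow> f \<in> l2_fun M \<Longrightarrow>
      (\<lambda>n. l2n M (\<lambda>x. s n x - f x)) \<longlonglongrightarrow> 0 \<Longrightarrow> P f"
  shows "P f"
proof -
  have ind: "P (indicator A)" if A: "A \<in> sets M" "emeasure M A < \<infinity>" for A
  proof -
    have "\<exists>U. openin T U \<and> A \<subseteq> U \<and> emeasure M U < emeasure M A + ennreal (1 / Suc n)" for n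
      by (rule outer_regular_open[OF reg A, of "1 / Suc n"]) auto
    then obtain U where U: "\<And>n. openin T (U n)" "\<And>n. A \<subseteq> U n"
      "\<And>n. emeasure M (U n) < emeasure M A + ennreal (1 / Suc n)"
      by metis
    have Us: "U n \<in> sets M" for n
      by (rule regularD(3)[OF reg U(1)])
    have Uf: "emeasure M (U n) < \<infinity>" for n
      using order.strict_trans[OF U(3)[of n], of \<infinity>] A(2) by (simp add: less_top)
    show ?thesis
    proof (rule lim)
      show "(indicator (U n)) \<in> l2_fun M" for n
        by (rule indicator_l2_fun[OF Us Uf])
      show "P (indicator (U n))" for n
        by (rule opn[OF U(1) Uf])
      show "(indicator A) \<in> l2_fun M"
        by (rule indicator_l2_fun[OF A])
      have le: "l2n M (\<lambda>x. indicator (U n) x - indicator A x) \<le> sqrt (1 / Suc n)" for n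
      proof -
        have "(\<lambda>x. indicator (U n) x - indicator A x) = (\<lambda>x. indicator (U n - A) x :: complex)"
          by (intro ext) (use U(2)[of n] in \<open>auto simp: indicator_def\<close>)
        then have "(l2n M (\<lambda>x. indicator (U n) x - indicator A x))\<^sup>2 = measure M (U n - A)"
          by (simp only:) (rule l2n_indicator, use Us A in auto)
        also have "\<dots> = measure M (U n) - measure M A"
          using Uf[of n] A U(2)[of n] Us[of n] by (intro measure_Diff) auto
        also have "\<dots> \<le> 1 / Suc n"
        proof -
          have "ennreal (measure M (U n)) < ennreal (measure M A) + ennreal (1 / Suc n)"
            using U(3)[of n] Uf[of n] A(2) by (simp add: emeasure_eq_ennreal_measure less_top)
          then show ?thesis
            by (simp flip: ennreal_plus add: ennreal_less_iff)
        qed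
        finally have "(l2n M (\<lambda>x. indicator (U n) x - indicator A x))\<^sup>2 \<le> 1 / Suc n" .
        then show ?thesis by (rule real_le_rsqrt)
      qed
      show "(\<lambda>n. l2n M (\<lambda>x. indicator (U n) x - indicator A x)) \<longlonglongrightarrow> 0"
      proof (rule Lim_null_comparison)
        show "\<forall>\<^sub>F n in sequentially. norm (l2n M (\<lambda>x. indicator (U n) x - indicator A x)) \<le> sqrt (1 / Suc n)"
          using le by simp
        show "(\<lambda>n. sqrt (1 / Suc n)) \<longlonglongrightarrow> 0"
          using tendsto_real_sqrt[OF LIMSEQ_Suc[OF lim_1_over_n]] by simp
      qed
    qed
  qed
  have zero: "P (\<lambda>x. 0)"
    using ind[of "{}"] by (simp add: indicator_def[abs_def])
  note [measurable] = l2_funD(1)[OF f]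
  obtain s where s: "\<And>i. simple_function M (s i)" "\<And>x. x \<in> space M \<Longrightarrow> (\<lambda>i. s i x) \<longlonglongrightarrow> f x"
    "\<And>i x. x \<in> space M \<Longrightarrow> dist (s i x) 0 \<le> 2 * dist (f x) 0"
    using borel_measurable_implies_sequence_metric[OF l2_funD(1)[OF f], of 0] by blast
  note [measurable] = borel_measurable_simple_function[OF s(1)]
  have s2: "integrable M (\<lambda>x. (cmod (s i x))\<^sup>2)" for i
  proof (rule Bochner_Integration.integrable_bound)
    show "integrable M (\<lambda>x. 4 * (cmod (f x))\<^sup>2)"
      using l2_funD(2)[OF f] by simp
    show "AE x in M. norm ((cmod (s i x))\<^sup>2) \<le> norm (4 * (cmod (f x))\<^sup>2)"
    proof (rule AE_I2)
      fix x assume "x \<in> space M"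
      then have "(cmod (s i x))\<^sup>2 \<le> (2 * cmod (f x))\<^sup>2"
        using s(3)[of x i] by (intro power_mono) auto
      then show "norm ((cmod (s i x))\<^sup>2) \<le> norm (4 * (cmod (f x))\<^sup>2)"
        by (simp add: power_mult_distrib)
    qed
  qed measurable
  show ?thesis
  proof (rule lim[OF _ _ f])
    \<comment> \<open>Leaving out the value \<open>0\<close> keeps only level sets of finite measure; \<open>?s i\<close> agrees with \<open>s i\<close> on the space.\<close>
    let ?A = "\<lambda>i y. s i -` {y} \<inter> space M"
    let ?s = "\<lambda>i x. \<Sum>y\<in>s i ` space M - {0}. y * indicator (?A i y) x"
    have eq: "?s i x = s i x" if "x \<in> space M" for i x
    proof -
      have "?s i x = (\<Sum>y\<in>s i ` space M - {0}. if y = s i x then y else 0)"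
        using that by (intro sum.cong) (auto simp: indicator_def)
      also have "\<dots> = s i x"
        using that simple_functionD(1)[OF s(1), of i] by simp
      finally show ?thesis .
    qed
    have sum: "?s i \<in> l2_fun M \<and> P (?s i)" for i
    proof (rule l2_sum_induct[OF zero add])
      show "finite (s i ` space M - {0})"
        using simple_functionD(1)[OF s(1), of i] by simp
      fix y assume y: "y \<in> s i ` space M - {0}"
      have A: "?A i y \<in> sets M" by measurable
      have "integrable M (\<lambda>x. indicator (?A i y) x :: real)"
      proof (rule Bochner_Integration.integrable_bound)
        show "integrable M (\<lambda>x. (cmod (s i x))\<^sup>2 / (cmod y)\<^sup>2)"
          using s2 by simp
        show "AE x in M. norm (indicator (?A i y) x :: real) \<le> norm ((cmod (s i x))\<^sup>2 / (cmod y)\<^sup>2)"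
          using y by (intro AE_I2) (auto simp: indicator_def)
      qed (use A in measurable)
      then have fin: "emeasure M (?A i y) < \<infinity>"
        using A by (simp add: integrable_indicator_iff)
      show "(\<lambda>x. y * indicator (?A i y) x) \<in> l2_fun M"
        by (intro l2_fun_scale indicator_l2_fun A fin)
      show "P (\<lambda>x. y * indicator (?A i y) x)"
        by (intro scale indicator_l2_fun ind A fin)
    qed
    show "?s i \<in> l2_fun M" for i
      using sum by (rule conjunct1)
    show "P (?s i)" for i
      using sum by (rule conjunct2)
    have "(\<lambda>i. LINT x|M. (cmod (s i x - f x))\<^sup>2) \<longlonglongrightarrow> (LINT x|M. 0)"
    proof (rule integral_dominated_convergence)
      show "integrable M (\<lambda>x. 9 * (cmod (f x))\<^sup>2)"
        using l2_funD(2)[OF f] by simp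
      show "AE x in M. norm ((cmod (s i x - f x))\<^sup>2) \<le> 9 * (cmod (f x))\<^sup>2" for i
      proof (rule AE_I2)
        fix x assume "x \<in> space M"
        then have "cmod (s i x - f x) \<le> 3 * cmod (f x)"
          using s(3)[of x i] norm_triangle_ineq4[of "s i x" "f x"] by simp
        then have "(cmod (s i x - f x))\<^sup>2 \<le> (3 * cmod (f x))\<^sup>2"
          by (intro power_mono) auto
        then show "norm ((cmod (s i x - f x))\<^sup>2) \<le> 9 * (cmod (f x))\<^sup>2"
          by (simp add: power_mult_distrib)
      qed
      show "AE x in M. (\<lambda>i. (cmod (s i x - f x))\<^sup>2) \<longlonglongrightarrow> 0"
      proof (rule AE_I2)
        fix x assume "x \<in> space M"
        then have "(\<lambda>i. (cmod (s i x - f x))\<^sup>2) \<longlonglongrightarrow> (cmod (f x - f x))\<^sup>2"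
          by (intro tendsto_intros s(2))
        then show "(\<lambda>i. (cmod (s i x - f x))\<^sup>2) \<longlonglongrightarrow> 0" by simp
      qed
    qed measurable
    then have "(\<lambda>i. sqrt (LINT x|M. (cmod (s i x - f x))\<^sup>2)) \<longlonglongrightarrow> sqrt (LINT x|M. 0)"
      by (rule tendsto_real_sqrt)
    moreover have "sqrt (LINT x|M. (cmod (s i x - f x))\<^sup>2) = l2n M (\<lambda>x. ?s i x - f x)" for i
      unfolding l2n_def using eq by (simp cong: Bochner_Integration.integral_cong)
    ultimately show "(\<lambda>i. l2n M (\<lambda>x. ?s i x - f x)) \<longlonglongrightarrow> 0"
      by simp
  qed
qed


section \<open>Continuous functions of compact support\<close>

text \<open>The functions of the class usually written \<open>C\<^sub>c(T)\<close>.\<close>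

definition cc :: "'x topology \<Rightarrow> ('x \<Rightarrow> 'y::real_normed_vector) \<Rightarrow> bool"
  where "cc T f \<longleftrightarrow> continuous_map T euclidean f \<and> (\<exists>Q. compactin T Q \<and> (\<forall>x\<in>topspace T - Q. f x = 0))"

lemma cc_bounded:
  assumes "cc T f"
  obtains B where "\<And>x. x \<in> topspace T \<Longrightarrow> norm (f x) \<le> B" "B \<ge> 0"
proof -
  obtain Q where Q: "compactin T Q" "\<And>x. x \<in> topspace T - Q \<Longrightarrow> f x = 0"
    and f: "continuous_map T euclidean f"
    using assms by (auto simp: cc_def)
  have "compact (f ` Q)"
    using image_compactin[OF Q(1) f] by simp
  then obtain B where "\<And>y. y \<in> f ` Q \<Longrightarrow> norm y \<le> B"
    using compact_imp_bounded bounded_iff by metis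
  then have "norm (f x) \<le> max B 0" if "x \<in> topspace T" for x
    using Q(2)[of x] that by (cases "x \<in> Q") (auto simp: le_max_iff_disj)
  then show thesis using that[of "max B 0"] by auto
qed

lemma cc_add:
  assumes "cc T f" "cc T g"
  shows "cc T (\<lambda>x. f x + g x)"
proof -
  obtain Q R where "compactin T Q" "\<And>x. x \<in> topspace T - Q \<Longrightarrow> f x = 0"
    "compactin T R" "\<And>x. x \<in> topspace T - R \<Longrightarrow> g x = 0"
    using assms unfolding cc_def by metis
  then show ?thesis
    using assms unfolding cc_def by (intro conjI continuous_map_add exI[of _ "Q \<union> R"] compactin_Un) auto
qed

lemma cc_cont_compose:
  assumes "cc T f" "continuous_on UNIV h" "h 0 = 0"
  shows "cc T (\<lambda>x. h (f x))"
proof -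
  have "continuous_map T euclidean (h \<circ> f)"
    using assms by (intro continuous_map_compose[of _ euclidean]) (auto simp: cc_def)
  with assms show ?thesis by (auto simp: cc_def o_def)
qed

lemma cc_integrable:
  fixes f :: "'x \<Rightarrow> 'y::{banach, second_countable_topology}"
  assumes "cc T f" "Hausdorff_space T" "regular_borel_measure T M"
  shows "f \<in> borel_measurable M" "integrable M f"
proof -
  show f [measurable]: "f \<in> borel_measurable M"
    using assms(1) unfolding cc_def regular_borel_measurable[OF assms(3)]
    by (blast intro: continuous_map_borel_measurable)
  obtain Q where Q: "compactin T Q" "\<And>x. x \<in> topspace T - Q \<Longrightarrow> f x = 0"
    using assms(1) unfolding cc_def by metis
  obtain B where B: "\<And>x. x \<in> topspace T \<Longrightarrow> norm (f x) \<le> B" "B \<ge> 0"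
    using cc_bounded[OF assms(1)] by metis
  have Qs: "Q \<in> sets M"
    using Q(1) assms regularD(1)[OF assms(3)] by (simp add: compactin_borel_of)
  show "integrable M f"
  proof (rule Bochner_Integration.integrable_bound)
    show "integrable M (\<lambda>x. B * indicator Q x)"
      using Qs regularD(4)[OF assms(3) Q(1)] by simp
    show "AE x in M. norm (f x) \<le> norm (B * indicator Q x)"
      using B Q(2) regularD(2)[OF assms(3)] by (intro AE_I2) (auto simp: indicator_def)
  qed measurable
qed

lemma cc_l2_fun:
  assumes "cc T f" "Hausdorff_space T" "regular_borel_measure T M"
  shows "f \<in> l2_fun M"
proof -
  have "cc T (\<lambda>x. (cmod (f x))\<^sup>2)"
    by (rule cc_cont_compose[OF assms(1)]) (auto intro!: continuous_intros)
  then show ?thesis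
    using cc_integrable(1)[OF assms] cc_integrable(2)[OF _ assms(2,3), of "\<lambda>x. (cmod (f x))\<^sup>2"]
    by (simp add: l2_fun_def)
qed

text \<open>Compactly supported continuous functions are dense in \<open>L\<^sup>2\<close>: by the induction principle it
  suffices to approximate the indicator of an open set, where inner regularity and Urysohn's lemma apply.\<close>

lemma cc_dense_l2:
  assumes lc: "locally_compact_space T" and hd: "Hausdorff_space T" and reg: "regular_borel_measure T M"
    and f: "f \<in> l2_fun M"
  obtains s where "\<And>n. cc T (s n)" "(\<lambda>n. l2n M (\<lambda>x. s n x - f x)) \<longlonglongrightarrow> 0"
proof -
  note ccl2 = cc_l2_fun[OF _ hd reg]
  have "\<forall>e>0. \<exists>\<phi>. cc T \<phi> \<and> l2n M (\<lambda>x. \<phi> x - f x) < e"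
    using reg f
  proof (induction rule: l2_open_induct)
    case (open_set U)
    show ?case
    proof (intro allI impI)
      fix e :: real assume e: "e > 0"
      obtain K where K: "compactin T K" "K \<subseteq> U" "measure M U - e\<^sup>2 < measure M K"
        by (rule inner_regular_compact[OF reg open_set, of "e\<^sup>2"]) (use e in auto)
      obtain V L where V: "openin T V" "compactin T L" "K \<subseteq> V" "V \<subseteq> L"
        using lc hd K(1) locally_compact_space_compact_closed_compact[of T] by metis
      have cr: "completely_regular_space T"
        using lc hd locally_compact_Hausdorff_imp_regular_space locally_compact_regular_imp_completely_regular_space
        by blast
      have "closedin T (topspace T - U \<inter> V)"
        using V open_set by auto
      moreover have "disjnt K (topspace T - U \<inter> V)"
        using K(2) V(3) by (auto simp: disjnt_iff)
      ultimately obtain g :: "_ \<Rightarrow> real" where g: "continuous_map T (top_of_set {0..1}) g"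
        "g ` (topspace T - U \<inter> V) \<subseteq> {0}" "g ` K \<subseteq> {1}"
        using Urysohn_completely_regular_compact_closed[OF zero_le_one cr K(1)] by metis
      have gc: "continuous_map T euclidean g" and g01: "\<And>x. x \<in> topspace T \<Longrightarrow> 0 \<le> g x \<and> g x \<le> 1"
        using g(1) by (auto simp: continuous_map_in_subtopology image_subset_iff Pi_iff)
      let ?\<phi> = "\<lambda>x. complex_of_real (g x)"
      have "cc T g"
        unfolding cc_def using gc V(2,4) g(2) by (intro conjI exI[of _ L]) auto
      then have \<phi>: "cc T ?\<phi>"
        by (rule cc_cont_compose) (auto intro!: continuous_intros)
      have Us: "U \<in> sets M" and Ks: "K \<in> sets M"
        using regularD[OF reg] open_set(1) K(1) hd by (auto simp: compactin_borel_of)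
      have U2: "(indicator U :: _ \<Rightarrow> complex) \<in> l2_fun M"
        by (rule indicator_l2_fun[OF Us open_set(2)])
      have "(l2n M (\<lambda>x. ?\<phi> x - indicator U x))\<^sup>2 \<le> (LINT x|M. indicator (U - K) x)"
        unfolding l2n_power2
      proof (rule integral_mono)
        show "integrable M (\<lambda>x. (cmod (?\<phi> x - indicator U x))\<^sup>2)"
          by (rule l2_funD(2)[OF l2_fun_diff[OF ccl2[OF \<phi>] U2]])
        show "integrable M (indicator (U - K) :: _ \<Rightarrow> real)"
          using Us Ks open_set(2) le_less_trans[OF emeasure_mono[of "U - K" U M]] by simp
        fix x assume "x \<in> space M"
        then have x: "x \<in> topspace T"
          using regularD(2)[OF reg] by simp
        have 1: "cmod (?\<phi> x - 1) \<le> 1"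
          using g01[OF x] norm_of_real[of "g x - 1", where ?'a = complex] by simp
        show "(cmod (?\<phi> x - indicator U x))\<^sup>2 \<le> indicator (U - K) x"
          using g(2,3) g01[OF x] x K(2) power_mono[OF 1, of 2]
          by (cases "x \<in> U"; cases "x \<in> K") auto
      qed
      also have "\<dots> = measure M (U - K)"
        using Us Ks sets.sets_into_space by (simp add: Int_absorb2 Diff_subset subset_trans)
      also have "\<dots> = measure M U - measure M K"
        using Us Ks K(2) open_set(2) by (intro measure_Diff) auto
      also have "\<dots> < e\<^sup>2"
        using K(3) by simp
      finally have "l2n M (\<lambda>x. ?\<phi> x - indicator U x) < e"
        by (rule power2_less_imp_less) (use e in simp)
      with \<phi> show "\<exists>\<phi>. cc T \<phi> \<and> l2n M (\<lambda>x. \<phi> x - indicator U x) < e" by blast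
    qed
  next
    case (add f g)
    show ?case
    proof (intro allI impI)
      fix e :: real assume "e > 0"
      then obtain \<phi> \<psi> where *: "cc T \<phi>" "l2n M (\<lambda>x. \<phi> x - f x) < e / 2" "cc T \<psi>" "l2n M (\<lambda>x. \<psi> x - g x) < e / 2"
        using add by (metis half_gt_zero)
      have "l2n M (\<lambda>x. (\<phi> x + \<psi> x) - (f x + g x)) \<le> l2n M (\<lambda>x. \<phi> x - f x) + l2n M (\<lambda>x. \<psi> x - g x)"
        using l2n_triangle[OF l2_fun_diff[OF ccl2[OF *(1)] add.hyps(1)] l2_fun_diff[OF ccl2[OF *(3)] add.hyps(2)]]
        by (simp add: algebra_simps)
      with * show "\<exists>\<phi>. cc T \<phi> \<and> l2n M (\<lambda>x. \<phi> x - (f x + g x)) < e"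
        by (intro exI[of _ "\<lambda>x. \<phi> x + \<psi> x"] conjI cc_add) auto
    qed
  next
    case (scale c f)
    show ?case
    proof (intro allI impI)
      fix e :: real assume "e > 0"
      then have "e / (cmod c + 1) > 0" by (intro divide_pos_pos) (auto intro: add_nonneg_pos)
      then obtain \<phi> where *: "cc T \<phi>" "l2n M (\<lambda>x. \<phi> x - f x) < e / (cmod c + 1)"
        using scale by blast
      have "l2n M (\<lambda>x. c * \<phi> x - c * f x) = cmod c * l2n M (\<lambda>x. \<phi> x - f x)"
        unfolding right_diff_distrib[symmetric] by (rule l2n_scale)
      also have "\<dots> \<le> (cmod c + 1) * l2n M (\<lambda>x. \<phi> x - f x)"
        by (intro mult_right_mono) auto
      also have "\<dots> < e"
        using *(2) by (simp add: pos_less_divide_eq add_nonneg_pos mult.commute)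
      finally show "\<exists>\<phi>. cc T \<phi> \<and> l2n M (\<lambda>x. \<phi> x - c * f x) < e"
        by (intro exI[of _ "\<lambda>x. c * \<phi> x"] conjI cc_cont_compose[OF *(1)]) (auto intro!: continuous_intros)
    qed
  next
    case (lim s f)
    show ?case
    proof (intro allI impI)
      fix e :: real assume e: "e > 0"
      obtain n where n: "l2n M (\<lambda>x. s n x - f x) < e / 2"
        using LIMSEQ_D[OF lim.hyps(3), of "e / 2"] e by auto
      obtain \<phi> where *: "cc T \<phi>" "l2n M (\<lambda>x. \<phi> x - s n x) < e / 2"
        using lim.IH e by (metis half_gt_zero)
      have "l2n M (\<lambda>x. \<phi> x - f x) < e"
        using l2n_triangle_diff[OF ccl2[OF *(1)] lim.hyps(1)[of n] lim.hyps(2)] n *(2) by simp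
      with * show "\<exists>\<phi>. cc T \<phi> \<and> l2n M (\<lambda>x. \<phi> x - f x) < e" by blast
    qed
  qed
  then have "\<exists>\<phi>. cc T \<phi> \<and> l2n M (\<lambda>x. \<phi> x - f x) < inverse (real (Suc n))" for n
    by simp
  then obtain s where s: "\<And>n. cc T (s n)" "\<And>n. l2n M (\<lambda>x. s n x - f x) < inverse (real (Suc n))"
    by metis
  show thesis
  proof (rule that[OF s(1)])
    show "(\<lambda>n. l2n M (\<lambda>x. s n x - f x)) \<longlonglongrightarrow> 0"
      by (rule Lim_null_comparison[OF _ LIMSEQ_inverse_real_of_nat]) (use less_imp_le[OF s(2)] in simp)
  qed
qed


section \<open>Continuous measure-preserving actions\<close>

locale mp_action = topological_group G T for G (structure) and T +
  fixes act :: "'a \<Rightarrow> 'x \<Rightarrow> 'x" and S :: "'x topology" and M :: "'x measure"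
  assumes act_continuous: "continuous_map (prod_topology T S) S (\<lambda>(g, x). act g x)"
    and act_one: "x \<in> topspace S \<Longrightarrow> act \<one> x = x"
    and act_mult: "g \<in> carrier G \<Longrightarrow> h \<in> carrier G \<Longrightarrow> x \<in> topspace S \<Longrightarrow> act (g \<otimes> h) x = act g (act h x)"
    and S_hausdorff: "Hausdorff_space S"
    and reg: "regular_borel_measure S M"
    and inv_measure: "invariant_measure G act M"
begin

lemmas sets_M = regularD(1)[OF reg]
lemmas space_M = regularD(2)[OF reg]
lemmas open_M = regularD(3)[OF reg]
lemmas compact_finite = regularD(4)[OF reg]

lemma compact_M: "compactin S K \<Longrightarrow> K \<in> sets M"
  by (simp add: sets_M compactin_borel_of S_hausdorff)

lemma act_closed [simp]: "g \<in> carrier G \<Longrightarrow> x \<in> topspace S \<Longrightarrow> act g x \<in> topspace S"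
  using Pi_mem[OF continuous_map_funspace[OF act_continuous], of "(g, x)"] by (simp add: topspace_eq)

lemma act_inv_act [simp]: "g \<in> carrier G \<Longrightarrow> x \<in> topspace S \<Longrightarrow> act (inv g) (act g x) = x"
  using act_mult[of "inv g" g x] act_one by simp

lemma act_act_inv [simp]: "g \<in> carrier G \<Longrightarrow> x \<in> topspace S \<Longrightarrow> act g (act (inv g) x) = x"
  using act_mult[of g "inv g" x] act_one by simp

lemma act_cont:
  assumes "g \<in> carrier G"
  shows "continuous_map S S (act g)"
proof -
  have "continuous_map S (prod_topology T S) (\<lambda>x. (g, x))"
    using assms by (simp add: continuous_map_pairedI topspace_eq)
  from continuous_map_compose[OF this act_continuous] show ?thesis
    by (simp add: o_def)
qed

lemma orbit_cont:
  assumes "x \<in> topspace S"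
  shows "continuous_map T S (\<lambda>g. act g x)"
proof -
  have "continuous_map T (prod_topology T S) (\<lambda>g. (g, x))"
    using assms by (simp add: continuous_map_pairedI)
  from continuous_map_compose[OF this act_continuous] show ?thesis
    by (simp add: o_def)
qed

lemma act_measurable: "g \<in> carrier G \<Longrightarrow> act g \<in> measurable M M"
  using continuous_map_measurable[OF act_cont] measurable_cong_sets[OF sets_M sets_M] by blast

lemma act_image:
  assumes "g \<in> carrier G" "A \<subseteq> topspace S"
  shows "act g ` A = {x \<in> topspace S. act (inv g) x \<in> A}"
proof -
  have "x \<in> act g ` A" if "x \<in> topspace S" "act (inv g) x \<in> A" for x
    using that assms by (intro image_eqI[of _ _ "act (inv g) x"]) auto
  then show ?thesis using assms by auto
qed

lemma act_image_subset: "g \<in> carrier G \<Longrightarrow> A \<subseteq> topspace S \<Longrightarrow> act g ` A \<subseteq> topspace S"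
  by auto

lemma open_act_image: "g \<in> carrier G \<Longrightarrow> openin S U \<Longrightarrow> openin S (act g ` U)"
  using openin_continuous_map_preimage[OF act_cont[of "inv g"]] by (simp add: act_image openin_subset)

lemma act_image_sets:
  assumes "g \<in> carrier G" "A \<in> sets M"
  shows "act g ` A \<in> sets M"
proof -
  have "act (inv g) -` A \<inter> space M \<in> sets M"
    using assms by (intro measurable_sets[OF act_measurable]) auto
  moreover have "act (inv g) -` A \<inter> space M = act g ` A"
    using assms sets.sets_into_space[of A M] by (subst act_image) (auto simp: space_M)
  ultimately show ?thesis by simp
qed

lemma emeasure_act_image: "g \<in> carrier G \<Longrightarrow> A \<in> sets M \<Longrightarrow> emeasure M (act g ` A) = emeasure M A"
  using inv_measure by (simp add: invariant_measure_def)

lemma measure_act_image: "g \<in> carrier G \<Longrightarrow> A \<in> sets M \<Longrightarrow> measure M (act g ` A) = measure M A"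
  by (simp add: measure_def emeasure_act_image)

lemma distr_act:
  assumes g: "g \<in> carrier G"
  shows "distr M M (act g) = M"
proof (rule measure_eqI)
  fix A assume "A \<in> sets (distr M M (act g))"
  then have A: "A \<in> sets M" by simp
  have "act g -` A \<inter> space M = act (inv g) ` A"
    using A g sets.sets_into_space[OF A] by (subst act_image) (auto simp: space_M)
  then show "emeasure (distr M M (act g)) A = emeasure M A"
    using A g by (simp add: emeasure_distr act_measurable emeasure_act_image)
qed simp

lemma integral_act:
  fixes f :: "'x \<Rightarrow> 'y::{banach, second_countable_topology}"
  assumes g: "g \<in> carrier G" and f: "f \<in> borel_measurable M"
  shows "(LINT x|M. f (act g x)) = (LINT x|M. f x)"
  using integral_distr[OF act_measurable[OF g] f] by (simp add: distr_act[OF g])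

lemma integrable_act:
  fixes f :: "'x \<Rightarrow> 'y::{banach, second_countable_topology}"
  assumes g: "g \<in> carrier G" and f: "integrable M f"
  shows "integrable M (\<lambda>x. f (act g x))"
  using integrable_distr_eq[OF act_measurable[OF g] borel_measurable_integrable[OF f]] f
  by (simp add: distr_act[OF g])

definition tr :: "'a \<Rightarrow> ('x \<Rightarrow> complex) \<Rightarrow> 'x \<Rightarrow> complex"
  where "tr g f = (\<lambda>x. f (act (inv g) x))"

lemma tr_l2:
  assumes "g \<in> carrier G" "f \<in> l2_fun M"
  shows "tr g f \<in> l2_fun M"
  using assms integrable_act[OF inv_closed[OF assms(1)] l2_funD(2)[OF assms(2)]]
    measurable_compose[OF act_measurable[OF inv_closed[OF assms(1)]] l2_funD(1)[OF assms(2)]]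
  by (simp add: l2_fun_def tr_def)

lemma ip_tr:
  assumes "g \<in> carrier G" "f \<in> l2_fun M" "f' \<in> l2_fun M"
  shows "ip M (tr g f) (tr g f') = ip M f f'"
proof -
  note [measurable] = l2_funD(1)[OF assms(2)] l2_funD(1)[OF assms(3)]
  have "(\<lambda>x. f x * cnj (f' x)) \<in> borel_measurable M" by measurable
  from integral_act[OF inv_closed[OF assms(1)] this] show ?thesis
    by (simp add: ip_def tr_def)
qed

lemma l2n_tr:
  assumes "g \<in> carrier G" "f \<in> l2_fun M"
  shows "l2n M (tr g f) = l2n M f"
proof -
  note [measurable] = l2_funD(1)[OF assms(2)]
  have "(\<lambda>x. (cmod (f x))\<^sup>2) \<in> borel_measurable M" by measurable
  from integral_act[OF inv_closed[OF assms(1)] this] show ?thesis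
    by (simp add: l2n_def tr_def)
qed

lemma ip_tr_bound:
  assumes "g \<in> carrier G" "f \<in> l2_fun M" "f' \<in> l2_fun M"
  shows "cmod (ip M (tr g f) f') \<le> l2n M f * l2n M f'"
  using l2_cauchy_schwarz[OF tr_l2[OF assms(1,2)] assms(3)] l2n_tr[OF assms(1,2)] by simp

lemma ip_tr_left:
  assumes "g \<in> carrier G" "f \<in> l2_fun M" "f' \<in> l2_fun M"
  shows "ip M (tr g f) f' = ip M f (tr (inv g) f')"
proof -
  have "ip M (tr g f) f' = ip M (tr (inv g) (tr g f)) (tr (inv g) f')"
    using assms by (simp add: ip_tr tr_l2)
  also have "\<dots> = ip M f (tr (inv g) f')"
    unfolding ip_def using assms(1)
    by (intro Bochner_Integration.integral_cong) (simp_all add: tr_def space_M)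
  finally show ?thesis .
qed

lemma ip_tr_mult:
  assumes "g \<in> carrier G" "h \<in> carrier G"
  shows "ip M (tr (g \<otimes> h) f) f' = ip M (tr g (tr h f)) f'"
  unfolding ip_def using assms
  by (intro Bochner_Integration.integral_cong) (simp_all add: tr_def space_M inv_mult_group act_mult)

lemma tr_indicator:
  assumes "g \<in> carrier G" "A \<subseteq> topspace S" "x \<in> space M"
  shows "tr g (indicator A) x = indicator (act g ` A) x"
  using assms by (simp add: tr_def act_image space_M indicator_def)

lemma ip_tr_indicator:
  assumes "g \<in> carrier G" "A \<in> sets M" "B \<in> sets M"
  shows "ip M (tr g (indicator A)) (indicator B) = of_real (measure M (act g ` A \<inter> B))"
proof -
  have A: "A \<subseteq> topspace S"
    using sets.sets_into_space[OF assms(2)] by (simp add: space_M)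
  have "ip M (tr g (indicator A)) (indicator B)
      = (LINT x|M. complex_of_real (indicator (act g ` A \<inter> B) x))"
    unfolding ip_def
    by (intro Bochner_Integration.integral_cong) (auto simp: tr_indicator[OF assms(1) A] indicator_def)
  also have "\<dots> = of_real (measure M (act g ` A \<inter> B))"
    using act_image_sets[OF assms(1,2)] assms(3) sets.sets_into_space[OF assms(3)]
    by (simp add: Int_absorb2 le_infI2)
  finally show ?thesis .
qed

lemma act_tube:
  assumes "compactin T C" "compactin S L" "openin S W"
    and "\<And>g x. g \<in> C \<Longrightarrow> x \<in> L \<Longrightarrow> act g x \<in> W"
  shows "\<exists>U V. openin T U \<and> openin S V \<and> C \<subseteq> U \<and> L \<subseteq> V \<and> (\<forall>g\<in>U. \<forall>x\<in>V. act g x \<in> W)"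
proof -
  define P where "P = {p \<in> topspace (prod_topology T S). (\<lambda>(g, x). act g x) p \<in> W}"
  have "openin (prod_topology T S) P"
    unfolding P_def by (rule openin_continuous_map_preimage[OF act_continuous assms(3)])
  moreover have "C \<times> L \<subseteq> P"
    using assms compactin_subset_topspace[OF assms(1)] compactin_subset_topspace[OF assms(2)] by (auto simp: P_def)
  ultimately obtain U V where UV: "openin T U" "openin S V" "C \<subseteq> U" "L \<subseteq> V" "U \<times> V \<subseteq> P"
    using Wallace_theorem_prod_topology[OF assms(1,2)] by metis
  have "\<forall>g\<in>U. \<forall>x\<in>V. act g x \<in> W"
    using UV(5) by (auto simp: P_def)
  with UV show ?thesis
    by (intro exI[of _ U] exI[of _ V]) simp
qed

text \<open>The matrix coefficients of the Koopman representation are measurable. For indicators of open sets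
  inner regularity makes \<open>h \<mapsto> M (h U \<inter> B)\<close> lower semicontinuous; density does the rest.\<close>

lemma coefficient_open_measurable:
  assumes U: "openin S U" "emeasure M U < \<infinity>" and B: "openin S B"
  shows "(\<lambda>h. measure M (act h ` U \<inter> B)) \<in> borel_measurable (borel_of T)"
  unfolding borel_measurable_iff_greater
proof
  fix a
  let ?D = "{h \<in> space (borel_of T). a < measure M (act h ` U \<inter> B)}"
  have fin: "emeasure M (act h ` U \<inter> B) < \<infinity>" if "h \<in> carrier G" for h
    using le_less_trans[OF emeasure_mono[of "act h ` U \<inter> B" "act h ` U" M]] that U
    by (simp add: act_image_sets open_M emeasure_act_image)
  have "openin T ?D"
  proof (subst openin_subopen, safe)
    fix h0 assume "h0 \<in> space (borel_of T)" and a: "a < measure M (act h0 ` U \<inter> B)"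
    then have h0: "h0 \<in> carrier G" by (simp add: topspace_eq)
    obtain K where K: "compactin S K" "K \<subseteq> act h0 ` U \<inter> B"
      "measure M (act h0 ` U \<inter> B) - (measure M (act h0 ` U \<inter> B) - a) < measure M K"
      using inner_regular_compact[OF reg _ fin[OF h0], of "measure M (act h0 ` U \<inter> B) - a"] a
        open_act_image[OF h0 U(1)] B by (metis diff_gt_0_iff_gt openin_Int)
    have *: "act g x \<in> U" if "g \<in> {inv h0}" "x \<in> K" for g x
      using that K(2) h0 openin_subset[OF U(1)] by (auto simp: act_image)
    have cs: "compactin T {inv h0}"
      using h0 by (simp add: topspace_eq)
    obtain N V where N: "openin T N" "inv h0 \<in> N" "K \<subseteq> V" "\<And>g x. g \<in> N \<Longrightarrow> x \<in> V \<Longrightarrow> act g x \<in> U"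
      using act_tube[OF cs K(1) U(1) *] by (metis insert_subset)
    let ?N = "{h \<in> topspace T. inv h \<in> N}"
    have "?N \<subseteq> ?D"
    proof
      fix h assume h: "h \<in> ?N"
      then have hG: "h \<in> carrier G" by (simp add: topspace_eq)
      have "K \<subseteq> act h ` U \<inter> B"
        using N(3,4) h K(2) compactin_subset_topspace[OF K(1)] openin_subset[OF U(1)]
        by (auto simp: act_image[OF hG])
      then have "measure M K \<le> measure M (act h ` U \<inter> B)"
        using fin[OF hG] U B hG by (intro measure_mono_fmeasurable compact_M K(1))
           (auto simp: fmeasurable_def act_image_sets open_M)
      with K(3) h show "h \<in> ?D" by simp
    qed
    moreover have "openin T ?N"
      by (rule openin_continuous_map_preimage[OF continuous_inv N(1)])
    ultimately show "\<exists>N. openin T N \<and> h0 \<in> N \<and> N \<subseteq> ?D"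
      using h0 N(2) by (intro exI[of _ ?N]) (auto simp: topspace_eq)
  qed
  then show "?D \<in> sets (borel_of T)"
    by (rule openin_borel_of)
qed

lemma coefficient_measurable:
  assumes f: "f \<in> l2_fun M" and g: "g \<in> l2_fun M"
  shows "(\<lambda>h. ip M (tr h f) g) \<in> borel_measurable (borel_of T)"
proof -
  let ?m = "\<lambda>f g. (\<lambda>h. ip M (tr h f) g) \<in> borel_measurable (borel_of T)"
  have 1: "?m (indicator U) g" if U: "openin S U" "emeasure M U < \<infinity>" for U
    using reg g
  proof (induction rule: l2_open_induct)
    case (open_set B)
    have "(\<lambda>h. complex_of_real (measure M (act h ` U \<inter> B))) \<in> borel_measurable (borel_of T)"
      using coefficient_open_measurable[OF U open_set(1)] by measurable
    moreover have "complex_of_real (measure M (act h ` U \<inter> B)) = ip M (tr h (indicator U)) (indicator B)"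
      if "h \<in> space (borel_of T)" for h
      using that U open_set by (simp add: ip_tr_indicator open_M topspace_eq)
    ultimately show ?case
      by (subst (asm) measurable_cong) auto
  next
    have Ul2: "tr h (indicator U) \<in> l2_fun M" if "h \<in> space (borel_of T)" for h
      using that U by (intro tr_l2 indicator_l2_fun open_M) (auto simp: topspace_eq)
    {
      case (add f g)
      have "(\<lambda>h. ip M (tr h (indicator U)) f + ip M (tr h (indicator U)) g) \<in> borel_measurable (borel_of T)"
        using add.IH by measurable
      then show ?case
        by (subst measurable_cong[OF ip_add_right]) (use add.hyps Ul2 in auto)
    next
      case (scale c f)
      then show ?case
        unfolding ip_scale_right by measurable
    next
      case (lim s f)
      show ?case
      proof (rule borel_measurable_LIMSEQ_metric[OF lim.IH])
        fix h assume h: "h \<in> space (borel_of T)"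
        have "(\<lambda>n. cnj (ip M (s n) (tr h (indicator U)))) \<longlonglongrightarrow> cnj (ip M f (tr h (indicator U)))"
          by (intro tendsto_cnj tendsto_ip_left lim.hyps Ul2 h)
        then show "(\<lambda>n. ip M (tr h (indicator U)) (s n)) \<longlonglongrightarrow> ip M (tr h (indicator U)) f"
          by (simp add: ip_commute[symmetric])
      qed
    }
  qed
  from reg f show ?thesis
  proof (induction rule: l2_open_induct)
    case (open_set U)
    then show ?case by (rule 1)
  next
    case (add f f')
    have "(\<lambda>h. ip M (tr h f) g + ip M (tr h f') g) \<in> borel_measurable (borel_of T)"
      using add.IH by measurable
    moreover have "ip M (tr h (\<lambda>x. f x + f' x)) g = ip M (tr h f) g + ip M (tr h f') g"
      if "h \<in> space (borel_of T)" for h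
      using ip_add_left[OF tr_l2 tr_l2 g, of h f h f'] add.hyps that by (simp add: tr_def topspace_eq)
    ultimately show ?case
      by (subst measurable_cong) auto
  next
    case (scale c f)
    have "ip M (tr h (\<lambda>x. c * f x)) g = c * ip M (tr h f) g" for h
      using ip_scale_left[of M c "tr h f" g] by (simp add: tr_def)
    then show ?case
      using scale by simp
  next
    case (lim s f)
    show ?case
    proof (rule borel_measurable_LIMSEQ_metric[OF lim.IH])
      fix h assume "h \<in> space (borel_of T)"
      then have h: "h \<in> carrier G" by (simp add: topspace_eq)
      have "l2n M (\<lambda>x. tr h (s n) x - tr h f x) = l2n M (\<lambda>x. s n x - f x)" for n
        using l2n_tr[OF h l2_fun_diff[OF lim.hyps(1,2)], of n] by (simp add: tr_def)
      then show "(\<lambda>n. ip M (tr h (s n)) g) \<longlonglongrightarrow> ip M (tr h f) g"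
        using lim.hyps h g by (intro tendsto_ip_left tr_l2) auto
    qed
  qed
qed

text \<open>On a transitive space an invariant regular measure charges every nonempty open set, because
  finitely many translates of such a set cover any compact set.\<close>

lemma open_positive:
  assumes trans: "\<And>x y. x \<in> topspace S \<Longrightarrow> y \<in> topspace S \<Longrightarrow> \<exists>g\<in>carrier G. act g x = y"
    and nz: "emeasure M (space M) \<noteq> 0" and U: "openin S U" "U \<noteq> {}"
  shows "emeasure M U > 0"
proof (rule ccontr)
  assume "\<not> ?thesis"
  then have U0: "emeasure M U = 0" by simp
  obtain x0 where x0: "x0 \<in> U" "x0 \<in> topspace S"
    using U openin_subset by blast
  have K0: "emeasure M K = 0" if K: "compactin S K" for K
  proof -
    have "K \<subseteq> \<Union>((\<lambda>g. act g ` U) ` carrier G)"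
    proof
      fix y assume "y \<in> K"
      then obtain g where "g \<in> carrier G" "act g x0 = y"
        using trans[OF x0(2)] compactin_subset_topspace[OF K] by blast
      then show "y \<in> \<Union>((\<lambda>g. act g ` U) ` carrier G)"
        using x0(1) by auto
    qed
    then obtain F where F: "finite F" "F \<subseteq> (\<lambda>g. act g ` U) ` carrier G" "K \<subseteq> \<Union>F"
      using compactinD[OF K, of "(\<lambda>g. act g ` U) ` carrier G"] open_act_image[OF _ U(1)] by auto
    have FN: "A \<in> null_sets M" if "A \<in> F" for A
      using that F(2) U0 U(1) by (auto simp: null_sets_def act_image_sets open_M emeasure_act_image)
    have "\<Union>F \<in> null_sets M"
      using null_sets_UN'[of F "\<lambda>A. A" M] F(1) FN by (simp add: countable_finite)
    then show ?thesis
      using null_sets_subset[OF _ compact_M[OF K] F(3)] by auto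
  qed
  have "emeasure M (topspace S) = (SUP K\<in>{K. compactin S K \<and> K \<subseteq> topspace S}. emeasure M K)"
    using reg by (simp add: regular_borel_measure_def)
  also have "\<dots> = 0"
    using K0 by (auto simp: SUP_eq_iff bot_ennreal intro!: SUP_eqI)
  finally show False
    using nz by (simp add: space_M)
qed

end


section \<open>The operators of the Koopman representation\<close>

lemma l2_class_eq_iff:
  assumes "f \<in> l2_fun M" "g \<in> l2_fun M"
  shows "l2_class M f = l2_class M g \<longleftrightarrow> (AE x in M. f x = g x)"
  using eq_equiv_class_iff[OF equiv_l2_rel assms] assms by (simp add: l2_class_def l2_rel_def)

lemma l2_class_eqI:
  assumes f: "f \<in> l2_fun M" and g: "g \<in> l2_fun M"
    and eq: "\<And>\<eta>. \<eta> \<in> l2_fun M \<Longrightarrow> ip M f \<eta> = ip M g \<eta>"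
  shows "l2_class M f = l2_class M g"
proof -
  have d: "(\<lambda>x. f x - g x) \<in> l2_fun M" by (rule l2_fun_diff[OF f g])
  have "complex_of_real ((l2n M (\<lambda>x. f x - g x))\<^sup>2) = 0"
    using eq[OF d] ip_diff_left[OF f g d] by (simp add: ip_self[symmetric] del: of_real_power)
  then have "l2n M (\<lambda>x. f x - g x) = 0" by simp
  then show ?thesis
    using l2n_zero_iff[OF d] l2_class_eq_iff[OF f g] by simp
qed

lemma hinner_L2_ip: "f \<in> l2_fun M \<Longrightarrow> g \<in> l2_fun M \<Longrightarrow> hinner (L2 M) (l2_class M f) (l2_class M g) = ip M f g"
  by (simp add: hinner_L2_class ip_def)

lemma hnorm_L2_class: "f \<in> l2_fun M \<Longrightarrow> hnorm (L2 M) (l2_class M f) = l2n M f"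
  by (simp add: hnorm_def hinner_L2_ip ip_self)

lemma hadd_L2_class:
  assumes "f \<in> l2_fun M" "g \<in> l2_fun M"
  shows "hadd (L2 M) (l2_class M f) (l2_class M g) = l2_class M (\<lambda>x. f x + g x)"
proof -
  have r: "l2_rep (l2_class M f) \<in> l2_fun M" "l2_rep (l2_class M g) \<in> l2_fun M"
    by (simp_all add: assms l2_class_in_L2 L2_rep)
  have "AE x in M. l2_rep (l2_class M f) x + l2_rep (l2_class M g) x = f x + g x"
    using l2_rep_class_AE[OF assms(1)] l2_rep_class_AE[OF assms(2)] by eventually_elim simp
  then show ?thesis
    using l2_class_eq_iff[OF l2_fun_add[OF r] l2_fun_add[OF assms]] by (simp add: L2_def)
qed

lemma hscale_L2_class:
  assumes "f \<in> l2_fun M"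
  shows "hscale (L2 M) c (l2_class M f) = l2_class M (\<lambda>x. c * f x)"
proof -
  have r: "l2_rep (l2_class M f) \<in> l2_fun M"
    by (simp add: assms l2_class_in_L2 L2_rep)
  have "AE x in M. c * l2_rep (l2_class M f) x = c * f x"
    using l2_rep_class_AE[OF assms(1)] by eventually_elim simp
  then show ?thesis
    using l2_class_eq_iff[OF l2_fun_scale[OF r] l2_fun_scale[OF assms]] by (simp add: L2_def)
qed

lemma L2_cases: "\<xi> \<in> hcarrier (L2 M) \<Longrightarrow> \<exists>f. f \<in> l2_fun M \<and> \<xi> = l2_class M f"
  using L2_rep by metis

context mp_action
begin

lemma coefficient_bounded_integrable:
  assumes \<rho>: "sets \<rho> = sets (borel_of T)" and w: "integrable \<rho> w"
    and f: "f \<in> l2_fun M" "g \<in> l2_fun M"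
  shows "integrable \<rho> (\<lambda>h. w h * ip M (tr h f) g)"
    and "cmod (LINT h|\<rho>. w h * ip M (tr h f) g) \<le> (LINT h|\<rho>. cmod (w h)) * l2n M f * l2n M g"
proof -
  have [measurable]: "(\<lambda>h. ip M (tr h f) g) \<in> borel_measurable \<rho>"
    using coefficient_measurable[OF f] by (simp add: measurable_cong_sets[OF \<rho>])
  have wm [measurable]: "w \<in> borel_measurable \<rho>"
    using w by simp
  have sp: "space \<rho> = carrier G"
    using sets_eq_imp_space_eq[OF \<rho>] by (simp add: topspace_eq)
  have le: "cmod (w h * ip M (tr h f) g) \<le> cmod (w h) * (l2n M f * l2n M g)" if "h \<in> space \<rho>" for h
    using ip_tr_bound[OF _ f, of h] that sp by (simp add: norm_mult mult_left_mono)
  have i: "integrable \<rho> (\<lambda>h. cmod (w h) * (l2n M f * l2n M g))"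
    using w by simp
  show int: "integrable \<rho> (\<lambda>h. w h * ip M (tr h f) g)"
    by (rule Bochner_Integration.integrable_bound[OF i]) (use le in \<open>auto intro!: AE_I2 simp: norm_mult\<close>)
  have "cmod (LINT h|\<rho>. w h * ip M (tr h f) g) \<le> (LINT h|\<rho>. cmod (w h * ip M (tr h f) g))"
    by (rule integral_norm_bound)
  also have "\<dots> \<le> (LINT h|\<rho>. cmod (w h) * (l2n M f * l2n M g))"
    by (intro integral_mono integrable_norm int i le)
  finally show "cmod (LINT h|\<rho>. w h * ip M (tr h f) g) \<le> (LINT h|\<rho>. cmod (w h)) * l2n M f * l2n M g"
    by (simp add: mult.assoc)
qed

text \<open>The vector \<open>\<integral> w(h) \<pi>(h) f d\<rho>(h)\<close>. It is characterised by its inner products, as the weak definition does not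
  involve joint measurability of \<open>(h, x) \<mapsto> f (h\<^sup>-\<^sup>1 x)\<close>.\<close>

definition average :: "'a measure \<Rightarrow> ('a \<Rightarrow> complex) \<Rightarrow> ('x \<Rightarrow> complex) \<Rightarrow> 'x \<Rightarrow> complex"
  where "average \<rho> w f = (SOME F. F \<in> l2_fun M \<and>
    (\<forall>\<eta>\<in>l2_fun M. ip M F \<eta> = (LINT h|\<rho>. w h * ip M (tr h f) \<eta>)))"

lemma average:
  assumes \<rho>: "sets \<rho> = sets (borel_of T)" and w: "integrable \<rho> w" and f: "f \<in> l2_fun M"
  shows average_l2: "average \<rho> w f \<in> l2_fun M"
    and ip_average: "\<And>\<eta>. \<eta> \<in> l2_fun M \<Longrightarrow> ip M (average \<rho> w f) \<eta> = (LINT h|\<rho>. w h * ip M (tr h f) \<eta>)"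
proof -
  let ?L = "\<lambda>\<eta>. cnj (LINT h|\<rho>. w h * ip M (tr h f) \<eta>)"
  have sp: "space \<rho> = carrier G"
    using sets_eq_imp_space_eq[OF \<rho>] by (simp add: topspace_eq)
  obtain F where F: "F \<in> l2_fun M" "\<And>\<eta>. \<eta> \<in> l2_fun M \<Longrightarrow> ?L \<eta> = ip M \<eta> F"
  proof (rule l2_riesz[where L = ?L and B = "(LINT h|\<rho>. cmod (w h)) * l2n M f"])
    fix \<eta> \<zeta> assume *: "\<eta> \<in> l2_fun M" "\<zeta> \<in> l2_fun M"
    have "(LINT h|\<rho>. w h * ip M (tr h f) (\<lambda>x. \<eta> x + \<zeta> x))
        = (LINT h|\<rho>. w h * ip M (tr h f) \<eta> + w h * ip M (tr h f) \<zeta>)"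
      using * f sp by (intro Bochner_Integration.integral_cong) (simp_all add: ip_add_right tr_l2 distrib_left)
    also have "\<dots> = (LINT h|\<rho>. w h * ip M (tr h f) \<eta>) + (LINT h|\<rho>. w h * ip M (tr h f) \<zeta>)"
      by (intro Bochner_Integration.integral_add coefficient_bounded_integrable(1) \<rho> w f *)
    finally show "?L (\<lambda>x. \<eta> x + \<zeta> x) = ?L \<eta> + ?L \<zeta>" by simp
  next
    fix c \<eta> assume *: "\<eta> \<in> l2_fun M"
    show "?L (\<lambda>x. c * \<eta> x) = c * ?L \<eta>"
      by (simp add: ip_scale_right mult.left_commute)
  next
    fix \<eta> assume *: "\<eta> \<in> l2_fun M"
    show "cmod (?L \<eta>) \<le> (LINT h|\<rho>. cmod (w h)) * l2n M f * l2n M \<eta>"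
      using coefficient_bounded_integrable(2)[OF \<rho> w f *] by simp
  qed blast
  have "ip M F \<eta> = (LINT h|\<rho>. w h * ip M (tr h f) \<eta>)" if "\<eta> \<in> l2_fun M" for \<eta>
    using F(2)[OF that] ip_commute[of M F \<eta>] by (metis complex_cnj_cnj)
  then have "\<exists>F. F \<in> l2_fun M \<and> (\<forall>\<eta>\<in>l2_fun M. ip M F \<eta> = (LINT h|\<rho>. w h * ip M (tr h f) \<eta>))"
    using F(1) by blast
  then have *: "average \<rho> w f \<in> l2_fun M \<and>
      (\<forall>\<eta>\<in>l2_fun M. ip M (average \<rho> w f) \<eta> = (LINT h|\<rho>. w h * ip M (tr h f) \<eta>))"
    unfolding average_def by (rule someI_ex)
  show "average \<rho> w f \<in> l2_fun M"
    using * by (rule conjunct1)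
  show "ip M (average \<rho> w f) \<eta> = (LINT h|\<rho>. w h * ip M (tr h f) \<eta>)" if "\<eta> \<in> l2_fun M" for \<eta>
    using conjunct2[OF *] that by (rule bspec)
qed

lemma l2n_average_le:
  assumes \<rho>: "sets \<rho> = sets (borel_of T)" and w: "integrable \<rho> w" and f: "f \<in> l2_fun M"
  shows "l2n M (average \<rho> w f) \<le> (LINT h|\<rho>. cmod (w h)) * l2n M f"
proof -
  let ?F = "average \<rho> w f"
  note F = average_l2[OF assms]
  have "(l2n M ?F)\<^sup>2 = cmod (ip M ?F ?F)"
    by (simp add: ip_self norm_power)
  also have "\<dots> \<le> (LINT h|\<rho>. cmod (w h)) * l2n M f * l2n M ?F"
    unfolding ip_average[OF assms F] by (rule coefficient_bounded_integrable(2)[OF assms F])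
  finally have *: "l2n M ?F * l2n M ?F \<le> ((LINT h|\<rho>. cmod (w h)) * l2n M f) * l2n M ?F"
    by (simp add: power2_eq_square)
  show ?thesis
  proof (cases "l2n M ?F = 0")
    case True
    then show ?thesis by simp
  next
    case False
    then have "l2n M ?F > 0" using l2n_nonneg[of M ?F] by linarith
    with * show ?thesis by simp
  qed
qed

lemma average_cong:
  assumes \<rho>: "sets \<rho> = sets (borel_of T)" and w: "integrable \<rho> w"
    and f: "f \<in> l2_fun M" "f' \<in> l2_fun M" and eq: "AE x in M. f x = f' x"
  shows "l2_class M (average \<rho> w f) = l2_class M (average \<rho> w f')"
proof (rule l2_class_eqI)
  fix \<eta> assume \<eta>: "\<eta> \<in> l2_fun M"
  have sp: "space \<rho> = carrier G"
    using sets_eq_imp_space_eq[OF \<rho>] by (simp add: topspace_eq)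
  have "ip M (tr h f) \<eta> = ip M (tr h f') \<eta>" if "h \<in> carrier G" for h
    unfolding ip_tr_left[OF that f(1) \<eta>] ip_tr_left[OF that f(2) \<eta>]
    using that eq \<eta> f by (intro ip_cong_AE tr_l2) auto
  then show "ip M (average \<rho> w f) \<eta> = ip M (average \<rho> w f') \<eta>"
    unfolding ip_average[OF \<rho> w f(1) \<eta>] ip_average[OF \<rho> w f(2) \<eta>]
    by (intro lint_cong) (simp add: sp)
qed (auto intro!: average_l2[OF \<rho> w] f)

lemma average_add:
  assumes \<rho>: "sets \<rho> = sets (borel_of T)" and w: "integrable \<rho> w" and f: "f \<in> l2_fun M" "g \<in> l2_fun M"
  shows "l2_class M (average \<rho> w (\<lambda>x. f x + g x)) = l2_class M (\<lambda>x. average \<rho> w f x + average \<rho> w g x)"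
proof (rule l2_class_eqI)
  fix \<eta> assume \<eta>: "\<eta> \<in> l2_fun M"
  have sp: "space \<rho> = carrier G"
    using sets_eq_imp_space_eq[OF \<rho>] by (simp add: topspace_eq)
  have "ip M (tr h (\<lambda>x. f x + g x)) \<eta> = ip M (tr h f) \<eta> + ip M (tr h g) \<eta>" if "h \<in> carrier G" for h
    using ip_add_left[OF tr_l2 tr_l2 \<eta>, of h f h g] that f by (simp add: tr_def)
  then have "(LINT h|\<rho>. w h * ip M (tr h (\<lambda>x. f x + g x)) \<eta>)
      = (LINT h|\<rho>. w h * ip M (tr h f) \<eta> + w h * ip M (tr h g) \<eta>)"
    using sp by (intro Bochner_Integration.integral_cong) (simp_all add: distrib_left)
  also have "\<dots> = (LINT h|\<rho>. w h * ip M (tr h f) \<eta>) + (LINT h|\<rho>. w h * ip M (tr h g) \<eta>)"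
    by (intro Bochner_Integration.integral_add coefficient_bounded_integrable(1) \<rho> w f \<eta>)
  finally show "ip M (average \<rho> w (\<lambda>x. f x + g x)) \<eta> = ip M (\<lambda>x. average \<rho> w f x + average \<rho> w g x) \<eta>"
    using f \<eta> by (simp add: ip_average ip_add_left average_l2 \<rho> w l2_fun_add)
qed (auto intro!: average_l2[OF \<rho> w] f l2_fun_add)

lemma average_scale:
  assumes \<rho>: "sets \<rho> = sets (borel_of T)" and w: "integrable \<rho> w" and f: "f \<in> l2_fun M"
  shows "l2_class M (average \<rho> w (\<lambda>x. c * f x)) = l2_class M (\<lambda>x. c * average \<rho> w f x)"
proof (rule l2_class_eqI)
  fix \<eta> assume \<eta>: "\<eta> \<in> l2_fun M"
  have "ip M (tr h (\<lambda>x. c * f x)) \<eta> = c * ip M (tr h f) \<eta>" for h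
    using ip_scale_left[of M c "tr h f" \<eta>] by (simp add: tr_def)
  then show "ip M (average \<rho> w (\<lambda>x. c * f x)) \<eta> = ip M (\<lambda>x. c * average \<rho> w f x) \<eta>"
    using f \<eta> by (simp add: ip_average ip_scale_left \<rho> w l2_fun_scale mult.left_commute)
qed (auto intro!: average_l2[OF \<rho> w] f l2_fun_scale)

text \<open>On a subspace \<open>C\<close> that is invariant under averaging, averaging with weight \<open>1\<close> is an operator with the required
  inner products, and it is the only one: the difference of the values of two such operators at a point of
  \<open>C\<close> lies in \<open>C\<close> and is orthogonal to itself.\<close>

lemma integrated_op_koopman:
  fixes C
  defines "E \<equiv> (L2 M)\<lparr>hcarrier := C\<rparr>"
  assumes \<rho>: "sets \<rho> = sets (borel_of T)" and fin: "finite_measure \<rho>"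
    and C: "C \<subseteq> hcarrier (L2 M)"
    and C_add: "\<forall>\<xi>\<in>C. \<forall>\<eta>\<in>C. hadd (L2 M) \<xi> \<eta> \<in> C"
    and C_scale: "\<forall>c. \<forall>\<xi>\<in>C. hscale (L2 M) c \<xi> \<in> C"
    and C_average: "\<forall>f\<in>l2_fun M. l2_class M f \<in> C \<longrightarrow> l2_class M (average \<rho> (\<lambda>_. 1) f) \<in> C"
  shows "bounded_op E (integrated_op E (koopman G act M) \<rho>)"
    and "\<And>f. f \<in> l2_fun M \<Longrightarrow> l2_class M f \<in> C \<Longrightarrow>
      integrated_op E (koopman G act M) \<rho> (l2_class M f) = l2_class M (average \<rho> (\<lambda>_. 1) f)"
proof -
  interpret finite_measure \<rho> by (rule fin)
  have w: "integrable \<rho> (\<lambda>_. 1 :: complex)" by simp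
  let ?a = "average \<rho> (\<lambda>_. 1)"
  have sp: "space \<rho> = carrier G"
    using sets_eq_imp_space_eq[OF \<rho>] by (simp add: topspace_eq)
  have E [simp]: "hcarrier E = C" "hadd E = hadd (L2 M)" "hscale E = hscale (L2 M)" "hinner E = hinner (L2 M)"
    "hnorm E = hnorm (L2 M)"
    by (simp_all add: E_def hnorm_def fun_eq_iff)
  have kc: "koopman G act M g (l2_class M f) = l2_class M (tr g f)" if "g \<in> carrier G" "f \<in> l2_fun M" for f g
    using koopman_class[of f M act G g] act_measurable[of "inv g"] distr_act[of "inv g"] that by (simp add: tr_def)
  have cof: "(LINT g|\<rho>. hinner (L2 M) (koopman G act M g (l2_class M f)) (l2_class M \<eta>)) = ip M (?a f) \<eta>"
    if "f \<in> l2_fun M" "\<eta> \<in> l2_fun M" for f \<eta>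
    unfolding ip_average[OF \<rho> w that]
    by (intro lint_cong) (simp add: that sp kc hinner_L2_ip tr_l2)
  define A where "A = (\<lambda>\<xi>\<in>C. l2_class M (?a (l2_rep \<xi>)))"
  have A: "A (l2_class M f) = l2_class M (?a f)" if "f \<in> l2_fun M" "l2_class M f \<in> C" for f
  proof -
    have "A (l2_class M f) = l2_class M (?a (l2_rep (l2_class M f)))"
      using that(2) by (simp add: A_def)
    also have "\<dots> = l2_class M (?a f)"
      by (rule average_cong[OF \<rho> w L2_rep(1)[OF l2_class_in_L2[OF that(1)]] that(1) l2_rep_class_AE[OF that(1)]])
    finally show ?thesis .
  qed
  have cls: "\<exists>f. f \<in> l2_fun M \<and> \<xi> = l2_class M f" if "\<xi> \<in> C" for \<xi>
    using C that L2_cases by blast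
  have bA: "bounded_op E A"
    unfolding bounded_op_def
  proof (intro conjI ballI allI)
    show "A \<in> hcarrier E \<rightarrow>\<^sub>E hcarrier E"
    proof (rule PiE_I)
      fix \<xi> assume "\<xi> \<in> hcarrier E"
      then show "A \<xi> \<in> hcarrier E"
        using cls[of \<xi>] C_average A by auto
    qed (simp add: A_def)
    fix \<xi> \<eta> assume "\<xi> \<in> hcarrier E" "\<eta> \<in> hcarrier E"
    then obtain f g where fg: "f \<in> l2_fun M" "\<xi> = l2_class M f" "l2_class M f \<in> C"
      "g \<in> l2_fun M" "\<eta> = l2_class M g" "l2_class M g \<in> C"
      using cls[of \<xi>] cls[of \<eta>] by auto
    have "l2_class M (\<lambda>x. f x + g x) \<in> C"
      using C_add[rule_format, OF fg(3,6)] fg by (simp add: hadd_L2_class)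
    then show "A (hadd E \<xi> \<eta>) = hadd E (A \<xi>) (A \<eta>)"
      using fg by (simp add: hadd_L2_class A l2_fun_add average_l2 average_add \<rho> w)
  next
    fix c \<xi> assume "\<xi> \<in> hcarrier E"
    then obtain f where fg: "f \<in> l2_fun M" "\<xi> = l2_class M f" "l2_class M f \<in> C"
      using cls[of \<xi>] by auto
    have "l2_class M (\<lambda>x. c * f x) \<in> C"
      using C_scale[rule_format, OF fg(3)] fg by (simp add: hscale_L2_class)
    then show "A (hscale E c \<xi>) = hscale E c (A \<xi>)"
      using fg by (simp add: hscale_L2_class A l2_fun_scale average_l2 average_scale \<rho> w)
  next
    show "\<exists>B. \<forall>\<xi>\<in>hcarrier E. hnorm E (A \<xi>) \<le> B * hnorm E \<xi>"
    proof (intro exI ballI)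
      fix \<xi> assume "\<xi> \<in> hcarrier E"
      then obtain f where fg: "f \<in> l2_fun M" "\<xi> = l2_class M f" "l2_class M f \<in> C"
        using cls[of \<xi>] by auto
      then show "hnorm E (A \<xi>) \<le> (LINT h|\<rho>. cmod 1) * hnorm E \<xi>"
        using l2n_average_le[OF \<rho> w fg(1)] by (simp add: A hnorm_L2_class average_l2 \<rho> w)
    qed
  qed
  have spec: "hinner E (A \<xi>) \<eta> = (LINT g|\<rho>. hinner E (koopman G act M g \<xi>) \<eta>)"
    if "\<xi> \<in> hcarrier E" "\<eta> \<in> hcarrier E" for \<xi> \<eta>
  proof -
    obtain f g where fg: "f \<in> l2_fun M" "\<xi> = l2_class M f" "l2_class M f \<in> C"
      "g \<in> l2_fun M" "\<eta> = l2_class M g" "l2_class M g \<in> C"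
      using \<open>\<xi> \<in> hcarrier E\<close> \<open>\<eta> \<in> hcarrier E\<close> cls[of \<xi>] cls[of \<eta>] by auto
    then show ?thesis
      by (simp add: cof A hinner_L2_ip average_l2 \<rho> w)
  qed
  have eq: "integrated_op E (koopman G act M) \<rho> = A"
    unfolding integrated_op_def
  proof (rule the_equality)
    show "bounded_op E A \<and> (\<forall>\<xi>\<in>hcarrier E. \<forall>\<eta>\<in>hcarrier E.
        hinner E (A \<xi>) \<eta> = (LINT g|\<rho>. hinner E (koopman G act M g \<xi>) \<eta>))"
      using bA spec by blast
    fix A' assume A': "bounded_op E A' \<and> (\<forall>\<xi>\<in>hcarrier E. \<forall>\<eta>\<in>hcarrier E.
        hinner E (A' \<xi>) \<eta> = (LINT g|\<rho>. hinner E (koopman G act M g \<xi>) \<eta>))"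
    show "A' = A"
    proof (rule PiE_ext[of _ C "\<lambda>_. C"])
      show "A' \<in> C \<rightarrow>\<^sub>E C" "A \<in> C \<rightarrow>\<^sub>E C"
        using A' bA by (auto simp: bounded_op_def)
      fix \<xi> assume \<xi>: "\<xi> \<in> C"
      have "A' \<xi> \<in> C" "A \<xi> \<in> C"
        using A' bA \<xi> by (auto simp: bounded_op_def)
      then obtain f g where fg: "f \<in> l2_fun M" "A' \<xi> = l2_class M f" "l2_class M f \<in> C"
        "g \<in> l2_fun M" "A \<xi> = l2_class M g" "l2_class M g \<in> C"
        using cls[of "A' \<xi>"] cls[of "A \<xi>"] by auto
      let ?d = "\<lambda>x. f x + (-1) * g x"
      have d: "?d \<in> l2_fun M"
        using fg by (intro l2_fun_add l2_fun_scale)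
      have "l2_class M ?d \<in> C"
        using C_add[rule_format, OF fg(3) C_scale[rule_format, OF fg(6), of "-1"]] fg l2_fun_scale[OF fg(4), of "-1"]
        by (simp add: hadd_L2_class hscale_L2_class)
      then have "hinner E (A' \<xi>) (l2_class M ?d) = hinner E (A \<xi>) (l2_class M ?d)"
        using A' spec \<xi> by simp
      then have eq: "ip M f ?d = ip M g ?d"
        using fg d by (simp add: hinner_L2_ip)
      have "ip M ?d ?d = ip M f ?d + (-1) * ip M g ?d"
        using ip_add_left[OF fg(1) l2_fun_scale[OF fg(4), of "-1"] d] ip_scale_left[of M "-1" g ?d] by simp
      then have "l2n M ?d = 0"
        using eq by (simp add: ip_self)
      then have "AE x in M. f x = g x"
        using l2n_zero_iff[OF d] by simp
      then show "A' \<xi> = A \<xi>"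
        using fg by (simp add: l2_class_eq_iff)
    qed
  qed
  show "bounded_op E (integrated_op E (koopman G act M) \<rho>)"
    unfolding eq by (rule bA)
  show "\<And>f. f \<in> l2_fun M \<Longrightarrow> l2_class M f \<in> C \<Longrightarrow>
      integrated_op E (koopman G act M) \<rho> (l2_class M f) = l2_class M (?a f)"
    unfolding eq by (rule A)
qed

end

text \<open>The following lemmas translate bounds for the operator norm into bounds for functions, so that equivalence
  classes need not be mentioned afterwards.\<close>

lemma opnorm_bounds:
  fixes M C
  defines "E \<equiv> (L2 M)\<lparr>hcarrier := C\<rparr>"
  assumes C: "C \<subseteq> hcarrier (L2 M)" and A: "bounded_op E A"
  shows opnorm_upper: "\<And>\<xi>. \<xi> \<in> C \<Longrightarrow> hnorm (L2 M) \<xi> \<le> 1 \<Longrightarrow> hnorm (L2 M) (A \<xi>) \<le> opnorm E A"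
    and opnorm_nonneg: "l2_class M (\<lambda>_. 0) \<in> C \<Longrightarrow> 0 \<le> opnorm E A"
proof -
  have E [simp]: "hcarrier E = C" "hnorm E = hnorm (L2 M)"
    by (simp_all add: E_def hnorm_def fun_eq_iff)
  obtain B where "\<forall>\<xi>\<in>C. hnorm (L2 M) (A \<xi>) \<le> B * hnorm (L2 M) \<xi>"
    using A by (auto simp: bounded_op_def)
  then have B: "hnorm (L2 M) (A \<xi>) \<le> B * hnorm (L2 M) \<xi>" if "\<xi> \<in> C" for \<xi>
    using that by blast
  have nn: "hnorm (L2 M) \<xi> \<ge> 0" if "\<xi> \<in> C" for \<xi>
    using subsetD[OF C that] L2_cases[of \<xi> M] by (auto simp: hnorm_L2_class)
  have bdd: "bdd_above ((\<lambda>\<xi>. hnorm E (A \<xi>)) ` {\<xi> \<in> hcarrier E. hnorm E \<xi> \<le> 1})"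
  proof (rule bdd_aboveI2)
    fix \<xi> assume *: "\<xi> \<in> {\<xi> \<in> hcarrier E. hnorm E \<xi> \<le> 1}"
    then have "B * hnorm (L2 M) \<xi> \<le> \<bar>B\<bar> * 1"
      using nn[of \<xi>] by (intro mult_mono) auto
    then show "hnorm E (A \<xi>) \<le> \<bar>B\<bar>"
      using B[of \<xi>] * by simp
  qed
  show up: "hnorm (L2 M) (A \<xi>) \<le> opnorm E A" if "\<xi> \<in> C" "hnorm (L2 M) \<xi> \<le> 1" for \<xi>
  proof -
    have "hnorm E (A \<xi>) \<le> opnorm E A"
      unfolding opnorm_def using that by (intro cSUP_upper bdd) auto
    then show ?thesis by simp
  qed
  show "0 \<le> opnorm E A" if z: "l2_class M (\<lambda>_. 0) \<in> C"
  proof -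
    have "hnorm (L2 M) (l2_class M (\<lambda>_. 0)) = 0"
      by (simp add: hnorm_L2_class l2n_def)
    moreover have "A (l2_class M (\<lambda>_. 0)) \<in> C"
      using A z by (auto simp: bounded_op_def)
    ultimately show ?thesis
      using up[OF z] nn[of "A (l2_class M (\<lambda>_. 0))"] by simp
  qed
qed

lemma opnorm_ge:
  fixes M C
  defines "E \<equiv> (L2 M)\<lparr>hcarrier := C\<rparr>"
  assumes C: "C \<subseteq> hcarrier (L2 M)" and C_scale: "\<forall>c. \<forall>\<xi>\<in>C. hscale (L2 M) c \<xi> \<in> C"
    and A: "bounded_op E A" and f: "f \<in> l2_fun M" "l2_class M f \<in> C" and a: "a \<in> l2_fun M" "A (l2_class M f) = l2_class M a"
  shows "l2n M a \<le> opnorm E A * l2n M f"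
proof -
  have E [simp]: "hcarrier E = C" "hscale E = hscale (L2 M)" "hnorm E = hnorm (L2 M)"
    by (simp_all add: E_def hnorm_def fun_eq_iff)
  show ?thesis
  proof (cases "l2n M f = 0")
    case True
    obtain B where "\<forall>\<xi>\<in>C. hnorm (L2 M) (A \<xi>) \<le> B * hnorm (L2 M) \<xi>"
      using A by (auto simp: bounded_op_def)
    then have "hnorm (L2 M) (A (l2_class M f)) \<le> B * hnorm (L2 M) (l2_class M f)"
      using f(2) by blast
    then show ?thesis
      using True a f by (simp add: hnorm_L2_class)
  next
    case False
    then have pos: "l2n M f > 0" using l2n_nonneg[of M f] by linarith
    let ?c = "complex_of_real (inverse (l2n M f))"
    let ?\<xi> = "hscale (L2 M) ?c (l2_class M f)"
    have \<xi>: "?\<xi> \<in> C" by (rule C_scale[rule_format, OF f(2)])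
    have "hnorm (L2 M) ?\<xi> = 1"
      using pos f(1) by (simp add: hscale_L2_class hnorm_L2_class l2_fun_scale l2n_scale norm_inverse)
    then have "hnorm (L2 M) (A ?\<xi>) \<le> opnorm E A"
      using opnorm_upper[OF C A[unfolded E_def] \<xi>] by (simp add: E_def)
    moreover have "A ?\<xi> = hscale (L2 M) ?c (l2_class M a)"
      using A f(2) a(2) by (simp add: bounded_op_def)
    ultimately have "inverse (l2n M f) * l2n M a \<le> opnorm E A"
      using pos a(1) by (simp add: hscale_L2_class hnorm_L2_class l2_fun_scale l2n_scale norm_inverse)
    then show ?thesis
      using pos by (simp add: field_simps)
  qed
qed

lemma opnorm_le:
  fixes M C
  defines "E \<equiv> (L2 M)\<lparr>hcarrier := C\<rparr>"
  assumes C: "C \<subseteq> hcarrier (L2 M)" and zero: "l2_class M (\<lambda>_. 0) \<in> C" and K: "0 \<le> K"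
    and le: "\<And>f. f \<in> l2_fun M \<Longrightarrow> l2_class M f \<in> C \<Longrightarrow> hnorm (L2 M) (A (l2_class M f)) \<le> K * l2n M f"
  shows "opnorm E A \<le> K"
  unfolding opnorm_def
proof (rule cSUP_least)
  have E: "hcarrier E = C" "hnorm E = hnorm (L2 M)"
    by (simp_all add: E_def hnorm_def fun_eq_iff)
  have "l2n M (\<lambda>_. 0) = 0" by (simp add: l2n_def)
  then have "l2_class M (\<lambda>_. 0) \<in> {\<xi> \<in> hcarrier E. hnorm E \<xi> \<le> 1}"
    using zero by (simp add: E hnorm_L2_class)
  then show "{\<xi> \<in> hcarrier E. hnorm E \<xi> \<le> 1} \<noteq> {}" by blast
  fix \<xi> assume "\<xi> \<in> {\<xi> \<in> hcarrier E. hnorm E \<xi> \<le> 1}"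
  then have \<xi>: "\<xi> \<in> C" "hnorm (L2 M) \<xi> \<le> 1" by (simp_all add: E)
  then obtain f where f: "f \<in> l2_fun M" "\<xi> = l2_class M f" "l2_class M f \<in> C" "l2n M f \<le> 1"
    using L2_cases[OF subsetD[OF C \<xi>(1)]] by (auto simp: hnorm_L2_class)
  have "hnorm E (A \<xi>) \<le> K * l2n M f"
    using le f by (simp add: E)
  also have "\<dots> \<le> K"
    using f(4) K mult_left_mono[of "l2n M f" 1 K] by simp
  finally show "hnorm E (A \<xi>) \<le> K" .
qed

context mp_action
begin

lemma opnorm_L2_le:
  assumes \<rho>: "sets \<rho> = sets (borel_of T)" "finite_measure \<rho>" and K: "0 \<le> K"
    and le: "\<And>f. f \<in> l2_fun M \<Longrightarrow> l2n M (average \<rho> (\<lambda>_. 1) f) \<le> K * l2n M f"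
  shows "opnorm (L2 M) (integrated_op (L2 M) (koopman G act M) \<rho>) \<le> K"
proof -
  interpret finite_measure \<rho> by (rule \<rho>(2))
  have w: "integrable \<rho> (\<lambda>_. 1 :: complex)" by simp
  let ?C = "hcarrier (L2 M)"
  have E: "(L2 M)\<lparr>hcarrier := ?C\<rparr> = L2 M" by simp
  have add: "\<forall>\<xi>\<in>?C. \<forall>\<eta>\<in>?C. hadd (L2 M) \<xi> \<eta> \<in> ?C"
  proof (intro ballI)
    fix \<xi> \<eta> assume "\<xi> \<in> ?C" "\<eta> \<in> ?C"
    then obtain f g where "f \<in> l2_fun M" "\<xi> = l2_class M f" "g \<in> l2_fun M" "\<eta> = l2_class M g"
      using L2_cases by blast
    then show "hadd (L2 M) \<xi> \<eta> \<in> ?C" by (simp add: hadd_L2_class l2_class_in_L2 l2_fun_add)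
  qed
  have scale: "\<forall>c. \<forall>\<xi>\<in>?C. hscale (L2 M) c \<xi> \<in> ?C"
  proof (intro allI ballI)
    fix c \<xi> assume "\<xi> \<in> ?C"
    then obtain f where "f \<in> l2_fun M" "\<xi> = l2_class M f"
      using L2_cases by blast
    then show "hscale (L2 M) c \<xi> \<in> ?C" by (simp add: hscale_L2_class l2_class_in_L2 l2_fun_scale)
  qed
  have avg: "\<forall>f\<in>l2_fun M. l2_class M f \<in> ?C \<longrightarrow> l2_class M (average \<rho> (\<lambda>_. 1) f) \<in> ?C"
    using l2_class_in_L2 average_l2[OF \<rho>(1) w] by blast
  note op = integrated_op_koopman[OF \<rho> subset_refl add scale avg, unfolded E]
  have "opnorm ((L2 M)\<lparr>hcarrier := ?C\<rparr>) (integrated_op (L2 M) (koopman G act M) \<rho>) \<le> K"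
  proof (rule opnorm_le[OF subset_refl _ K])
    fix f assume f: "f \<in> l2_fun M" "l2_class M f \<in> hcarrier (L2 M)"
    then show "hnorm (L2 M) (integrated_op (L2 M) (koopman G act M) \<rho> (l2_class M f)) \<le> K * l2n M f"
      using le[OF f(1)] by (simp add: op(2) hnorm_L2_class average_l2[OF \<rho>(1) w])
  qed (simp add: l2_class_in_L2)
  then show ?thesis by (simp only: E)
qed

text \<open>Having mean zero is orthogonality to the constant function \<open>1\<close>, a property that averaging preserves because
  \<open>1\<close> is invariant.\<close>

lemma opnorm_L2_0_ge:
  assumes \<rho>: "sets \<rho> = sets (borel_of T)" "finite_measure \<rho>" and M: "prob_space M"
  defines "c \<equiv> opnorm (L2_0 M) (integrated_op (L2_0 M) (koopman G act M) \<rho>)"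
  shows "\<And>f. f \<in> l2_fun M \<Longrightarrow> (LINT x|M. f x) = 0 \<Longrightarrow> l2n M (average \<rho> (\<lambda>_. 1) f) \<le> c * l2n M f"
    and "0 \<le> c"
proof -
  interpret finite_measure \<rho> by (rule \<rho>(2))
  interpret M: prob_space M by (rule M)
  have w: "integrable \<rho> (\<lambda>_. 1 :: complex)" by simp
  have one: "(\<lambda>_. 1) \<in> l2_fun M" by (simp add: l2_fun_def)
  have int: "(LINT x|M. f x) = ip M f (\<lambda>_. 1)" for f by (simp add: ip_def)
  define C where "C = {\<xi> \<in> hcarrier (L2 M). (LINT x|M. l2_rep \<xi> x) = 0}"
  have E: "(L2 M)\<lparr>hcarrier := C\<rparr> = L2_0 M" by (simp add: L2_0_def C_def)
  have C: "l2_class M f \<in> C \<longleftrightarrow> (LINT x|M. f x) = 0" if f: "f \<in> l2_fun M" for f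
  proof -
    have "(LINT x|M. l2_rep (l2_class M f) x) = (LINT x|M. f x)"
      unfolding int
      by (rule ip_cong_AE) (simp_all add: f one L2_rep l2_class_in_L2 l2_rep_class_AE)
    then show ?thesis by (simp add: C_def l2_class_in_L2 f)
  qed
  have CL: "C \<subseteq> hcarrier (L2 M)" by (auto simp: C_def)
  have cls: "\<exists>f. f \<in> l2_fun M \<and> \<xi> = l2_class M f \<and> ip M f (\<lambda>_. 1) = 0" if "\<xi> \<in> C" for \<xi>
  proof -
    obtain f where "f \<in> l2_fun M" "\<xi> = l2_class M f"
      using L2_cases[OF subsetD[OF CL \<open>\<xi> \<in> C\<close>]] by blast
    with C[of f] that show ?thesis by (auto simp: int)
  qed
  have add: "\<forall>\<xi>\<in>C. \<forall>\<eta>\<in>C. hadd (L2 M) \<xi> \<eta> \<in> C"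
  proof (intro ballI)
    fix \<xi> \<eta> assume "\<xi> \<in> C" "\<eta> \<in> C"
    then obtain f g where "f \<in> l2_fun M" "\<xi> = l2_class M f" "ip M f (\<lambda>_. 1) = 0"
      "g \<in> l2_fun M" "\<eta> = l2_class M g" "ip M g (\<lambda>_. 1) = 0"
      using cls by blast
    then show "hadd (L2 M) \<xi> \<eta> \<in> C" by (simp add: hadd_L2_class C l2_fun_add int ip_add_left one)
  qed
  have scale: "\<forall>c. \<forall>\<xi>\<in>C. hscale (L2 M) c \<xi> \<in> C"
  proof (intro allI ballI)
    fix c \<xi> assume "\<xi> \<in> C"
    then obtain f where "f \<in> l2_fun M" "\<xi> = l2_class M f" "ip M f (\<lambda>_. 1) = 0"
      using cls by blast
    then show "hscale (L2 M) c \<xi> \<in> C" by (simp add: hscale_L2_class C l2_fun_scale int ip_scale_left)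
  qed
  have sp: "space \<rho> = carrier G"
    using sets_eq_imp_space_eq[OF \<rho>(1)] by (simp add: topspace_eq)
  have avg: "\<forall>f\<in>l2_fun M. l2_class M f \<in> C \<longrightarrow> l2_class M (average \<rho> (\<lambda>_. 1) f) \<in> C"
  proof (intro ballI impI)
    fix f assume f: "f \<in> l2_fun M" "l2_class M f \<in> C"
    have "ip M (tr h f) (\<lambda>_. 1) = 0" if "h \<in> carrier G" for h
      using ip_tr[OF that f(1) one] f by (simp add: C int tr_def)
    then have "(LINT h|\<rho>. 1 * ip M (tr h f) (\<lambda>_. 1)) = (LINT h|\<rho>. 0)"
      by (intro lint_cong) (simp add: sp)
    then show "l2_class M (average \<rho> (\<lambda>_. 1) f) \<in> C"
      using average_l2[OF \<rho>(1) w f(1)] ip_average[OF \<rho>(1) w f(1) one] by (simp add: C int)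
  qed
  note op = integrated_op_koopman[OF \<rho> CL add scale avg]
  show "0 \<le> c"
    unfolding c_def E[symmetric] by (rule opnorm_nonneg[OF CL op(1)]) (simp add: C)
  fix f assume f: "f \<in> l2_fun M" "(LINT x|M. f x) = 0"
  then have fC: "l2_class M f \<in> C" by (simp add: C)
  show "l2n M (average \<rho> (\<lambda>_. 1) f) \<le> c * l2n M f"
    unfolding c_def E[symmetric]
    by (rule opnorm_ge[OF CL scale op(1) f(1) fC average_l2[OF \<rho>(1) w f(1)] op(2)[OF f(1) fC]])
qed

end


section \<open>Topological groups and coset spaces\<close>

context topological_group
begin

lemma mult_continuous_pair:
  assumes "continuous_map X T f" "continuous_map X T g"
  shows "continuous_map X T (\<lambda>x. f x \<otimes> g x)"
  using continuous_map_compose[OF continuous_map_pairedI[OF assms] continuous_mult] by (simp add: o_def)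

lemma inv_continuous:
  assumes "continuous_map X T f"
  shows "continuous_map X T (\<lambda>x. inv (f x))"
  using continuous_map_compose[OF assms continuous_inv] by (simp add: o_def)

lemma const_continuous: "g \<in> carrier G \<Longrightarrow> continuous_map X T (\<lambda>x. g)"
  by (simp add: topspace_eq)

lemma id_continuous: "continuous_map T T (\<lambda>x. x)"
  by simp

lemma compact_inv_image: "compactin T K \<Longrightarrow> compactin T (m_inv G ` K)"
  by (rule image_compactin[OF _ continuous_inv])

lemma compact_mult:
  assumes "compactin T K" "compactin T L"
  shows "compactin T ((\<lambda>(x, y). x \<otimes> y) ` (K \<times> L))"
  using assms by (intro image_compactin[OF _ continuous_mult]) (simp add: compactin_Times)

lemma self_action:
  assumes "Hausdorff_space T" "left_haar_measure G T m"
  shows "mp_action G T (\<lambda>g x. g \<otimes> x) T m"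
  by unfold_locales
    (use assms continuous_mult in \<open>auto simp: left_haar_measure_def topspace_eq m_assoc\<close>)

text \<open>A compactly supported continuous function is uniformly continuous for right translations: near the
  support this is the tube lemma, and the inverse neighbourhood handles points that are moved into it.\<close>

lemma cc_uniformly_continuous:
  assumes f: "cc T f" and e: "e > 0"
  obtains N where "openin T N" "\<one> \<in> N" "\<And>h k. h \<in> carrier G \<Longrightarrow> k \<in> N \<Longrightarrow> norm (f (h \<otimes> k) - f h) < e"
proof -
  obtain Q where Q: "compactin T Q" "\<And>x. x \<in> topspace T - Q \<Longrightarrow> f x = 0"
    and fc: "continuous_map T euclidean f"
    using f by (auto simp: cc_def)
  define W where "W = {p \<in> topspace (prod_topology T T). norm (f (fst p \<otimes> snd p) - f (fst p)) < e}"
  have "continuous_map (prod_topology T T) euclidean (\<lambda>p. norm (f (fst p \<otimes> snd p) - f (fst p)))"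
  proof (intro continuous_map_norm continuous_map_diff)
    show "continuous_map (prod_topology T T) euclidean (\<lambda>p. f (fst p))"
      using continuous_map_compose[OF continuous_map_fst[of T T] fc] by (simp add: o_def)
    have "continuous_map (prod_topology T T) T (\<lambda>p. fst p \<otimes> snd p)"
      by (intro mult_continuous_pair continuous_map_fst continuous_map_snd)
    from continuous_map_compose[OF this fc]
    show "continuous_map (prod_topology T T) euclidean (\<lambda>p. f (fst p \<otimes> snd p))"
      by (simp add: o_def)
  qed
  from openin_continuous_map_preimage[OF this, of "{..<e}"]
  have W: "openin (prod_topology T T) W"
    by (simp add: W_def)
  have "Q \<times> {\<one>} \<subseteq> W"
    using compactin_subset_topspace[OF Q(1)] e by (auto simp: W_def topspace_eq)
  moreover have "\<one> \<in> topspace T" by (simp add: topspace_eq)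
  ultimately obtain U N where UN: "openin T N" "Q \<subseteq> U" "\<one> \<in> N" "U \<times> N \<subseteq> W"
    using tube_lemma_left[OF W Q(1)] by metis
  have near: "norm (f (h \<otimes> k) - f h) < e" if "h \<in> Q" "k \<in> N" for h k
  proof -
    have "(h, k) \<in> W" using that UN by blast
    then show ?thesis by (simp add: W_def)
  qed
  let ?N = "N \<inter> {k \<in> topspace T. inv k \<in> N}"
  show thesis
  proof (rule that[of ?N])
    show "openin T ?N"
      by (intro openin_Int UN openin_continuous_map_preimage[OF continuous_inv])
    show "\<one> \<in> ?N"
      using UN by (simp add: topspace_eq)
    fix h k assume h: "h \<in> carrier G" and k: "k \<in> ?N"
    then have kG: "k \<in> carrier G" by (simp add: topspace_eq)
    consider "h \<in> Q" | "h \<otimes> k \<in> Q" | "h \<notin> Q" "h \<otimes> k \<notin> Q" by blast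
    then show "norm (f (h \<otimes> k) - f h) < e"
    proof cases
      case 1
      then show ?thesis using near k by simp
    next
      case 2
      have "h \<otimes> k \<otimes> inv k = h"
        using h kG by (simp add: m_assoc)
      then show ?thesis
        using near[OF 2, of "inv k"] k by (simp add: norm_minus_commute)
    next
      case 3
      then show ?thesis
        using Q(2)[of h] Q(2)[of "h \<otimes> k"] h kG e by (simp add: topspace_eq)
    qed
  qed
qed

lemma coset_eq_iff:
  assumes "subgroup K G" "x \<in> carrier G" "y \<in> carrier G"
  shows "x <# K = y <# K \<longleftrightarrow> inv x \<otimes> y \<in> K"
proof
  assume "x <# K = y <# K"
  then have "y \<in> x <# K"
    using lcos_self[OF assms(3,1)] by simp
  then show "inv x \<otimes> y \<in> K"
    by (rule subgroup.lcos_module_imp[OF assms(1) is_group assms(2)])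
next
  assume "inv x \<otimes> y \<in> K"
  then have "y \<in> x <# K"
    by (rule subgroup.lcos_module_rev[OF assms(1) is_group assms(2,3)])
  then show "x <# K = y <# K"
    by (rule l_repr_independence[OF _ assms(2,1)])
qed

lemma l_coset_mult:
  assumes "subgroup K G" "g \<in> carrier G" "x \<in> carrier G"
  shows "g <# (x <# K) = (g \<otimes> x) <# K"
  using assms subgroup.mem_carrier[OF assms(1)] by (force simp: l_coset_def m_assoc)

lemma topspace_coset: "topspace (coset_topology G T K) = (\<lambda>x. x <# K) ` carrier G"
  using quotient_imp_surjective_map[OF quotient_map_coset_topology[of K]] by (simp add: topspace_eq)

lemma coset_continuous: "continuous_map T (coset_topology G T K) (\<lambda>x. x <# K)"
  by (rule quotient_imp_continuous_map[OF quotient_map_coset_topology])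

text \<open>The preimage of the image of \<open>U\<close> is the union of the right translates of \<open>U\<close> by elements of \<open>K\<close>.\<close>

lemma coset_open_map:
  assumes K: "subgroup K G" and U: "openin T U"
  shows "openin (coset_topology G T K) ((\<lambda>x. x <# K) ` U)"
proof -
  have UG: "U \<subseteq> carrier G"
    using openin_subset[OF U] by (simp add: topspace_eq)
  have "{x \<in> topspace T. x <# K \<in> (\<lambda>x. x <# K) ` U} = (\<Union>k\<in>K. {x \<in> topspace T. x \<otimes> k \<in> U})"
  proof (intro Set.set_eqI iffI)
    fix x assume "x \<in> {x \<in> topspace T. x <# K \<in> (\<lambda>x. x <# K) ` U}"
    then obtain u where x: "x \<in> carrier G" and u: "u \<in> U" "x <# K = u <# K"
      by (auto simp: topspace_eq)
    then have "inv x \<otimes> u \<in> K"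
      using coset_eq_iff[OF K, of x u] UG by blast
    moreover have "x \<otimes> (inv x \<otimes> u) = u"
      using x u UG by (simp add: m_assoc[symmetric] subset_iff)
    ultimately show "x \<in> (\<Union>k\<in>K. {x \<in> topspace T. x \<otimes> k \<in> U})"
      using x u by (auto simp: topspace_eq intro!: bexI[of _ "inv x \<otimes> u"])
  next
    fix x assume "x \<in> (\<Union>k\<in>K. {x \<in> topspace T. x \<otimes> k \<in> U})"
    then obtain k where k: "k \<in> K" "k \<in> carrier G" and x: "x \<in> carrier G" "x \<otimes> k \<in> U"
      using subgroup.mem_carrier[OF K] by (auto simp: topspace_eq)
    have "inv x \<otimes> (x \<otimes> k) = k"
      using x k by (simp add: m_assoc[symmetric])
    then have "x <# K = (x \<otimes> k) <# K"
      using coset_eq_iff[OF K, of x "x \<otimes> k"] x k by simp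
    then show "x \<in> {x \<in> topspace T. x <# K \<in> (\<lambda>x. x <# K) ` U}"
      using x by (auto simp: topspace_eq)
  qed
  moreover have "openin T {x \<in> topspace T. x \<otimes> k \<in> U}" if "k \<in> K" for k
    using subgroup.mem_carrier[OF K that]
    by (intro openin_continuous_map_preimage[OF mult_continuous_pair[OF id_continuous const_continuous] U])
  ultimately have "openin T {x \<in> topspace T. x <# K \<in> (\<lambda>x. x <# K) ` U}"
    by auto
  moreover have "(\<lambda>x. x <# K) ` U \<subseteq> lcosets K"
    using UG by (auto simp: LCOSETS_def)
  ultimately show ?thesis
    by (simp add: openin_coset_topology)
qed

text \<open>Since the projection is open, images of boxes in \<open>G \<times> G\<close> are neighbourhoods in \<open>G \<times> G/K\<close>, so continuity can be
  tested on representatives.\<close>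

lemma coset_action_continuous:
  assumes K: "subgroup K G"
  shows "continuous_map (prod_topology T (coset_topology G T K)) (coset_topology G T K) (\<lambda>(g, C). g <# C)"
  unfolding continuous_map_def
proof (intro conjI allI impI)
  let ?X = "coset_topology G T K"
  show "(\<lambda>(g, C). g <# C) \<in> topspace (prod_topology T ?X) \<rightarrow> topspace ?X"
    by (auto simp: topspace_coset topspace_eq l_coset_mult[OF K])
  fix Y assume Y: "openin ?X Y"
  let ?P = "{p \<in> topspace (prod_topology T ?X). (\<lambda>(g, C). g <# C) p \<in> Y}"
  show "openin (prod_topology T ?X) ?P"
  proof (subst openin_subopen, safe)
    fix g C assume p: "(g, C) \<in> topspace (prod_topology T ?X)" and gC: "g <# C \<in> Y"
    then obtain y where y: "y \<in> carrier G" "C = y <# K" and g: "g \<in> carrier G"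
      by (auto simp: topspace_coset topspace_eq)
    define W where "W = {q \<in> topspace (prod_topology T T). (fst q \<otimes> snd q) <# K \<in> Y}"
    have "continuous_map (prod_topology T T) ?X (\<lambda>q. (fst q \<otimes> snd q) <# K)"
      using continuous_map_compose[OF mult_continuous_pair[OF continuous_map_fst continuous_map_snd] coset_continuous]
      by (simp add: o_def)
    then have W: "openin (prod_topology T T) W"
      unfolding W_def by (rule openin_continuous_map_preimage[OF _ Y])
    have gy: "(g, y) \<in> W"
      using g y gC by (simp add: W_def topspace_eq l_coset_mult[OF K])
    obtain A B where AB: "openin T A" "openin T B" "g \<in> A" "y \<in> B" "A \<times> B \<subseteq> W"
      using openin_prod_topology_alt[THEN iffD1, OF W, rule_format, OF gy] by metis
    let ?N = "A \<times> (\<lambda>x. x <# K) ` B"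
    have "openin (prod_topology T ?X) ?N"
      by (simp add: openin_prod_Times_iff AB coset_open_map[OF K])
    moreover have "(g, C) \<in> ?N"
      using AB y by auto
    moreover have "?N \<subseteq> ?P"
    proof safe
      fix a b assume ab: "a \<in> A" "b \<in> B"
      then have c: "a \<in> carrier G" "b \<in> carrier G"
        using openin_subset[OF AB(1)] openin_subset[OF AB(2)] by (auto simp: topspace_eq)
      then show "(a, b <# K) \<in> topspace (prod_topology T ?X)"
        by (auto simp: topspace_coset topspace_eq)
      show "a <# (b <# K) \<in> Y"
        using AB(5) ab c by (auto simp: W_def l_coset_mult[OF K])
    qed
    ultimately show "\<exists>N. openin (prod_topology T ?X) N \<and> (g, C) \<in> N \<and> N \<subseteq> ?P" by blast
  qed
qed

text \<open>A discrete subgroup is closed: a suitable translate of a neighbourhood of the identity meets it in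
  at most one point, which can be removed.\<close>

lemma discrete_subgroup_closed:
  assumes K: "subgroup K G" and disc: "subtopology T K = discrete_topology K" and hd: "Hausdorff_space T"
  shows "closedin T K"
proof -
  have KG: "K \<subseteq> carrier G" by (rule subgroup.subset[OF K])
  have "openin (subtopology T K) {\<one>}"
    using subgroup.one_closed[OF K] by (simp add: disc)
  then obtain V where V: "openin T V" "V \<inter> K = {\<one>}"
    unfolding openin_subtopology by blast
  have "openin T (topspace T - K)"
  proof (subst openin_subopen, safe)
    fix x assume x: "x \<in> topspace T" "x \<notin> K"
    then have xG: "x \<in> carrier G" by (simp add: topspace_eq)
    define W where "W = {p \<in> topspace (prod_topology T T). inv (fst p) \<otimes> snd p \<in> V}"
    have "continuous_map (prod_topology T T) T (\<lambda>p. inv (fst p) \<otimes> snd p)"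
      by (intro mult_continuous_pair inv_continuous continuous_map_fst continuous_map_snd)
    then have W: "openin (prod_topology T T) W"
      unfolding W_def by (rule openin_continuous_map_preimage[OF _ V(1)])
    have gy: "(x, x) \<in> W"
      using x xG V(2) by (auto simp: W_def)
    obtain A B where AB: "openin T A" "openin T B" "x \<in> A" "x \<in> B" "A \<times> B \<subseteq> W"
      using openin_prod_topology_alt[THEN iffD1, OF W, rule_format, OF gy] by metis
    have uniq: "g = g'" if "g \<in> A \<inter> B \<inter> K" "g' \<in> A \<inter> B \<inter> K" for g g'
    proof -
      have "inv g \<otimes> g' \<in> V"
        using AB(5) that by (auto simp: W_def)
      moreover have "inv g \<otimes> g' \<in> K"
        using that K by (simp add: subgroup.m_closed subgroup.m_inv_closed)
      ultimately have 1: "inv g \<otimes> g' = \<one>" using V(2) by blast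
      have gs: "g \<in> carrier G" "g' \<in> carrier G" using that KG by auto
      have "g \<otimes> (inv g \<otimes> g') = g'"
        using gs by (simp add: m_assoc[symmetric])
      with 1 gs show "g = g'" by simp
    qed
    obtain F where F: "finite F" "A \<inter> B \<inter> K = F"
      using uniq by (metis finite.emptyI finite.insertI is_singletonI' is_singleton_def)
    have "closedin T F"
      using F AB(1) openin_subset[OF AB(1)] hd by (intro closedin_Hausdorff_finite) auto
    then have "openin T (A \<inter> B - F)"
      using AB by blast
    moreover have "x \<in> A \<inter> B - F" "A \<inter> B - F \<subseteq> topspace T - K"
      using AB x F openin_subset[OF AB(1)] by auto
    ultimately show "\<exists>N. openin T N \<and> x \<in> N \<and> N \<subseteq> topspace T - K" by blast
  qed
  then show ?thesis
    using KG by (simp add: closedin_def topspace_eq)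
qed

text \<open>The set of pairs with \<open>x\<^sup>-\<^sup>1 y \<notin> K\<close> is open, and a box contained in it projects to two disjoint open sets.\<close>

lemma coset_Hausdorff:
  assumes K: "subgroup K G" and cl: "closedin T K"
  shows "Hausdorff_space (coset_topology G T K)"
  unfolding Hausdorff_space_def
proof (intro allI impI, elim conjE)
  fix C D assume "C \<in> topspace (coset_topology G T K)" "D \<in> topspace (coset_topology G T K)" and ne: "C \<noteq> D"
  then obtain x y where x: "x \<in> carrier G" "C = x <# K" and y: "y \<in> carrier G" "D = y <# K"
    by (auto simp: topspace_coset)
  define W where "W = {p \<in> topspace (prod_topology T T). inv (fst p) \<otimes> snd p \<in> topspace T - K}"
  have "continuous_map (prod_topology T T) T (\<lambda>p. inv (fst p) \<otimes> snd p)"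
    by (intro mult_continuous_pair inv_continuous continuous_map_fst continuous_map_snd)
  moreover have "openin T (topspace T - K)"
    using cl by blast
  ultimately have W: "openin (prod_topology T T) W"
    unfolding W_def by (rule openin_continuous_map_preimage)
  have gy: "(x, y) \<in> W"
    using x y ne coset_eq_iff[OF K, of x y] by (auto simp: W_def topspace_eq)
  obtain A B where AB: "openin T A" "openin T B" "x \<in> A" "y \<in> B" "A \<times> B \<subseteq> W"
    using openin_prod_topology_alt[THEN iffD1, OF W, rule_format, OF gy] by metis
  have "disjnt ((\<lambda>x. x <# K) ` A) ((\<lambda>x. x <# K) ` B)"
    unfolding disjnt_iff
  proof (intro allI notI, elim conjE imageE)
    fix C a b assume ab: "a \<in> A" "b \<in> B" "C = a <# K" "C = b <# K"
    then have "a \<in> carrier G" "b \<in> carrier G"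
      using openin_subset[OF AB(1)] openin_subset[OF AB(2)] by (auto simp: topspace_eq)
    then have "inv a \<otimes> b \<in> K"
      using ab coset_eq_iff[OF K, of a b] by auto
    then show False
      using AB(5) ab by (auto simp: W_def)
  qed
  then show "\<exists>U V. openin (coset_topology G T K) U \<and> openin (coset_topology G T K) V \<and> C \<in> U \<and> D \<in> V \<and> disjnt U V"
    using AB x y coset_open_map[OF K] by (metis image_eqI)
qed

lemma coset_locally_compact:
  assumes K: "subgroup K G" and lc: "locally_compact_space T"
  shows "locally_compact_space (coset_topology G T K)"
proof (rule locally_compact_space_continuous_open_map_image[OF coset_continuous _ _ lc])
  show "open_map T (coset_topology G T K) (\<lambda>x. x <# K)"
    by (simp add: open_map_def coset_open_map[OF K])
  show "(\<lambda>x. x <# K) ` topspace T = topspace (coset_topology G T K)"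
    by (simp add: topspace_coset topspace_eq)
qed

lemma coset_action:
  assumes K: "subgroup K G" and disc: "subtopology T K = discrete_topology K" and hd: "Hausdorff_space T"
    and \<nu>: "regular_borel_measure (coset_topology G T K) \<nu>" "invariant_measure G (\<lambda>g C. g <# C) \<nu>"
  shows "mp_action G T (\<lambda>g C. g <# C) (coset_topology G T K) \<nu>"
proof unfold_locales
  show "continuous_map (prod_topology T (coset_topology G T K)) (coset_topology G T K) (\<lambda>(g, C). g <# C)"
    by (rule coset_action_continuous[OF K])
  show "Hausdorff_space (coset_topology G T K)"
    by (intro coset_Hausdorff K discrete_subgroup_closed disc hd)
  fix C assume "C \<in> topspace (coset_topology G T K)"
  then obtain x where x: "x \<in> carrier G" "C = x <# K"
    by (auto simp: topspace_coset)
  then show "\<one> <# C = C"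
    by (simp add: l_coset_mult[OF K])
  fix g h assume "g \<in> carrier G" "h \<in> carrier G"
  with x show "(g \<otimes> h) <# C = g <# (h <# C)"
    by (simp add: l_coset_mult[OF K] m_assoc)
qed (fact \<nu>)+

lemma topological_subgroup:
  assumes H: "subgroup H G"
  shows "topological_group (G\<lparr>carrier := H\<rparr>) (subtopology T H)"
proof -
  interpret H: group "G\<lparr>carrier := H\<rparr>"
    by (rule subgroup.subgroup_is_group[OF H is_group])
  have HG: "H \<subseteq> carrier G" by (rule subgroup.subset[OF H])
  show ?thesis
  proof unfold_locales
    show "topspace (subtopology T H) = carrier (G\<lparr>carrier := H\<rparr>)"
      using HG by (auto simp: topspace_eq)
    have "continuous_map (subtopology (prod_topology T T) (H \<times> H)) T (\<lambda>(x, y). x \<otimes> y)"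
      by (rule continuous_map_from_subtopology[OF continuous_mult])
    then have "continuous_map (subtopology (prod_topology T T) (H \<times> H)) (subtopology T H) (\<lambda>(x, y). x \<otimes> y)"
      using H by (intro continuous_map_into_subtopology) (auto simp: subgroup.m_closed)
    then show "continuous_map (prod_topology (subtopology T H) (subtopology T H)) (subtopology T H)
        (\<lambda>(x, y). x \<otimes>\<^bsub>G\<lparr>carrier := H\<rparr>\<^esub> y)"
      by (simp add: subtopology_Times)
    have "continuous_map (subtopology T H) T (\<lambda>x. inv x)"
      by (rule continuous_map_from_subtopology[OF continuous_inv])
    then have "continuous_map (subtopology T H) (subtopology T H) (\<lambda>x. inv x)"
      using H by (intro continuous_map_into_subtopology) (auto simp: subgroup.m_inv_closed)
    then show "continuous_map (subtopology T H) (subtopology T H) (\<lambda>x. inv\<^bsub>G\<lparr>carrier := H\<rparr>\<^esub> x)"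
      by (rule continuous_map_eq) (simp add: m_inv_consistent[OF H])
  qed
qed

end

lemma (in mp_action) restrict_subgroup:
  assumes H: "subgroup H G"
  shows "mp_action (G\<lparr>carrier := H\<rparr>) (subtopology T H) act S M"
proof -
  interpret H: topological_group "G\<lparr>carrier := H\<rparr>" "subtopology T H"
    by (rule topological_subgroup[OF H])
  have HG: "H \<subseteq> carrier G" by (rule subgroup.subset[OF H])
  show ?thesis
  proof unfold_locales
    have "prod_topology (subtopology T H) S = subtopology (prod_topology T S) (H \<times> topspace S)"
      by (metis subtopology_Times subtopology_topspace)
    then show "continuous_map (prod_topology (subtopology T H) S) S (\<lambda>(g, x). act g x)"
      using continuous_map_from_subtopology[OF act_continuous] by simp
    show "invariant_measure (G\<lparr>carrier := H\<rparr>) act M"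
      using inv_measure HG by (auto simp: invariant_measure_def)
  qed (use HG in \<open>auto simp: act_one act_mult subset_iff S_hausdorff reg\<close>)
qed


section \<open>Null sets of the group and thin tubes around compact pieces of orbits\<close>

context mp_action
begin

text \<open>By outer regularity the exceptional group elements lie in an open set \<open>A\<close> of small measure. For the other
  \<open>g \<in> K\<close> the points \<open>g\<^sup>-\<^sup>1 x\<close> form a compact set disjoint from \<open>E\<close>, and the two sets stay disjoint after \<open>x\<close> and
  \<open>E\<close> are replaced by neighbourhoods.\<close>

lemma null_translates_local:
  assumes m: "regular_borel_measure T m"
    and K: "compactin T K" and E: "compactin S E" and x: "x \<in> topspace S"
    and null: "\<exists>A\<in>null_sets m. {g \<in> K. act (inv g) x \<in> E} \<subseteq> A" and d: "d > 0"
  shows "\<exists>N O' A. openin S N \<and> x \<in> N \<and> openin S O' \<and> E \<subseteq> O' \<and> A \<in> sets m \<and> emeasure m A < ennreal d \<and>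
    (\<forall>g\<in>K - A. \<forall>y\<in>N. act (inv g) y \<notin> O')"
proof -
  obtain B where B: "B \<in> null_sets m" "{g \<in> K. act (inv g) x \<in> E} \<subseteq> B"
    using null by blast
  obtain A where A: "openin T A" "B \<subseteq> A" "emeasure m A < emeasure m B + ennreal d"
    by (rule outer_regular_open[OF m _ _ d, of B]) (use B in auto)
  have KA: "compactin T (K - A)"
  proof -
    have "K - A = (topspace T - A) \<inter> K"
      using compactin_subset_topspace[OF K] by auto
    moreover have "closedin T (topspace T - A)"
      using A(1) by blast
    ultimately show ?thesis
      using closed_Int_compactin[OF _ K] by simp
  qed
  have iKA: "compactin T (m_inv G ` (K - A))"
    using image_compactin[OF KA continuous_inv] .
  define C where "C = (\<lambda>g. act g x) ` m_inv G ` (K - A)"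
  have C: "compactin S C"
    unfolding C_def by (rule image_compactin[OF iKA orbit_cont[OF x]])
  have "disjnt C E"
    using B(2) A(2) by (auto simp: C_def disjnt_iff)
  then obtain O1 O2 where O12: "openin S O1" "openin S O2" "C \<subseteq> O1" "E \<subseteq> O2" "disjnt O1 O2"
    using Hausdorff_space_compact_separation[OF S_hausdorff C E] by metis
  have cx: "compactin S {x}" using x by simp
  have *: "act g y \<in> O1" if "g \<in> m_inv G ` (K - A)" "y \<in> {x}" for g y
    using that O12(3) by (auto simp: C_def)
  obtain U N where UN: "openin S N" "m_inv G ` (K - A) \<subseteq> U" "{x} \<subseteq> N" "\<forall>g\<in>U. \<forall>y\<in>N. act g y \<in> O1"
    using act_tube[OF iKA cx O12(1) *] by metis
  have "act (inv g) y \<notin> O2" if "g \<in> K - A" "y \<in> N" for g y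
    using that UN O12(5) by (auto simp: disjnt_iff)
  moreover have "A \<in> sets m"
    by (rule regularD(3)[OF m A(1)])
  moreover have "emeasure m A < ennreal d"
    using A(3) B(1) by (simp add: null_setsD1)
  ultimately show ?thesis
    using UN(1,3) O12(2,4) by (intro exI[of _ N] exI[of _ O2] exI[of _ A]) auto
qed

text \<open>A finite subcover of \<open>L\<close> makes the neighbourhood of \<open>E\<close> in the previous lemma independent of \<open>x\<close>.\<close>

lemma null_translates_uniform:
  assumes m: "regular_borel_measure T m"
    and K: "compactin T K" and E: "compactin S E" and L: "compactin S L"
    and null: "\<forall>x\<in>topspace S. \<exists>A\<in>null_sets m. {g \<in> K. act (inv g) x \<in> E} \<subseteq> A" and d: "d > 0"
  shows "\<exists>Y. openin S Y \<and> E \<subseteq> Y \<and>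
    (\<forall>x\<in>L. \<exists>A\<in>sets m. emeasure m A < ennreal d \<and> {g \<in> K. act (inv g) x \<in> Y} \<subseteq> A)"
proof -
  have LS: "L \<subseteq> topspace S" by (rule compactin_subset_topspace[OF L])
  obtain N Y A where NYA: "\<And>x. x \<in> topspace S \<Longrightarrow> openin S (N x) \<and> x \<in> N x \<and> openin S (Y x) \<and> E \<subseteq> Y x
      \<and> A x \<in> sets m \<and> emeasure m (A x) < ennreal d \<and> (\<forall>g\<in>K - A x. \<forall>y\<in>N x. act (inv g) y \<notin> Y x)"
    using null_translates_local[OF m K E _ bspec[OF null] d] by metis
  have No: "\<And>U. U \<in> N ` L \<Longrightarrow> openin S U" and NL: "L \<subseteq> \<Union>(N ` L)"
    using NYA LS by auto
  obtain \<F> where \<F>: "finite \<F>" "\<F> \<subseteq> N ` L" "L \<subseteq> \<Union>\<F>"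
    using compactinD[OF L No NL] by auto
  then obtain F where F: "finite F" "F \<subseteq> L" "\<F> = N ` F"
    by (meson finite_subset_image)
  define Z where "Z = topspace S \<inter> \<Inter>(Y ` F)"
  show ?thesis
  proof (intro exI[of _ Z] conjI ballI)
    have "openin S (\<Inter>(insert (topspace S) (Y ` F)))"
      using F NYA LS by (intro openin_Inter) auto
    then show "openin S Z" by (simp add: Z_def)
    show "E \<subseteq> Z"
      using F NYA LS compactin_subset_topspace[OF E] by (auto simp: Z_def subset_iff)
    fix x assume "x \<in> L"
    then obtain y where y: "y \<in> F" "x \<in> N y"
      using \<F>(3) F(3) by blast
    then have yS: "y \<in> topspace S" using F(2) LS by blast
    have "{g \<in> K. act (inv g) x \<in> Z} \<subseteq> A y"
      using NYA[OF yS] y by (auto simp: Z_def)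
    then show "\<exists>A\<in>sets m. emeasure m A < ennreal d \<and> {g \<in> K. act (inv g) x \<in> Z} \<subseteq> A"
      using NYA[OF yS] by blast
  qed
qed

text \<open>The double integral of \<open>1[g\<^sup>-\<^sup>1 x \<in> P]\<close> over \<open>g \<in> K\<close> and \<open>x\<close>, evaluated in both orders. Since this set need not
  be product measurable, the integral over \<open>g\<close> is replaced by a sum over a finite partition of \<open>K\<close>.\<close>

lemma measure_le_of_null_translates:
  assumes hdT: "Hausdorff_space T" and m: "regular_borel_measure T m" and M: "prob_space M"
    and K: "compactin T K" and V: "openin T V" "\<one> \<in> V" and P: "openin S P"
    and VP: "\<And>v x. v \<in> V \<Longrightarrow> x \<in> P \<Longrightarrow> act v x \<in> Y" and KP: "\<And>g x. g \<in> K \<Longrightarrow> x \<in> P \<Longrightarrow> act g x \<in> L"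
    and Y: "\<forall>x\<in>L. \<exists>A\<in>sets m. emeasure m A < ennreal d \<and> {g \<in> K. act (inv g) x \<in> Y} \<subseteq> A"
    and d: "d > 0"
  shows "measure m K * measure M P \<le> d"
proof -
  interpret M: prob_space M by (rule M)
  have KG: "K \<subseteq> carrier G" using compactin_subset_topspace[OF K] by (simp add: topspace_eq)
  have PS: "P \<subseteq> topspace S" by (rule openin_subset[OF P])
  \<comment> \<open>If \<open>g \<in> B h\<close> and \<open>x \<in> h P\<close>, then \<open>g\<^sup>-\<^sup>1 x \<in> V P \<subseteq> Y\<close>. The sets \<open>D' i\<close> below cut \<open>K\<close> into disjoint pieces of
      sets \<open>B h\<close>.\<close>
  define B where "B h = {g \<in> topspace T. inv g \<otimes> h \<in> V}" for h
  have Bo: "openin T (B h)" if "h \<in> K" for h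
    unfolding B_def using that KG
    by (intro openin_continuous_map_preimage[OF mult_continuous_pair[OF inv_continuous[OF id_continuous]
            const_continuous] V(1)]) auto
  have Bh: "h \<in> B h" if "h \<in> K" for h
    using that KG V by (auto simp: B_def topspace_eq)
  have BU: "\<And>U. U \<in> B ` K \<Longrightarrow> openin T U" and BK: "K \<subseteq> \<Union>(B ` K)"
    using Bo Bh by auto
  obtain \<F> where \<F>: "finite \<F>" "\<F> \<subseteq> B ` K" "K \<subseteq> \<Union>\<F>"
    using compactinD[OF K BU BK] by auto
  then obtain F where F: "finite F" "F \<subseteq> K" "\<F> = B ` F"
    by (meson finite_subset_image)
  obtain h :: "nat \<Rightarrow> 'a" and n where h: "F = h ` {..<n}"
    using finite_imp_nat_seg_image_inj_on[OF F(1)] by (metis lessThan_def)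
  have hK: "h i \<in> K" if "i < n" for i using that h F(2) by auto
  have Ks: "K \<in> sets m"
    using K hdT regularD(1)[OF m] by (simp add: compactin_borel_of)
  define D where "D i = (if i < n then K \<inter> B (h i) else {})" for i
  define D' where "D' = disjointed D"
  have Dm: "D i \<in> sets m" for i
    using Bo[OF hK[of i]] Ks regularD(3)[OF m] by (auto simp: D_def)
  have D'm: "D' i \<in> sets m" for i
    using sets.range_disjointed_sets[of D m] Dm by (auto simp: D'_def)
  have D'D: "D' i \<subseteq> D i" for i
    unfolding D'_def by (rule disjointed_subset)
  have D'K: "D' i \<subseteq> K" for i
    using D'D[of i] by (auto simp: D_def split: if_splits)
  have fin: "emeasure m X < \<infinity>" if "X \<in> sets m" "X \<subseteq> K" for X
    using le_less_trans[OF emeasure_mono[OF that(2) Ks] regularD(4)[OF m K]] .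
  have dis: "disjoint_family_on D' I" for I
    using disjoint_family_disjointed[of D] by (auto simp: D'_def disjoint_family_on_def)
  have UD: "(\<Union>i<n. D' i) = K"
  proof -
    have "(\<Union>i<n. D' i) = (\<Union>i<n. D i)"
      unfolding D'_def lessThan_atLeast0 by (rule finite_UN_disjointed_eq)
    also have "\<dots> = K"
      using \<F>(3) F(3) h by (auto simp: D_def)
    finally show ?thesis .
  qed
  have mD': "measure m (\<Union>i\<in>I. D' i) = (\<Sum>i\<in>I. measure m (D' i))" if "finite I" for I
    using that D'm fin[OF D'm D'K] dis by (intro measure_finite_Union) (auto simp: less_top)
  let ?R = "\<lambda>i. act (h i) ` P"
  have R: "?R i \<in> sets M" "measure M (?R i) = measure M P" if "i < n" for i
    using hK[OF that] KG P by (auto simp: act_image_sets measure_act_image open_M)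
  have point: "(\<Sum>i<n. measure m (D' i) * indicator (?R i) x) \<le> d" if x: "x \<in> space M" for x
  proof -
    let ?I = "{i. i < n \<and> x \<in> ?R i}"
    have "(\<Sum>i<n. measure m (D' i) * indicator (?R i) x) = (\<Sum>i\<in>?I. measure m (D' i))"
      by (rule sum.mono_neutral_cong_right) (auto simp: indicator_def)
    also have "\<dots> = measure m (\<Union>i\<in>?I. D' i)"
      by (rule mD'[symmetric]) simp
    also have "\<dots> \<le> d"
    proof (cases "?I = {}")
      case True
      show ?thesis unfolding True using d by simp
    next
      case False
      then obtain j where j: "j < n" "x \<in> ?R j" by blast
      then have "x \<in> L" using KP hK[OF j(1)] by auto
      then obtain A where A: "A \<in> sets m" "emeasure m A < ennreal d" "{g \<in> K. act (inv g) x \<in> Y} \<subseteq> A"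
        using Y by blast
      have "(\<Union>i\<in>?I. D' i) \<subseteq> A"
      proof
        fix g assume "g \<in> (\<Union>i\<in>?I. D' i)"
        then obtain i where i: "i < n" "x \<in> ?R i" "g \<in> D' i" by blast
        then have gK: "g \<in> K" and gB: "g \<in> B (h i)"
          using D'D[of i] by (auto simp: D_def)
        obtain p where p: "p \<in> P" "x = act (h i) p" using i(2) by blast
        have gG: "g \<in> carrier G" "h i \<in> carrier G" using gK hK[OF i(1)] KG by auto
        have "act (inv g) x = act (inv g \<otimes> h i) p"
          using p gG PS by (auto simp: act_mult)
        then have "act (inv g) x \<in> Y"
          using VP[OF _ p(1), of "inv g \<otimes> h i"] gB by (simp add: B_def)
        then show "g \<in> A" using A(3) gK by blast
      qed
      then have "emeasure m (\<Union>i\<in>?I. D' i) \<le> emeasure m A"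
        by (rule emeasure_mono[OF _ A(1)])
      also have "\<dots> < ennreal d" by (rule A(2))
      finally have "emeasure m (\<Union>i\<in>?I. D' i) < ennreal d" .
      then show ?thesis
        using d by (simp add: measure_def enn2real_leI less_imp_le)
    qed
    finally show ?thesis .
  qed
  have "measure m K * measure M P = (\<Sum>i<n. measure m (D' i)) * measure M P"
    using mD'[of "{..<n}"] UD by simp
  also have "\<dots> = (\<Sum>i<n. measure m (D' i) * measure M (?R i))"
    by (simp add: sum_distrib_right R(2))
  also have "\<dots> = (LINT x|M. (\<Sum>i<n. measure m (D' i) * indicator (?R i) x))"
    using R(1) sets.sets_into_space[OF R(1)]
    by (subst Bochner_Integration.integral_sum) (auto simp: Int_absorb2 M.emeasure_eq_measure intro!: sum.cong)
  also have "\<dots> \<le> (LINT x|M. d)"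
    using R(1) by (intro integral_mono point Bochner_Integration.integrable_sum) (auto simp: M.emeasure_eq_measure)
  also have "\<dots> = d"
    by (simp add: M.prob_space)
  finally show ?thesis .
qed

text \<open>The tube lemma provides \<open>U\<close> such that \<open>V Q U\<close>, for some neighbourhood \<open>V\<close> of the identity, stays in the
  neighbourhood \<open>Y\<close> of \<open>Q x\<^sub>0\<close> from \<open>null_translates_uniform\<close>, while \<open>K Q U\<close> stays in a compact set. Then
  \<open>measure_le_of_null_translates\<close> applies to \<open>P = Q U\<close>.\<close>

lemma small_tube:
  assumes hdT: "Hausdorff_space T" and m: "regular_borel_measure T m" and M: "prob_space M"
    and lcS: "locally_compact_space S"
    and K: "compactin T K" "measure m K > 0" and Q: "compactin T Q" and x0: "x0 \<in> topspace S"
    and null: "\<forall>x\<in>topspace S. \<exists>A\<in>null_sets m. {g \<in> K. act (inv g) x \<in> (\<lambda>q. act q x0) ` Q} \<subseteq> A"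
    and e: "e > 0"
  obtains U where "openin S U" "x0 \<in> U" "measure M (\<Union>q\<in>Q. act q ` U) \<le> e"
proof -
  define E where "E = (\<lambda>q. act q x0) ` Q"
  have E: "compactin S E"
    unfolding E_def by (rule image_compactin[OF Q orbit_cont[OF x0]])
  have QG: "Q \<subseteq> carrier G" using compactin_subset_topspace[OF Q] by (simp add: topspace_eq)
  have "compactin (prod_topology T S) (K \<times> E)"
    using K(1) E by (simp add: compactin_Times)
  from image_compactin[OF this act_continuous]
  have KE: "compactin S ((\<lambda>(g, x). act g x) ` (K \<times> E))" .
  obtain W L where WL: "openin S W" "compactin S L" "(\<lambda>(g, x). act g x) ` (K \<times> E) \<subseteq> W" "W \<subseteq> L"
    using lcS KE locally_compact_space_compact_closed_compact[of S] S_hausdorff by metis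
  define d where "d = e * measure m K"
  have d: "d > 0" using e K by (simp add: d_def)
  obtain Y where Y: "openin S Y" "E \<subseteq> Y"
    "\<forall>x\<in>L. \<exists>A\<in>sets m. emeasure m A < ennreal d \<and> {g \<in> K. act (inv g) x \<in> Y} \<subseteq> A"
    using null_translates_uniform[OF m K(1) E WL(2) null[folded E_def] d] by blast
  have ES: "E \<subseteq> topspace S" by (rule compactin_subset_topspace[OF E])
  have 1: "act g x \<in> Y" if "g \<in> {\<one>}" "x \<in> E" for g x
    using that Y(2) ES act_one[of x] by (simp add: subset_iff)
  have c1: "compactin T {\<one>}" by (simp add: topspace_eq)
  obtain V Y1 where V: "openin T V" "openin S Y1" "{\<one>} \<subseteq> V" "E \<subseteq> Y1" "\<forall>g\<in>V. \<forall>x\<in>Y1. act g x \<in> Y"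
    using act_tube[OF c1 E Y(1) 1] by metis
  have 2: "act g x \<in> W" if "g \<in> K" "x \<in> E" for g x
    using that WL(3) by auto
  obtain V2 Y2 where V2: "openin S Y2" "K \<subseteq> V2" "E \<subseteq> Y2" "\<forall>g\<in>V2. \<forall>x\<in>Y2. act g x \<in> W"
    using act_tube[OF K(1) E WL(1) 2] by metis
  have Y12: "openin S (Y1 \<inter> Y2)" using V V2 by blast
  have 3: "act q x \<in> Y1 \<inter> Y2" if "q \<in> Q" "x \<in> {x0}" for q x
    using that V(4) V2(3) by (auto simp: E_def)
  have cx: "compactin S {x0}" using x0 by simp
  obtain V3 U where U: "openin S U" "Q \<subseteq> V3" "{x0} \<subseteq> U" "\<forall>q\<in>V3. \<forall>x\<in>U. act q x \<in> Y1 \<inter> Y2"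
    using act_tube[OF Q cx Y12 3] by metis
  let ?P = "\<Union>q\<in>Q. act q ` U"
  have P: "openin S ?P"
    using QG U(1) by (intro openin_Union) (auto intro: open_act_image)
  have P12: "x \<in> Y1 \<inter> Y2" if "x \<in> ?P" for x
    using that U by blast
  have "measure m K * measure M ?P \<le> d"
  proof (rule measure_le_of_null_translates[OF hdT m M K(1) V(1) _ P _ _ Y(3) d])
    show "\<one> \<in> V" using V by simp
    show "act v x \<in> Y" if "v \<in> V" "x \<in> ?P" for v x
      using P12[OF that(2)] V(5) that(1) by blast
    show "act g x \<in> L" if "g \<in> K" "x \<in> ?P" for g x
      using P12[OF that(2)] V2 WL(4) that(1) by blast
  qed
  then have "measure M ?P \<le> e"
    using K(2) by (simp add: d_def mult.commute)
  then show thesis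
    using U by (intro that[of U]) auto
qed

end

lemma (in topological_group) compact_positive:
  assumes lc: "locally_compact_space T" and hd: "Hausdorff_space T" and m: "left_haar_measure G T m"
  obtains K where "compactin T K" "measure m K > 0"
proof -
  interpret A: mp_action G T "\<lambda>g x. g \<otimes> x" T m
    by (rule self_action[OF hd m])
  obtain U K where UK: "openin T U" "compactin T K" "\<one> \<in> U" "U \<subseteq> K"
    using lc unfolding locally_compact_space_def by (metis one_closed topspace_eq)
  have "\<exists>g\<in>carrier G. g \<otimes> x = y" if "x \<in> topspace T" "y \<in> topspace T" for x y
    using that by (intro bexI[of _ "y \<otimes> inv x"]) (auto simp: topspace_eq m_assoc)
  then have "0 < emeasure m U"
    using m UK by (intro A.open_positive) (auto simp: left_haar_measure_def)
  also have "\<dots> \<le> emeasure m K"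
    by (rule emeasure_mono[OF UK(4) A.compact_M[OF UK(2)]])
  finally have "measure m K > 0"
    using A.compact_finite[OF UK(2)] by (simp add: measure_def enn2real_positive_iff)
  with UK show thesis using that by blast
qed

text \<open>In the coset space the exceptional sets of \<open>small_tube\<close> lie in finite unions of left translates of \<open>Q\<^sup>-\<^sup>1\<close>,
  because a compact set contains only finitely many elements of the discrete group \<open>\<Gamma>\<close>.\<close>

lemma (in topological_group) coset_small_tube:
  fixes \<Gamma> :: "'a set" and \<nu> :: "'a set measure"
  assumes lc: "locally_compact_space T" and hd: "Hausdorff_space T" and m: "left_haar_measure G T m"
    and \<Gamma>: "subgroup \<Gamma> G" and disc: "subtopology T \<Gamma> = discrete_topology \<Gamma>"
    and \<nu>: "regular_borel_measure (coset_topology G T \<Gamma>) \<nu>" "invariant_measure G (\<lambda>g C. g <# C) \<nu>" "prob_space \<nu>"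
    and Q: "compactin T Q" and Q0: "emeasure m (m_inv G ` Q) = 0" and e: "e > 0"
  obtains U where "openin (coset_topology G T \<Gamma>) U" "\<Gamma> \<in> U" "measure \<nu> (\<Union>q\<in>Q. (\<lambda>C. q <# C) ` U) \<le> e"
proof -
  let ?X = "coset_topology G T \<Gamma>"
  interpret X: mp_action G T "\<lambda>g (C :: 'a set). g <# C" ?X \<nu>
    by (rule coset_action[OF \<Gamma> disc hd \<nu>(1,2)])
  interpret A: mp_action G T "\<lambda>g x. g \<otimes> x" T m
    by (rule self_action[OF hd m])
  obtain K where K: "compactin T K" "measure m K > 0"
    using compact_positive[OF lc hd m] by blast
  have KG: "K \<subseteq> carrier G" and QG: "Q \<subseteq> carrier G"
    using compactin_subset_topspace[OF K(1)] compactin_subset_topspace[OF Q] by (auto simp: topspace_eq)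
  have \<Gamma>G: "\<Gamma> \<subseteq> carrier G" by (rule subgroup.subset[OF \<Gamma>])
  have one: "\<one> <# \<Gamma> = \<Gamma>"
    using \<Gamma>G by (force simp: l_coset_def)
  have \<Gamma>X: "\<Gamma> \<in> topspace ?X"
    using one by (auto simp: topspace_coset intro!: image_eqI[of _ _ \<one>])
  have Qn: "m_inv G ` Q \<in> null_sets m"
    using Q0 by (intro null_setsI A.compact_M compact_inv_image[OF Q])
  have null: "\<forall>x\<in>topspace ?X. \<exists>A\<in>null_sets m. {g \<in> K. inv g <# x \<in> (\<lambda>q. q <# \<Gamma>) ` Q} \<subseteq> A"
  proof
    fix x assume x: "x \<in> topspace ?X"
    obtain z where z: "z \<in> carrier G" "x = z <# \<Gamma>"
      using x by (auto simp: topspace_coset)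
    let ?C = "(\<lambda>g. g \<otimes> z) ` (\<lambda>(x, y). x \<otimes> y) ` (m_inv G ` Q \<times> m_inv G ` K)"
    have "compactin T ?C"
      by (rule image_compactin[OF compact_mult[OF compact_inv_image[OF Q] compact_inv_image[OF K(1)]]
            mult_continuous_pair[OF id_continuous const_continuous[OF z(1)]]])
    then have "compactin T (\<Gamma> \<inter> ?C)"
      by (rule closed_Int_compactin[OF discrete_subgroup_closed[OF \<Gamma> disc hd]])
    then have "compactin (subtopology T \<Gamma>) (\<Gamma> \<inter> ?C)"
      by (simp add: compactin_subtopology)
    then have F: "finite (\<Gamma> \<inter> ?C)"
      by (simp add: disc compactin_discrete_topology)
    let ?A = "\<Union>\<gamma>\<in>\<Gamma> \<inter> ?C. (\<lambda>y. (z \<otimes> inv \<gamma>) \<otimes> y) ` m_inv G ` Q"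
    have "(\<lambda>y. (z \<otimes> inv \<gamma>) \<otimes> y) ` m_inv G ` Q \<in> null_sets m" if "\<gamma> \<in> \<Gamma> \<inter> ?C" for \<gamma>
    proof -
      have "z \<otimes> inv \<gamma> \<in> carrier G" using that z \<Gamma>G by auto
      then show ?thesis
        using Qn by (simp add: null_sets_def A.act_image_sets A.emeasure_act_image)
    qed
    then have "?A \<in> null_sets m"
      using F by (intro null_sets_UN') (auto simp: countable_finite)
    moreover have "{g \<in> K. inv g <# x \<in> (\<lambda>q. q <# \<Gamma>) ` Q} \<subseteq> ?A"
    proof
      fix g assume "g \<in> {g \<in> K. inv g <# x \<in> (\<lambda>q. q <# \<Gamma>) ` Q}"
      then obtain q where g: "g \<in> K" "q \<in> Q" "inv g <# (z <# \<Gamma>) = q <# \<Gamma>"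
        using z by blast
      then have gG: "g \<in> carrier G" "q \<in> carrier G" using KG QG by auto
      let ?\<gamma> = "inv q \<otimes> inv g \<otimes> z"
      have "q <# \<Gamma> = (inv g \<otimes> z) <# \<Gamma>"
        using g gG z by (simp add: l_coset_mult[OF \<Gamma>])
      then have "?\<gamma> \<in> \<Gamma>"
        using coset_eq_iff[OF \<Gamma>, of q "inv g \<otimes> z"] gG z by (simp add: m_assoc)
      moreover have "?\<gamma> \<in> ?C"
        using g(1,2) by blast
      moreover have "g = (z \<otimes> inv ?\<gamma>) \<otimes> inv q"
      proof -
        have "(z \<otimes> inv ?\<gamma>) \<otimes> inv q = z \<otimes> (inv z \<otimes> (g \<otimes> q)) \<otimes> inv q"
          using gG z by (simp add: inv_mult_group)
        also have "\<dots> = (z \<otimes> inv z) \<otimes> g \<otimes> (q \<otimes> inv q)"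
          using gG z by (simp only: m_assoc m_closed inv_closed)
        also have "\<dots> = g" using gG z by simp
        finally show ?thesis by simp
      qed
      ultimately show "g \<in> ?A"
        using g(2) by blast
    qed
    ultimately show "\<exists>A\<in>null_sets m. {g \<in> K. inv g <# x \<in> (\<lambda>q. q <# \<Gamma>) ` Q} \<subseteq> A" by blast
  qed
  obtain U where "openin ?X U" "\<Gamma> \<in> U" "measure \<nu> (\<Union>q\<in>Q. (\<lambda>C. q <# C) ` U) \<le> e"
    using X.small_tube[OF hd _ \<nu>(3) coset_locally_compact[OF \<Gamma> lc] K Q \<Gamma>X null e] A.reg by metis
  then show thesis by (rule that)
qed


section \<open>Comparison with the regular representation\<close>

lemma cc_of_real: "cc T \<phi> \<Longrightarrow> cc T (\<lambda>x. complex_of_real (\<phi> x))"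
  by (rule cc_cont_compose) (auto intro!: continuous_intros)

text \<open>The situation in which the comparison works: \<open>G\<close>, which will be the subgroup \<open>H\<close> of the theorem, acts on a
  probability space and \<open>x\<^sub>0\<close> has trivial stabiliser. The assumption \<open>thin\<close> says that compact pieces of the orbit
  of \<open>x\<^sub>0\<close> are null sets, in the form in which it is used.\<close>

locale free_orbit = mp_action G T act S M
  for G (structure) and T :: "'a topology" and act and S :: "'x topology" and M +
  fixes m :: "'a measure" and x0 :: 'x
  assumes lcT: "locally_compact_space T" and hdT: "Hausdorff_space T"
    and haar: "left_haar_measure G T m"
    and M_prob: "prob_space M"
    and x0: "x0 \<in> topspace S"
    and free: "t \<in> carrier G \<Longrightarrow> act t x0 = x0 \<Longrightarrow> t = \<one>"
    and thin: "compactin T Q \<Longrightarrow> e > 0 \<Longrightarrow> \<exists>U. openin S U \<and> x0 \<in> U \<and> measure M (\<Union>q\<in>Q. act q ` U) \<le> e"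
    and pos: "openin S U \<Longrightarrow> x0 \<in> U \<Longrightarrow> measure M U > 0"
begin

interpretation M: prob_space M by (rule M_prob)

sublocale left: mp_action G T "\<lambda>g x. g \<otimes> x" T m
  by (rule self_action[OF hdT haar])

lemma sets_m: "sets m = sets (borel_of T)" by (rule left.sets_M)

lemma space_m: "space m = carrier G" by (simp add: left.space_M topspace_eq)

lemma cc_int:
  fixes f :: "'a \<Rightarrow> 'y::{banach, second_countable_topology}"
  shows "cc T f \<Longrightarrow> integrable m f"
  using cc_integrable(2)[OF _ hdT left.reg] by blast

lemma cc_meas:
  fixes f :: "'a \<Rightarrow> 'y::{banach, second_countable_topology}"
  shows "cc T f \<Longrightarrow> f \<in> borel_measurable m"
  using cc_integrable(1)[OF _ hdT left.reg] by blast

lemma ind_l2: "openin S U \<Longrightarrow> (indicator U :: _ \<Rightarrow> complex) \<in> l2_fun M"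
  by (intro indicator_l2_fun open_M) (simp_all add: M.emeasure_eq_measure)

text \<open>The coefficient \<open>\<langle>\<pi>(k) 1\<^sub>U, 1\<^sub>U\<rangle>\<close>.\<close>

definition overlap :: "'x set \<Rightarrow> 'a \<Rightarrow> real"
  where "overlap U k = measure M (act k ` U \<inter> U)"

lemma overlap_bounds: "0 \<le> overlap U k" "overlap U k \<le> 1"
  by (simp_all add: overlap_def)

lemma overlap_measurable: "openin S U \<Longrightarrow> overlap U \<in> borel_measurable m"
  using coefficient_open_measurable[of U U] unfolding overlap_def
  by (simp add: measurable_cong_sets[OF sets_m] M.emeasure_eq_measure)

text \<open>The vector \<open>\<integral> \<phi>(h) \<pi>(h) 1\<^sub>U dh\<close>, a copy of \<open>\<phi>\<close> spread along the orbit of \<open>U\<close>.\<close>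

definition smear :: "'x set \<Rightarrow> ('a \<Rightarrow> real) \<Rightarrow> 'x \<Rightarrow> complex"
  where "smear U \<phi> = average m (\<lambda>h. of_real (\<phi> h)) (indicator U)"

text \<open>The inner product of \<open>\<pi>(h) 1\<^sub>U\<close> with \<open>smear U \<psi>\<close>; see lemma \<open>ip_tr_smear\<close>.\<close>

definition conv :: "'x set \<Rightarrow> ('a \<Rightarrow> real) \<Rightarrow> 'a \<Rightarrow> real"
  where "conv U \<psi> h = (LINT k|m. \<psi> (h \<otimes> k) * overlap U k)"

lemma smear:
  assumes "openin S U" "cc T \<phi>"
  shows smear_l2: "smear U \<phi> \<in> l2_fun M"
    and ip_smear: "\<And>\<eta>. \<eta> \<in> l2_fun M \<Longrightarrow>
      ip M (smear U \<phi>) \<eta> = (LINT h|m. of_real (\<phi> h) * ip M (tr h (indicator U)) \<eta>)"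
  using average_l2[OF sets_m cc_int[OF cc_of_real[OF assms(2)]] ind_l2[OF assms(1)]]
    ip_average[OF sets_m cc_int[OF cc_of_real[OF assms(2)]] ind_l2[OF assms(1)]]
  by (simp_all add: smear_def)

lemma ip_translates:
  assumes U: "openin S U" and h: "h \<in> carrier G" "k \<in> carrier G"
  shows "ip M (tr k (indicator U)) (tr h (indicator U)) = of_real (overlap U (inv h \<otimes> k))"
proof -
  let ?u = "indicator U :: _ \<Rightarrow> complex"
  note u = ind_l2[OF U]
  have "ip M (tr k ?u) (tr h ?u) = ip M (tr (inv h) (tr k ?u)) ?u"
    using ip_tr_left[OF inv_closed[OF h(1)] tr_l2[OF h(2) u] u] h by simp
  also have "\<dots> = ip M (tr (inv h \<otimes> k) ?u) ?u"
    using h by (simp add: ip_tr_mult)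
  also have "\<dots> = of_real (overlap U (inv h \<otimes> k))"
    using h U by (simp add: ip_tr_indicator open_M overlap_def)
  finally show ?thesis .
qed

lemma ip_tr_smear:
  assumes U: "openin S U" and \<psi>: "cc T \<psi>" and h: "h \<in> carrier G"
  shows "ip M (tr h (indicator U)) (smear U \<psi>) = of_real (conv U \<psi> h)"
proof -
  let ?u = "indicator U :: _ \<Rightarrow> complex"
  note [measurable] = overlap_measurable[OF U] cc_meas[OF \<psi>] left.act_measurable[OF inv_closed[OF h]]
  have "ip M (smear U \<psi>) (tr h ?u) = (LINT k|m. of_real (\<psi> k) * ip M (tr k ?u) (tr h ?u))"
    by (rule ip_smear[OF U \<psi> tr_l2[OF h ind_l2[OF U]]])
  also have "\<dots> = (LINT k|m. of_real (\<psi> k * overlap U (inv h \<otimes> k)))"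
    using h by (intro lint_cong) (simp add: ip_translates[OF U] space_m)
  also have "\<dots> = of_real (LINT k|m. \<psi> k * overlap U (inv h \<otimes> k))"
    by (rule integral_complex_of_real)
  also have "(LINT k|m. \<psi> k * overlap U (inv h \<otimes> k)) = (LINT k|m. \<psi> (h \<otimes> k) * overlap U (inv h \<otimes> (h \<otimes> k)))"
    by (rule left.integral_act[OF h, symmetric]) measurable
  also have "\<dots> = conv U \<psi> h"
    unfolding conv_def using h
    by (intro lint_cong) (simp add: space_m m_assoc[symmetric])
  finally show ?thesis
    using ip_commute[of M "tr h ?u" "smear U \<psi>"] by simp
qed

lemma conv_measurable:
  assumes U: "openin S U" and \<psi>: "cc T \<psi>"
  shows "conv U \<psi> \<in> borel_measurable m"
proof -
  have "(\<lambda>h. Re (ip M (tr h (indicator U)) (smear U \<psi>))) \<in> borel_measurable m"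
    using coefficient_measurable[OF ind_l2[OF U] smear_l2[OF U \<psi>]] by (simp add: measurable_cong_sets[OF sets_m])
  then show ?thesis
    by (subst (asm) measurable_cong[where g = "conv U \<psi>"]) (simp_all add: ip_tr_smear[OF U \<psi>] space_m)
qed

lemma conv_integrable:
  assumes U: "openin S U" and \<psi>: "cc T \<psi>" and f: "integrable m (f :: 'a \<Rightarrow> real)"
  shows "integrable m (\<lambda>h. f h * conv U \<psi> h)"
proof -
  have "integrable m (\<lambda>h. Re (of_real (f h) * ip M (tr h (indicator U)) (smear U \<psi>)))"
    using f by (intro integrable_Re coefficient_bounded_integrable(1)[OF sets_m _ ind_l2[OF U] smear_l2[OF U \<psi>]]) simp
  moreover have "Re (of_real (f h) * ip M (tr h (indicator U)) (smear U \<psi>)) = f h * conv U \<psi> h"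
    if "h \<in> space m" for h
    using that by (simp add: ip_tr_smear[OF U \<psi>] space_m)
  ultimately show ?thesis
    by (subst (asm) Bochner_Integration.integrable_cong[where g = "\<lambda>h. f h * conv U \<psi> h"]) auto
qed

text \<open>Both vectors are given by weak integrals, so the inner product unfolds first in one and then in the other;
  left invariance of Haar measure moves \<open>g\<close> into the weight.\<close>

lemma ip_smear_smear:
  assumes U: "openin S U" and \<phi>: "cc T \<phi>" and \<psi>: "cc T \<psi>" and g: "g \<in> carrier G"
  shows "ip M (tr g (smear U \<phi>)) (smear U \<psi>) = of_real (LINT h|m. \<phi> (inv g \<otimes> h) * conv U \<psi> h)"
proof -
  let ?u = "indicator U :: _ \<Rightarrow> complex"
  note u = ind_l2[OF U] and s\<phi> = smear_l2[OF U \<phi>] and s\<psi> = smear_l2[OF U \<psi>]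
  note [measurable] = cc_meas[OF \<phi>] conv_measurable[OF U \<psi>] left.act_measurable[OF inv_closed[OF g]]
  have "ip M (tr g (smear U \<phi>)) (smear U \<psi>) = ip M (smear U \<phi>) (tr (inv g) (smear U \<psi>))"
    by (rule ip_tr_left[OF g s\<phi> s\<psi>])
  also have "\<dots> = (LINT h|m. of_real (\<phi> h) * ip M (tr h ?u) (tr (inv g) (smear U \<psi>)))"
    using g by (intro ip_smear[OF U \<phi>] tr_l2 s\<psi>) simp
  also have "\<dots> = (LINT h|m. of_real (\<phi> (inv g \<otimes> (g \<otimes> h)) * conv U \<psi> (g \<otimes> h)))"
  proof (intro lint_cong)
    fix h assume "h \<in> space m"
    then have h: "h \<in> carrier G" by (simp add: space_m)
    have "ip M (tr h ?u) (tr (inv g) (smear U \<psi>)) = ip M (tr g (tr h ?u)) (smear U \<psi>)"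
      using ip_tr_left[OF g tr_l2[OF h u] s\<psi>] by simp
    also have "\<dots> = of_real (conv U \<psi> (g \<otimes> h))"
      using g h by (simp add: ip_tr_mult[symmetric] ip_tr_smear[OF U \<psi>])
    finally show "of_real (\<phi> h) * ip M (tr h ?u) (tr (inv g) (smear U \<psi>))
        = of_real (\<phi> (inv g \<otimes> (g \<otimes> h)) * conv U \<psi> (g \<otimes> h))"
      using g h by (simp add: m_assoc[symmetric])
  qed
  also have "\<dots> = of_real (LINT h|m. \<phi> (inv g \<otimes> (g \<otimes> h)) * conv U \<psi> (g \<otimes> h))"
    by (rule integral_complex_of_real)
  also have "(LINT h|m. \<phi> (inv g \<otimes> (g \<otimes> h)) * conv U \<psi> (g \<otimes> h)) = (LINT h|m. \<phi> (inv g \<otimes> h) * conv U \<psi> h)"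
    by (rule left.integral_act[OF g]) measurable
  finally show ?thesis .
qed

lemma l2n_smear:
  assumes U: "openin S U" and \<phi>: "cc T \<phi>"
  shows "(l2n M (smear U \<phi>))\<^sup>2 = (LINT h|m. \<phi> h * conv U \<phi> h)"
proof -
  have "complex_of_real ((l2n M (smear U \<phi>))\<^sup>2) = ip M (smear U \<phi>) (smear U \<phi>)"
    by (simp add: ip_self)
  also have "\<dots> = (LINT h|m. of_real (\<phi> h) * ip M (tr h (indicator U)) (smear U \<phi>))"
    by (rule ip_smear[OF U \<phi> smear_l2[OF U \<phi>]])
  also have "\<dots> = (LINT h|m. of_real (\<phi> h * conv U \<phi> h))"
    by (intro lint_cong) (simp add: ip_tr_smear[OF U \<phi>] space_m)
  also have "\<dots> = of_real (LINT h|m. \<phi> h * conv U \<phi> h)"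
    by (rule integral_complex_of_real)
  finally show ?thesis using of_real_eq_iff by blast
qed

text \<open>Only \<open>k \<in> N\<close> contribute to the integral that defines \<open>conv U \<psi> h\<close>, and there \<open>\<psi> (h k)\<close> may be replaced by \<open>\<psi> h\<close>.\<close>

lemma conv_close:
  assumes U: "openin S U" and \<psi>: "cc T \<psi>" and N: "N \<in> sets m" "emeasure m N < \<infinity>" and h: "h \<in> carrier G"
    and uc: "\<And>k. k \<in> N \<Longrightarrow> \<bar>\<psi> (h \<otimes> k) - \<psi> h\<bar> \<le> \<delta>"
    and conc: "\<And>k. k \<in> carrier G \<Longrightarrow> \<psi> (h \<otimes> k) \<noteq> 0 \<Longrightarrow> overlap U k \<noteq> 0 \<Longrightarrow> k \<in> N"
  shows "\<bar>conv U \<psi> h - (LINT k|m. indicator N k * overlap U k) * \<psi> h\<bar> \<le> \<delta> * (LINT k|m. indicator N k * overlap U k)"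
proof -
  let ?p = "\<lambda>k. indicator N k * overlap U k"
  note [measurable] = overlap_measurable[OF U] cc_meas[OF \<psi>] left.act_measurable[OF h] N(1)
  have p: "integrable m ?p"
  proof (rule Bochner_Integration.integrable_bound)
    show "integrable m (indicator N :: 'a \<Rightarrow> real)" using N by simp
    show "AE k in m. norm (?p k) \<le> norm (indicator N k :: real)"
      using overlap_bounds[of U] by (intro AE_I2) (auto simp: indicator_def)
  qed measurable
  have bnd: "\<bar>?p k * (\<psi> (h \<otimes> k) - \<psi> h)\<bar> \<le> \<delta> * ?p k" for k
  proof (cases "k \<in> N")
    case True
    then show ?thesis
      using mult_right_mono[OF uc[OF True] overlap_bounds(1)[of U k]] overlap_bounds(1)[of U k]
      by (simp add: abs_mult mult.commute)
  qed simp
  have d: "integrable m (\<lambda>k. ?p k * (\<psi> (h \<otimes> k) - \<psi> h))"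
  proof (rule Bochner_Integration.integrable_bound)
    show "integrable m (\<lambda>k. \<delta> * ?p k)" using p by simp
    show "AE k in m. norm (?p k * (\<psi> (h \<otimes> k) - \<psi> h)) \<le> norm (\<delta> * ?p k)"
      by (intro AE_I2) (metis abs_ge_self bnd order_trans real_norm_def)
  qed measurable
  have "conv U \<psi> h = (LINT k|m. ?p k * (\<psi> (h \<otimes> k) - \<psi> h) + ?p k * \<psi> h)"
    unfolding conv_def
  proof (intro lint_cong)
    fix k assume "k \<in> space m"
    then show "\<psi> (h \<otimes> k) * overlap U k = ?p k * (\<psi> (h \<otimes> k) - \<psi> h) + ?p k * \<psi> h"
      using conc[of k] by (auto simp: space_m indicator_def algebra_simps)
  qed
  also have "\<dots> = (LINT k|m. ?p k * (\<psi> (h \<otimes> k) - \<psi> h)) + (LINT k|m. ?p k) * \<psi> h"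
    using d p by (subst Bochner_Integration.integral_add) auto
  finally have "\<bar>conv U \<psi> h - (LINT k|m. ?p k) * \<psi> h\<bar> = \<bar>LINT k|m. ?p k * (\<psi> (h \<otimes> k) - \<psi> h)\<bar>"
    by simp
  also have "\<dots> \<le> (LINT k|m. \<bar>?p k * (\<psi> (h \<otimes> k) - \<psi> h)\<bar>)"
    by (rule integral_abs_bound)
  also have "\<dots> \<le> (LINT k|m. \<delta> * ?p k)"
    using d p bnd by (intro integral_mono) auto
  finally show ?thesis by simp
qed

text \<open>The pointwise estimate of the previous lemma, tested against a nonnegative weight on whose support it holds.\<close>

lemma conv_integral_close:
  assumes U: "openin S U" and \<psi>: "cc T \<psi>" and f: "integrable m f" "\<And>h. h \<in> carrier G \<Longrightarrow> 0 \<le> f h"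
    and close: "\<And>h. h \<in> carrier G \<Longrightarrow> f h \<noteq> 0 \<Longrightarrow> \<bar>conv U \<psi> h - c * \<psi> h\<bar> \<le> \<delta> * c"
  shows "\<bar>(LINT h|m. f h * conv U \<psi> h) - c * (LINT h|m. f h * \<psi> h)\<bar> \<le> \<delta> * c * (LINT h|m. f h)"
proof -
  obtain B where B: "\<And>x. x \<in> topspace T \<Longrightarrow> norm (\<psi> x) \<le> B" "B \<ge> 0"
    using cc_bounded[OF \<psi>] by metis
  have fm: "f \<in> borel_measurable m" using f(1) by simp
  note [measurable] = cc_meas[OF \<psi>] fm
  have i1: "integrable m (\<lambda>h. f h * conv U \<psi> h)"
    by (rule conv_integrable[OF U \<psi> f(1)])
  have i2: "integrable m (\<lambda>h. f h * \<psi> h)"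
  proof (rule Bochner_Integration.integrable_bound)
    show "integrable m (\<lambda>h. B * f h)" using f(1) by simp
    show "AE h in m. norm (f h * \<psi> h) \<le> norm (B * f h)"
      using B by (intro AE_I2) (auto simp: space_m topspace_eq abs_mult mult.commute intro!: mult_right_mono)
  qed measurable
  have "(LINT h|m. f h * conv U \<psi> h) - c * (LINT h|m. f h * \<psi> h) = (LINT h|m. f h * (conv U \<psi> h - c * \<psi> h))"
    using i1 i2 by (simp add: right_diff_distrib mult.left_commute)
  also have "\<bar>\<dots>\<bar> \<le> (LINT h|m. \<bar>f h * (conv U \<psi> h - c * \<psi> h)\<bar>)"
    by (rule integral_abs_bound)
  also have "\<dots> \<le> (LINT h|m. \<delta> * c * f h)"
  proof (rule integral_mono)
    show "integrable m (\<lambda>h. \<bar>f h * (conv U \<psi> h - c * \<psi> h)\<bar>)"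
      using i1 i2 by (intro integrable_abs) (simp add: right_diff_distrib mult.left_commute)
    show "integrable m (\<lambda>h. \<delta> * c * f h)" using f(1) by simp
    fix h assume "h \<in> space m"
    then have h: "h \<in> carrier G" by (simp add: space_m)
    show "\<bar>f h * (conv U \<psi> h - c * \<psi> h)\<bar> \<le> \<delta> * c * f h"
      using close[OF h] f(2)[OF h] by (cases "f h = 0") (auto simp: abs_mult mult.commute intro!: mult_right_mono)
  qed
  finally show ?thesis by simp
qed

end


context free_orbit
begin

interpretation M: prob_space M by (rule M_prob)

text \<open>Because the stabiliser of \<open>x\<^sub>0\<close> is trivial, a small neighbourhood of \<open>x\<^sub>0\<close> is disjoint from its translates
  by a compact set of group elements that stays away from the identity.\<close>

lemma small_neighbourhood:
  assumes Q2: "compactin T Q2" and N: "openin T N" "\<one> \<in> N" and Q0: "compactin T Q0" and \<delta>: "\<delta> > 0"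
  obtains U where "openin S U" "x0 \<in> U" "measure M (\<Union>q\<in>Q0. act q ` U) \<le> \<delta>"
    "\<And>k. k \<in> Q2 \<Longrightarrow> k \<notin> N \<Longrightarrow> overlap U k = 0"
proof -
  have "Q2 - N = (topspace T - N) \<inter> Q2"
    using compactin_subset_topspace[OF Q2] by auto
  moreover have "closedin T (topspace T - N)" using N(1) by blast
  ultimately have K: "compactin T (Q2 - N)"
    using closed_Int_compactin[OF _ Q2] by simp
  have cx: "compactin S {x0}" using x0 by simp
  have C: "compactin S ((\<lambda>k. act k x0) ` (Q2 - N))"
    by (rule image_compactin[OF K orbit_cont[OF x0]])
  have dj: "disjnt ((\<lambda>k. act k x0) ` (Q2 - N)) {x0}"
    using free N(2) compactin_subset_topspace[OF Q2] by (auto simp: disjnt_iff topspace_eq)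
  obtain O1 O2 where O12: "openin S O1" "openin S O2" "(\<lambda>k. act k x0) ` (Q2 - N) \<subseteq> O1" "{x0} \<subseteq> O2" "disjnt O1 O2"
    using Hausdorff_space_compact_separation[OF S_hausdorff C cx dj] by metis
  have *: "act g y \<in> O1" if "g \<in> Q2 - N" "y \<in> {x0}" for g y
    using that O12(3) by auto
  obtain V U2 where U2: "openin S U2" "Q2 - N \<subseteq> V" "{x0} \<subseteq> U2" "\<forall>g\<in>V. \<forall>y\<in>U2. act g y \<in> O1"
    using act_tube[OF K cx O12(1) *] by metis
  obtain U1 where U1: "openin S U1" "x0 \<in> U1" "measure M (\<Union>q\<in>Q0. act q ` U1) \<le> \<delta>"
    using thin[OF Q0 \<delta>] by blast
  let ?U = "O2 \<inter> U2 \<inter> U1"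
  have QG: "Q0 \<subseteq> carrier G" using compactin_subset_topspace[OF Q0] by (simp add: topspace_eq)
  show thesis
  proof (rule that[of ?U])
    show "openin S ?U" using O12 U2 U1 by blast
    show "x0 \<in> ?U" using O12 U2 U1 by blast
    have o: "openin S (\<Union>q\<in>Q0. act q ` U1)"
      using QG U1(1) by (intro openin_Union) (auto intro: open_act_image)
    have "measure M (\<Union>q\<in>Q0. act q ` ?U) \<le> measure M (\<Union>q\<in>Q0. act q ` U1)"
      by (rule M.finite_measure_mono[OF _ open_M[OF o]]) blast
    then show "measure M (\<Union>q\<in>Q0. act q ` ?U) \<le> \<delta>" using U1(3) by simp
    fix k assume k: "k \<in> Q2" "k \<notin> N"
    have e: "act k ` ?U \<inter> ?U = {}"
      using k U2(2,4) O12(5) by (auto simp: disjnt_iff)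
    show "overlap ?U k = 0"
      unfolding overlap_def e by (rule measure_empty)
  qed
qed

text \<open>For \<open>k\<close> close to the identity, \<open>k U \<inter> U\<close> contains the translate by \<open>k\<close> of one fixed neighbourhood of \<open>x\<^sub>0\<close>.\<close>

lemma overlap_mass_positive:
  assumes U: "openin S U" "x0 \<in> U" and N: "openin T N" "\<one> \<in> N" "emeasure m N < \<infinity>"
  shows "0 < (LINT k|m. indicator N k * overlap U k)"
proof -
  note [measurable] = overlap_measurable[OF U(1)] left.open_M[OF N(1)]
  have cx: "compactin S {x0}" and c1: "compactin T {\<one>}" using x0 by (simp_all add: topspace_eq)
  have *: "act g y \<in> U" if "g \<in> {\<one>}" "y \<in> {x0}" for g y
    using that U(2) act_one[OF x0] by simp
  obtain N0 V where NV: "openin T N0" "openin S V" "{\<one>} \<subseteq> N0" "{x0} \<subseteq> V" "\<forall>g\<in>N0. \<forall>y\<in>V. act g y \<in> U"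
    using act_tube[OF c1 cx U(1) *] by metis
  let ?V = "V \<inter> U" and ?N = "N \<inter> N0"
  have V: "openin S ?V" "x0 \<in> ?V" using NV U by auto
  have N': "openin T ?N" "\<one> \<in> ?N" using NV N by auto
  have le: "measure M ?V \<le> overlap U k" if k: "k \<in> N0" for k
  proof -
    have kG: "k \<in> carrier G" using openin_subset[OF NV(1)] k by (auto simp: topspace_eq)
    have "measure M ?V = measure M (act k ` ?V)"
      using measure_act_image[OF kG open_M[OF V(1)]] by simp
    also have "\<dots> \<le> overlap U k"
      unfolding overlap_def
      by (rule M.finite_measure_mono[OF _ open_M[OF openin_Int[OF open_act_image[OF kG U(1)] U(1)]]])
        (use NV(5) k in auto)
    finally show ?thesis .
  qed
  have trans: "\<exists>g\<in>carrier G. g \<otimes> x = y" if "x \<in> topspace T" "y \<in> topspace T" for x y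
    using that by (intro bexI[of _ "y \<otimes> inv x"]) (auto simp: topspace_eq m_assoc)
  have nz: "emeasure m (space m) \<noteq> 0" using haar by (simp add: left_haar_measure_def)
  have "0 < emeasure m ?N"
    using N'(2) by (intro left.open_positive[OF trans nz N'(1)]) auto
  moreover have Nfin: "emeasure m ?N < \<infinity>"
    using le_less_trans[OF emeasure_mono[of ?N N m] N(3)] left.open_M[OF N(1)] by auto
  ultimately have mN: "0 < measure m ?N"
    by (simp add: measure_def enn2real_positive_iff)
  have "0 < measure m ?N * measure M ?V"
    using mN pos[OF V] by simp
  also have "\<dots> = (LINT k|m. indicator ?N k * measure M ?V)"
    using left.open_M[OF N'(1)] sets.sets_into_space[OF left.open_M[OF N'(1)]] by (simp add: Int_absorb2)
  also have "\<dots> \<le> (LINT k|m. indicator N k * overlap U k)"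
  proof (rule integral_mono)
    show "integrable m (\<lambda>k. indicator ?N k * measure M ?V)"
      using left.open_M[OF N'(1)] Nfin by simp
    show "integrable m (\<lambda>k. indicator N k * overlap U k)"
    proof (rule Bochner_Integration.integrable_bound)
      show "integrable m (indicator N :: 'a \<Rightarrow> real)" using N left.open_M[OF N(1)] by simp
      show "AE k in m. norm (indicator N k * overlap U k) \<le> norm (indicator N k :: real)"
        using overlap_bounds[of U] by (intro AE_I2) (auto simp: indicator_def)
    qed measurable
    fix k
    show "indicator ?N k * measure M ?V \<le> indicator N k * overlap U k"
      using le[of k] overlap_bounds(1)[of U k] by (auto simp: indicator_def)
  qed
  finally show ?thesis .
qed

text \<open>The coefficient \<open>\<langle>\<lambda>(g) \<phi>, \<psi>\<rangle>\<close> of the regular representation.\<close>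

definition pairing :: "('a \<Rightarrow> real) \<Rightarrow> ('a \<Rightarrow> real) \<Rightarrow> 'a \<Rightarrow> real"
  where "pairing \<phi> \<psi> g = (LINT h|m. \<phi> (inv g \<otimes> h) * \<psi> h)"

lemma cc_l2: "cc T \<phi> \<Longrightarrow> \<phi> \<in> l2_fun m"
  by (rule cc_l2_fun[OF _ hdT left.reg])

lemma ip_pairing: "ip m (left.tr g (\<lambda>x. of_real (\<phi> x))) (\<lambda>x. of_real (\<psi> x)) = of_real (pairing \<phi> \<psi> g)"
proof -
  have "ip m (left.tr g (\<lambda>x. of_real (\<phi> x))) (\<lambda>x. of_real (\<psi> x))
      = (LINT h|m. complex_of_real (\<phi> (inv g \<otimes> h) * \<psi> h))"
    by (simp add: ip_def left.tr_def)
  also have "\<dots> = of_real (pairing \<phi> \<psi> g)"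
    unfolding pairing_def by (rule integral_complex_of_real)
  finally show ?thesis .
qed

lemma pairing_le:
  assumes "cc T \<phi>" "cc T \<psi>" "g \<in> carrier G"
  shows "pairing \<phi> \<psi> g \<le> l2n m (\<lambda>x. of_real (\<phi> x)) * l2n m (\<lambda>x. of_real (\<psi> x))"
  using left.ip_tr_bound[OF assms(3) cc_l2[OF cc_of_real[OF assms(1)]] cc_l2[OF cc_of_real[OF assms(2)]]]
  by (simp add: ip_pairing)

lemma conv_nonneg:
  assumes "\<And>h. h \<in> carrier G \<Longrightarrow> 0 \<le> \<psi> h" "h \<in> carrier G"
  shows "0 \<le> conv U \<psi> h"
  unfolding conv_def using assms overlap_bounds(1) by (intro integral_nonneg_AE AE_I2) (simp add: space_m)

text \<open>The mean of \<open>smear U \<phi>\<close> is small compared with its norm, because the function lives on the thin tube \<open>Q\<^sub>0 U\<close>.\<close>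

lemma smear_mean:
  assumes U: "openin S U" and \<phi>: "cc T \<phi>" "\<And>h. h \<in> carrier G \<Longrightarrow> 0 \<le> \<phi> h"
    and Q0: "Q0 \<subseteq> carrier G" "\<And>h. h \<in> carrier G \<Longrightarrow> h \<notin> Q0 \<Longrightarrow> \<phi> h = 0"
  defines "P \<equiv> (\<Union>q\<in>Q0. act q ` U)" and "\<mu> \<equiv> measure M U * (LINT h|m. \<phi> h)"
  shows "ip M (smear U \<phi>) (\<lambda>_. 1) = of_real \<mu>" and "0 \<le> \<mu>" and "\<mu> \<le> l2n M (smear U \<phi>) * sqrt (measure M P)"
proof -
  let ?u = "indicator U :: _ \<Rightarrow> complex"
  have e: "(\<lambda>_. 1) \<in> l2_fun M" by (simp add: l2_fun_def)
  have US: "U \<subseteq> topspace S" by (rule openin_subset[OF U])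
  have "openin S P"
    unfolding P_def using Q0(1) U by (intro openin_Union) (auto intro: open_act_image)
  then have P: "P \<in> sets M" "(indicator P :: _ \<Rightarrow> complex) \<in> l2_fun M"
    by (auto intro: open_M ind_l2)
  have 1: "ip M (tr h ?u) (\<lambda>_. 1) = of_real (measure M U)" if h: "h \<in> carrier G" for h
  proof -
    have "ip M (tr h ?u) (\<lambda>_. 1) = ip M (tr h ?u) (indicator (topspace S))"
      unfolding ip_def by (intro lint_cong) (simp add: space_M)
    also have "\<dots> = of_real (measure M (act h ` U \<inter> topspace S))"
      by (rule ip_tr_indicator[OF h]) (auto intro: open_M U)
    also have "act h ` U \<inter> topspace S = act h ` U"
      using act_image_subset[OF h US] by blast
    finally show ?thesis by (simp add: measure_act_image[OF h open_M[OF U]])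
  qed
  have 2: "ip M (tr h ?u) (indicator P) = of_real (measure M U)" if h: "h \<in> Q0" for h
  proof -
    have hG: "h \<in> carrier G" using h Q0 by blast
    have "act h ` U \<inter> P = act h ` U" using h by (auto simp: P_def)
    then show ?thesis
      using ip_tr_indicator[OF hG open_M[OF U] P(1)] by (simp add: measure_act_image[OF hG open_M[OF U]])
  qed
  have *: "(LINT h|m. complex_of_real (\<phi> h) * of_real (measure M U)) = of_real \<mu>"
    by (simp add: \<mu>_def mult.commute)
  have "ip M (smear U \<phi>) (\<lambda>_. 1) = (LINT h|m. of_real (\<phi> h) * ip M (tr h ?u) (\<lambda>_. 1))"
    by (rule ip_smear[OF U \<phi>(1) e])
  also have "\<dots> = (LINT h|m. complex_of_real (\<phi> h) * of_real (measure M U))"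
    by (intro lint_cong) (simp add: 1 space_m)
  finally show "ip M (smear U \<phi>) (\<lambda>_. 1) = of_real \<mu>" by (simp only: *)
  have "ip M (smear U \<phi>) (indicator P) = (LINT h|m. of_real (\<phi> h) * ip M (tr h ?u) (indicator P))"
    by (rule ip_smear[OF U \<phi>(1) P(2)])
  also have "\<dots> = (LINT h|m. complex_of_real (\<phi> h) * of_real (measure M U))"
  proof (intro lint_cong)
    fix h assume "h \<in> space m"
    then show "of_real (\<phi> h) * ip M (tr h ?u) (indicator P) = complex_of_real (\<phi> h) * of_real (measure M U)"
      using 2[of h] Q0(2)[of h] by (cases "h \<in> Q0") (auto simp: space_m)
  qed
  finally have ipP: "ip M (smear U \<phi>) (indicator P) = of_real \<mu>" by (simp only: *)
  show \<mu>0: "0 \<le> \<mu>"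
    unfolding \<mu>_def using \<phi>(2) by (intro mult_nonneg_nonneg integral_nonneg_AE AE_I2) (auto simp: space_m)
  have "l2n M (indicator P) = sqrt (measure M P)"
    using l2n_indicator[OF P(1)] by (metis l2n_nonneg real_sqrt_unique)
  then show "\<mu> \<le> l2n M (smear U \<phi>) * sqrt (measure M P)"
    using l2_cauchy_schwarz[OF smear_l2[OF U \<phi>(1)] P(2)] \<mu>0 by (simp add: ipP)
qed

end

text \<open>From here on \<open>C\<close> bounds \<open>\<pi>(\<rho>)\<close> on the functions of mean zero.\<close>

locale koopman_bound = free_orbit G T act S M m x0
  for G (structure) and T :: "'a topology" and act and S :: "'x topology" and M and m and x0 +
  fixes \<rho> :: "'a measure" and C :: real
  assumes \<rho>: "regular_borel_measure T \<rho>" "finite_measure \<rho>"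
    and C: "0 \<le> C" "\<And>f. f \<in> l2_fun M \<Longrightarrow> (LINT x|M. f x) = 0 \<Longrightarrow> l2n M (average \<rho> (\<lambda>_. 1) f) \<le> C * l2n M f"
begin

interpretation M: prob_space M by (rule M_prob)

interpretation \<rho>: finite_measure \<rho> by (rule \<rho>(2))

lemmas sets_\<rho> = regularD(1)[OF \<rho>(1)]

lemma space_\<rho>: "space \<rho> = carrier G"
  using regularD(2)[OF \<rho>(1)] by (simp add: topspace_eq)

lemma one_integrable: "integrable \<rho> (\<lambda>_. 1 :: complex)" by simp

lemma pairing_integrable:
  assumes "cc T \<phi>" "cc T \<psi>"
  shows "integrable \<rho> (pairing \<phi> \<psi>)"
proof -
  have "integrable \<rho> (\<lambda>h. Re (1 * ip m (left.tr h (\<lambda>x. of_real (\<phi> x))) (\<lambda>x. of_real (\<psi> x))))"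
    by (intro integrable_Re left.coefficient_bounded_integrable(1)[OF sets_\<rho> one_integrable] cc_l2 cc_of_real assms)
  then show ?thesis by (simp add: ip_pairing)
qed

text \<open>The bound \<open>C\<close> applies to vectors after subtraction of their means. The constant function is invariant, so the
  coefficient of the centred vectors differs from the original one by the product of the means.\<close>

lemma centred_bound:
  assumes F: "F \<in> l2_fun M" "F' \<in> l2_fun M"
    and mean: "ip M F (\<lambda>_. 1) = of_real \<mu>" "ip M F' (\<lambda>_. 1) = of_real \<mu>'"
    and b: "integrable \<rho> b" "\<And>g. g \<in> carrier G \<Longrightarrow> ip M (tr g F) F' = of_real (b g)"
  shows "(LINT g|\<rho>. b g) \<le> C * l2n M F * l2n M F' + measure \<rho> (space \<rho>) * (\<mu> * \<mu>')"
proof -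
  define e where "e = (\<lambda>_::'x. 1 :: complex)"
  have e: "e \<in> l2_fun M" by (simp add: l2_fun_def e_def)
  have ee: "ip M e e = 1" by (simp add: ip_def e_def M.prob_space)
  have tre: "tr g e = e" for g by (simp add: tr_def e_def)
  note mean' = mean[folded e_def]
  define Z where "Z f \<nu> = (\<lambda>x. f x - complex_of_real \<nu> * e x)" for f \<nu>
  have Zl2: "Z f \<nu> \<in> l2_fun M" if "f \<in> l2_fun M" for f \<nu>
    unfolding Z_def by (intro l2_fun_diff l2_fun_scale that e)
  have Ze: "ip M (Z f \<nu>) e = 0" if "f \<in> l2_fun M" "ip M f e = of_real \<nu>" for f \<nu>
    unfolding Z_def using that by (simp add: ip_diff_left l2_fun_scale e ip_scale_left ee)
  have Zn: "l2n M (Z f \<nu>) \<le> l2n M f" if f: "f \<in> l2_fun M" "ip M f e = of_real \<nu>" for f \<nu>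
  proof (rule power2_le_imp_le)
    have "(l2n M (\<lambda>x. Z f \<nu> x + of_real \<nu> * e x))\<^sup>2
        = (l2n M (Z f \<nu>))\<^sup>2 + 2 * Re (ip M (Z f \<nu>) (\<lambda>x. of_real \<nu> * e x)) + (l2n M (\<lambda>x. of_real \<nu> * e x))\<^sup>2"
      by (rule l2n_add_power2[OF Zl2[OF f(1)] l2_fun_scale[OF e]])
    moreover have "Re (ip M (Z f \<nu>) (\<lambda>x. of_real \<nu> * e x)) = 0"
      by (simp add: ip_scale_right Ze[OF f])
    moreover have "(\<lambda>x. Z f \<nu> x + of_real \<nu> * e x) = f"
      by (simp add: Z_def)
    ultimately show "(l2n M (Z f \<nu>))\<^sup>2 \<le> (l2n M f)\<^sup>2"
      using zero_le_power2[of "l2n M (\<lambda>x. of_real \<nu> * e x)"] by simp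
  qed simp
  have co: "ip M (tr g (Z F \<mu>)) (Z F' \<mu>') = of_real (b g - \<mu> * \<mu>')" if g: "g \<in> carrier G" for g
  proof -
    have "tr g (Z F \<mu>) = (\<lambda>x. tr g F x - of_real \<mu> * e x)"
      by (simp add: tr_def Z_def e_def)
    then have "ip M (tr g (Z F \<mu>)) (Z F' \<mu>') = ip M (tr g F) (Z F' \<mu>') - of_real \<mu> * ip M e (Z F' \<mu>')"
      by (simp add: ip_diff_left tr_l2[OF g F(1)] l2_fun_scale e Zl2 F ip_scale_left)
    also have "ip M e (Z F' \<mu>') = 0"
      using Ze[OF F(2) mean'(2)] ip_commute[of M e "Z F' \<mu>'"] by simp
    also have "ip M (tr g F) (Z F' \<mu>') = ip M (tr g F) F' - of_real \<mu>' * ip M (tr g F) e"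
      unfolding Z_def by (simp add: ip_diff_right tr_l2[OF g F(1)] l2_fun_scale e F ip_scale_right)
    also have "ip M (tr g F) e = of_real \<mu>"
      using ip_tr[OF g F(1) e] mean'(1) by (simp add: tre)
    finally show ?thesis by (simp add: b(2)[OF g] mult.commute)
  qed
  let ?A = "average \<rho> (\<lambda>_. 1) (Z F \<mu>)"
  have "ip M ?A (Z F' \<mu>') = (LINT g|\<rho>. 1 * ip M (tr g (Z F \<mu>)) (Z F' \<mu>'))"
    by (rule ip_average[OF sets_\<rho> one_integrable Zl2[OF F(1)] Zl2[OF F(2)]])
  also have "\<dots> = (LINT g|\<rho>. complex_of_real (b g - \<mu> * \<mu>'))"
    by (intro lint_cong) (simp add: co space_\<rho>)
  also have "\<dots> = of_real (LINT g|\<rho>. b g - \<mu> * \<mu>')"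
    by (rule integral_complex_of_real)
  also have "(LINT g|\<rho>. b g - \<mu> * \<mu>') = (LINT g|\<rho>. b g) - measure \<rho> (space \<rho>) * (\<mu> * \<mu>')"
    using b(1) by simp
  finally have eq: "ip M ?A (Z F' \<mu>') = of_real ((LINT g|\<rho>. b g) - measure \<rho> (space \<rho>) * (\<mu> * \<mu>'))" .
  have "(LINT g|\<rho>. b g) - measure \<rho> (space \<rho>) * (\<mu> * \<mu>') \<le> cmod (ip M ?A (Z F' \<mu>'))"
    unfolding eq norm_of_real by (rule abs_ge_self)
  also have "\<dots> \<le> l2n M ?A * l2n M (Z F' \<mu>')"
    by (rule l2_cauchy_schwarz[OF average_l2[OF sets_\<rho> one_integrable Zl2[OF F(1)]] Zl2[OF F(2)]])
  also have "\<dots> \<le> (C * l2n M (Z F \<mu>)) * l2n M (Z F' \<mu>')"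
  proof (intro mult_right_mono C(2) Zl2 F)
    show "(LINT x|M. Z F \<mu> x) = 0"
      using Ze[OF F(1) mean'(1)] by (simp add: ip_def e_def)
  qed simp
  also have "\<dots> \<le> (C * l2n M F) * l2n M F'"
    using C(1) Zn[OF F(1) mean'(1)] Zn[OF F(2) mean'(2)]
    by (intro mult_mono mult_left_mono mult_nonneg_nonneg) auto
  finally show ?thesis by simp
qed

text \<open>The heart of the proof. The vectors \<open>smear U \<phi>\<close> and \<open>smear U \<psi>\<close> for a suitable small \<open>U\<close> are inserted into the
  previous lemma; every term is then comparable with the mass \<open>c\<close> of the overlap near the identity, and dividing
  by \<open>c\<close> leaves an estimate in which \<open>U\<close> no longer occurs.\<close>

lemma pairing_approx:
  assumes \<phi>: "cc T \<phi>" "\<And>h. h \<in> carrier G \<Longrightarrow> 0 \<le> \<phi> h"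
    and \<psi>: "cc T \<psi>" "\<And>h. h \<in> carrier G \<Longrightarrow> 0 \<le> \<psi> h"
    and K: "compactin T K" and \<delta>: "\<delta> > 0"
  defines "X \<equiv> (l2n m (\<lambda>x. of_real (\<phi> x)))\<^sup>2" and "Y \<equiv> (l2n m (\<lambda>x. of_real (\<psi> x)))\<^sup>2"
    and "I \<equiv> (LINT h|m. \<phi> h)" and "J \<equiv> (LINT h|m. \<psi> h)" and "R \<equiv> measure \<rho> (space \<rho>)"
  shows "(LINT g|\<rho>. indicator K g * pairing \<phi> \<psi> g)
    \<le> \<delta> * I * measure \<rho> K + (C + \<delta> * R) * (sqrt (X + \<delta> * I) * sqrt (Y + \<delta> * J))"
proof -
  have Ks: "K \<in> sets \<rho>" using compactin_borel_of[OF hdT K] by (simp add: sets_\<rho>)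
  obtain Q\<phi> Q\<psi> where Q: "compactin T Q\<phi>" "\<And>h. h \<in> topspace T - Q\<phi> \<Longrightarrow> \<phi> h = 0"
    "compactin T Q\<psi>" "\<And>h. h \<in> topspace T - Q\<psi> \<Longrightarrow> \<psi> h = 0"
    using \<phi>(1) \<psi>(1) unfolding cc_def by metis
  define Q0 where "Q0 = Q\<phi> \<union> Q\<psi>"
  have Q0: "compactin T Q0" unfolding Q0_def by (rule compactin_Un[OF Q(1,3)])
  have Q0G: "Q0 \<subseteq> carrier G" using compactin_subset_topspace[OF Q0] by (simp add: topspace_eq)
  have KG: "K \<subseteq> carrier G" using compactin_subset_topspace[OF K] by (simp add: topspace_eq)
  have off: "\<phi> h = 0" "\<psi> h = 0" if "h \<in> carrier G" "h \<notin> Q0" for h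
    using that Q(2,4)[of h] by (auto simp: Q0_def topspace_eq)
  \<comment> \<open>For \<open>g \<in> K\<close> the translate of \<open>\<phi>\<close> by \<open>g\<close> is supported in \<open>Q1\<close>. If \<open>h \<in> Q1\<close> and \<open>\<psi> (h k) \<noteq> 0\<close>, then \<open>k \<in> Q2\<close>, so it is on
      \<open>Q2\<close> that the overlap has to be concentrated near the identity.\<close>
  define Q1 where "Q1 = (\<lambda>(x, y). x \<otimes> y) ` (K \<times> Q0) \<union> Q0"
  have Q1: "compactin T Q1" unfolding Q1_def by (intro compactin_Un compact_mult K Q0)
  have Q1G: "Q1 \<subseteq> carrier G" using compactin_subset_topspace[OF Q1] by (simp add: topspace_eq)
  define Q2 where "Q2 = (\<lambda>(x, y). x \<otimes> y) ` (m_inv G ` Q1 \<times> Q0)"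
  have Q2: "compactin T Q2" unfolding Q2_def by (intro compact_mult compact_inv_image Q1 Q0)
  obtain N1 where N1: "openin T N1" "\<one> \<in> N1" "\<And>h k. h \<in> carrier G \<Longrightarrow> k \<in> N1 \<Longrightarrow> norm (\<phi> (h \<otimes> k) - \<phi> h) < \<delta>"
    using cc_uniformly_continuous[OF \<phi>(1) \<delta>] by metis
  obtain N2 where N2: "openin T N2" "\<one> \<in> N2" "\<And>h k. h \<in> carrier G \<Longrightarrow> k \<in> N2 \<Longrightarrow> norm (\<psi> (h \<otimes> k) - \<psi> h) < \<delta>"
    using cc_uniformly_continuous[OF \<psi>(1) \<delta>] by metis
  obtain N3 K3 where N3: "openin T N3" "\<one> \<in> N3" "compactin T K3" "N3 \<subseteq> K3"
    using lcT unfolding locally_compact_space_def by (metis one_closed topspace_eq)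
  define N where "N = N1 \<inter> N2 \<inter> N3"
  have N: "openin T N" "\<one> \<in> N" using N1 N2 N3 by (auto simp: N_def)
  have Ns: "N \<in> sets m" by (rule left.open_M[OF N(1)])
  have Nfin: "emeasure m N < \<infinity>"
    using le_less_trans[OF emeasure_mono[of N K3 m] left.compact_finite[OF N3(3)]] left.compact_M[OF N3(3)] N3(4)
    by (auto simp: N_def)
  obtain U where U: "openin S U" "x0 \<in> U" "measure M (\<Union>q\<in>Q0. act q ` U) \<le> \<delta>"
    "\<And>k. k \<in> Q2 \<Longrightarrow> k \<notin> N \<Longrightarrow> overlap U k = 0"
    using small_neighbourhood[OF Q2 N Q0 \<delta>] by metis
  define c where "c = (LINT k|m. indicator N k * overlap U k)"
  have c: "c > 0" unfolding c_def by (rule overlap_mass_positive[OF U(1,2) N Nfin])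
  have inN: "k \<in> N" if "h \<in> Q1" "k \<in> carrier G" "h \<otimes> k \<in> Q0" "overlap U k \<noteq> 0" for h k
  proof -
    have "inv h \<otimes> (h \<otimes> k) = k" using that(1,2) Q1G by (auto simp: m_assoc[symmetric])
    then have "k \<in> Q2" unfolding Q2_def using that(1,3) by (force intro!: image_eqI[of _ _ "(inv h, h \<otimes> k)"])
    then show ?thesis using U(4) that(4) by blast
  qed
  have close: "\<bar>conv U f h - c * f h\<bar> \<le> \<delta> * c" if f: "f \<in> {\<phi>, \<psi>}" and h: "h \<in> Q1" for f h
    unfolding c_def
  proof (rule conv_close[OF U(1) _ Ns Nfin])
    show "cc T f" using f \<phi>(1) \<psi>(1) by blast
    show hG: "h \<in> carrier G" using h Q1G by blast
    show "\<bar>f (h \<otimes> k) - f h\<bar> \<le> \<delta>" if "k \<in> N" for k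
      using N1(3)[OF hG, of k] N2(3)[OF hG, of k] that f by (auto simp: N_def)
    show "k \<in> N" if "k \<in> carrier G" "f (h \<otimes> k) \<noteq> 0" "overlap U k \<noteq> 0" for k
      using inN[OF h that(1) _ that(3)] off[of "h \<otimes> k"] that f hG by blast
  qed
  have Q01: "Q0 \<subseteq> Q1" by (auto simp: Q1_def)
  have sq: "(LINT h|m. f h * f h) = (l2n m (\<lambda>x. complex_of_real (f x)))\<^sup>2" for f
    by (simp only: l2n_power2 norm_of_real power2_abs) (simp add: power2_eq_square)
  have norm: "(l2n M (smear U f))\<^sup>2 \<le> c * ((l2n m (\<lambda>x. of_real (f x)))\<^sup>2 + \<delta> * (LINT h|m. f h))"
    if f: "f \<in> {\<phi>, \<psi>}" for f
  proof -
    have fc: "cc T f" and f0: "\<And>h. h \<in> carrier G \<Longrightarrow> 0 \<le> f h" using f \<phi> \<psi> by auto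
    have "\<bar>(LINT h|m. f h * conv U f h) - c * (LINT h|m. f h * f h)\<bar> \<le> \<delta> * c * (LINT h|m. f h)"
    proof (rule conv_integral_close[OF U(1) fc cc_int[OF fc] f0])
      fix h assume "h \<in> carrier G" "f h \<noteq> 0"
      then have "h \<in> Q1" using off[of h] Q01 f by blast
      then show "\<bar>conv U f h - c * f h\<bar> \<le> \<delta> * c" by (rule close[OF f])
    qed
    then show ?thesis
      by (simp add: l2n_smear[OF U(1) fc] sq algebra_simps)
  qed
  have norm\<phi>: "(l2n M (smear U \<phi>))\<^sup>2 \<le> c * (X + \<delta> * I)" and norm\<psi>: "(l2n M (smear U \<psi>))\<^sup>2 \<le> c * (Y + \<delta> * J)"
    using norm[of \<phi>] norm[of \<psi>] by (simp_all add: X_def Y_def I_def J_def)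
  define b where "b g = (LINT h|m. \<phi> (inv g \<otimes> h) * conv U \<psi> h)" for g
  have bip: "ip M (tr g (smear U \<phi>)) (smear U \<psi>) = of_real (b g)" if "g \<in> carrier G" for g
    unfolding b_def by (rule ip_smear_smear[OF U(1) \<phi>(1) \<psi>(1) that])
  have b_int: "integrable \<rho> b"
  proof -
    have "integrable \<rho> (\<lambda>g. Re (1 * ip M (tr g (smear U \<phi>)) (smear U \<psi>)))"
      by (intro integrable_Re coefficient_bounded_integrable(1)[OF sets_\<rho>] smear_l2 U \<phi> \<psi>) simp
    then show ?thesis
      by (subst (asm) Bochner_Integration.integrable_cong[where g = b]) (simp_all add: bip space_\<rho>)
  qed
  have b_nonneg: "0 \<le> b g" if g: "g \<in> carrier G" for g
    unfolding b_def using g \<phi>(2) conv_nonneg[OF \<psi>(2)]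
    by (intro integral_nonneg_AE AE_I2 mult_nonneg_nonneg) (auto simp: space_m)
  have b_ge: "c * (pairing \<phi> \<psi> g - \<delta> * I) \<le> b g" if gK: "g \<in> K" for g
  proof -
    have g: "g \<in> carrier G" using gK KG by blast
    have f: "integrable m (\<lambda>h. \<phi> (inv g \<otimes> h))"
      using left.integrable_act[OF inv_closed[OF g] cc_int[OF \<phi>(1)]] .
    have fI: "(LINT h|m. \<phi> (inv g \<otimes> h)) = I"
      unfolding I_def using left.integral_act[OF inv_closed[OF g] cc_meas[OF \<phi>(1)]] .
    have "\<bar>(LINT h|m. \<phi> (inv g \<otimes> h) * conv U \<psi> h) - c * (LINT h|m. \<phi> (inv g \<otimes> h) * \<psi> h)\<bar>
        \<le> \<delta> * c * (LINT h|m. \<phi> (inv g \<otimes> h))"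
    proof (rule conv_integral_close[OF U(1) \<psi>(1) f])
      show "0 \<le> \<phi> (inv g \<otimes> h)" if "h \<in> carrier G" for h
        using \<phi>(2) g that by simp
      fix h assume h: "h \<in> carrier G" "\<phi> (inv g \<otimes> h) \<noteq> 0"
      then have "inv g \<otimes> h \<in> Q0" using off(1)[of "inv g \<otimes> h"] g by auto
      moreover have "g \<otimes> (inv g \<otimes> h) = h" using g h by (simp add: m_assoc[symmetric])
      ultimately have "h \<in> Q1"
        unfolding Q1_def using gK by (force intro!: image_eqI[of _ _ "(g, inv g \<otimes> h)"])
      then show "\<bar>conv U \<psi> h - c * \<psi> h\<bar> \<le> \<delta> * c" by (intro close) simp
    qed
    then show ?thesis
      by (simp add: b_def pairing_def fI algebra_simps)
  qed
  have p_int: "integrable \<rho> (pairing \<phi> \<psi>)"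
    by (rule pairing_integrable[OF \<phi>(1) \<psi>(1)])
  have i1: "integrable \<rho> (\<lambda>g. indicator K g * pairing \<phi> \<psi> g)"
    using integrable_real_mult_indicator[OF Ks p_int] by (simp add: mult.commute)
  have i2: "integrable \<rho> (\<lambda>g. indicator K g * (\<delta> * I))"
    using Ks by (simp add: \<rho>.emeasure_eq_measure)
  let ?P = "LINT g|\<rho>. indicator K g * pairing \<phi> \<psi> g"
  have "c * (?P - \<delta> * I * measure \<rho> K) = (LINT g|\<rho>. c * (indicator K g * pairing \<phi> \<psi> g - indicator K g * (\<delta> * I)))"
    using i1 i2 Ks sets.sets_into_space[OF Ks] by (simp add: Int_absorb2 mult_ac)
  also have "\<dots> \<le> (LINT g|\<rho>. b g)"
  proof (rule integral_mono[OF _ b_int])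
    show "integrable \<rho> (\<lambda>g. c * (indicator K g * pairing \<phi> \<psi> g - indicator K g * (\<delta> * I)))"
      using i1 i2 by simp
    fix g assume "g \<in> space \<rho>"
    then show "c * (indicator K g * pairing \<phi> \<psi> g - indicator K g * (\<delta> * I)) \<le> b g"
      using b_ge[of g] b_nonneg[of g] by (cases "g \<in> K") (auto simp: space_\<rho>)
  qed
  also have "\<dots> \<le> C * l2n M (smear U \<phi>) * l2n M (smear U \<psi>)
      + R * ((measure M U * I) * (measure M U * J))"
    unfolding R_def I_def J_def
    by (rule centred_bound[OF smear_l2[OF U(1) \<phi>(1)] smear_l2[OF U(1) \<psi>(1)]
        smear_mean(1)[OF U(1) \<phi> Q0G off(1)] smear_mean(1)[OF U(1) \<psi> Q0G off(2)] b_int bip])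
  finally have upper: "c * (?P - \<delta> * I * measure \<rho> K) \<le> C * l2n M (smear U \<phi>) * l2n M (smear U \<psi>)
      + R * ((measure M U * I) * (measure M U * J))" .
  have "(measure M U * I) * (measure M U * J)
      \<le> (l2n M (smear U \<phi>) * sqrt \<delta>) * (l2n M (smear U \<psi>) * sqrt \<delta>)"
  proof (rule mult_mono)
    have s: "sqrt (measure M (\<Union>q\<in>Q0. act q ` U)) \<le> sqrt \<delta>" using U(3) by simp
    show "measure M U * I \<le> l2n M (smear U \<phi>) * sqrt \<delta>"
      using smear_mean(3)[OF U(1) \<phi> Q0G off(1)] mult_left_mono[OF s l2n_nonneg[of M "smear U \<phi>"]]
      by (simp add: I_def)
    show "measure M U * J \<le> l2n M (smear U \<psi>) * sqrt \<delta>"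
      using smear_mean(3)[OF U(1) \<psi> Q0G off(2)] mult_left_mono[OF s l2n_nonneg[of M "smear U \<psi>"]]
      by (simp add: J_def)
    show "0 \<le> measure M U * J"
      using smear_mean(2)[OF U(1) \<psi> Q0G off(2)] by (simp add: J_def)
  qed (use \<delta> in simp)
  also have "(l2n M (smear U \<phi>) * sqrt \<delta>) * (l2n M (smear U \<psi>) * sqrt \<delta>)
      = \<delta> * (l2n M (smear U \<phi>) * l2n M (smear U \<psi>))"
    using \<delta> by simp
  finally have means: "(measure M U * I) * (measure M U * J) \<le> \<delta> * (l2n M (smear U \<phi>) * l2n M (smear U \<psi>))" .
  have "R \<ge> 0" by (simp add: R_def)
  from upper mult_left_mono[OF means this]
  have main: "c * (?P - \<delta> * I * measure \<rho> K)
      \<le> (C + \<delta> * R) * (l2n M (smear U \<phi>) * l2n M (smear U \<psi>))"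
    by (simp add: algebra_simps)
  have nn: "0 \<le> c * (X + \<delta> * I)"
    by (rule order_trans[OF zero_le_power2 norm\<phi>])
  have "l2n M (smear U \<phi>) * l2n M (smear U \<psi>) \<le> sqrt (c * (X + \<delta> * I)) * sqrt (c * (Y + \<delta> * J))"
    using norm\<phi> norm\<psi> nn by (intro mult_mono real_le_rsqrt) auto
  also have "\<dots> = c * (sqrt (X + \<delta> * I) * sqrt (Y + \<delta> * J))"
    using c by (simp add: real_sqrt_mult)
  finally have "(C + \<delta> * R) * (l2n M (smear U \<phi>) * l2n M (smear U \<psi>))
      \<le> (C + \<delta> * R) * (c * (sqrt (X + \<delta> * I) * sqrt (Y + \<delta> * J)))"
    using C(1) \<delta> by (intro mult_left_mono) (auto simp: R_def)
  with main have "c * (?P - \<delta> * I * measure \<rho> K) \<le> c * ((C + \<delta> * R) * (sqrt (X + \<delta> * I) * sqrt (Y + \<delta> * J)))"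
    by (simp add: mult.left_commute)
  then have "?P - \<delta> * I * measure \<rho> K \<le> (C + \<delta> * R) * (sqrt (X + \<delta> * I) * sqrt (Y + \<delta> * J))"
    using c by simp
  then show ?thesis by simp
qed

text \<open>In the previous estimate \<open>\<delta>\<close> tends to \<open>0\<close>, and then compact sets exhaust \<open>\<rho>\<close> by inner regularity.\<close>

lemma pairing_bound:
  assumes \<phi>: "cc T \<phi>" "\<And>h. h \<in> carrier G \<Longrightarrow> 0 \<le> \<phi> h"
    and \<psi>: "cc T \<psi>" "\<And>h. h \<in> carrier G \<Longrightarrow> 0 \<le> \<psi> h"
  shows "(LINT g|\<rho>. pairing \<phi> \<psi> g) \<le> C * (l2n m (\<lambda>x. of_real (\<phi> x)) * l2n m (\<lambda>x. of_real (\<psi> x)))"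
proof -
  define X where "X = l2n m (\<lambda>x. complex_of_real (\<phi> x))"
  define Y where "Y = l2n m (\<lambda>x. complex_of_real (\<psi> x))"
  have XY: "0 \<le> X" "0 \<le> Y" by (simp_all add: X_def Y_def)
  have p_int: "integrable \<rho> (pairing \<phi> \<psi>)"
    by (rule pairing_integrable[OF \<phi>(1) \<psi>(1)])
  have comp: "(LINT g|\<rho>. indicator K g * pairing \<phi> \<psi> g) \<le> C * (X * Y)" if K: "compactin T K" for K
  proof -
    let ?r = "\<lambda>\<delta>. \<delta> * (LINT h|m. \<phi> h) * measure \<rho> K + (C + \<delta> * measure \<rho> (space \<rho>)) *
      (sqrt (X\<^sup>2 + \<delta> * (LINT h|m. \<phi> h)) * sqrt (Y\<^sup>2 + \<delta> * (LINT h|m. \<psi> h)))"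
    have "(?r \<longlongrightarrow> 0 * (LINT h|m. \<phi> h) * measure \<rho> K + (C + 0 * measure \<rho> (space \<rho>)) *
      (sqrt (X\<^sup>2 + 0 * (LINT h|m. \<phi> h)) * sqrt (Y\<^sup>2 + 0 * (LINT h|m. \<psi> h)))) (at_right 0)"
      by (intro tendsto_intros)
    then have lim: "(?r \<longlongrightarrow> C * (X * Y)) (at_right 0)"
      using XY by simp
    have "\<forall>\<^sub>F \<delta> in at_right 0. (LINT g|\<rho>. indicator K g * pairing \<phi> \<psi> g) \<le> ?r \<delta>"
      unfolding X_def Y_def
      by (rule eventually_at_rightI[of 0 1]) (auto intro!: pairing_approx[OF \<phi> \<psi> K])
    then show ?thesis
      by (rule tendsto_lowerbound[OF lim]) simp
  qed
  have "(LINT g|\<rho>. pairing \<phi> \<psi> g) \<le> C * (X * Y) + e" if e: "e > 0" for e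
  proof -
    define d where "d = e / (X * Y + 1)"
    have XY1: "0 < X * Y + 1" using XY by (simp add: add_nonneg_pos)
    have d: "d > 0" using e XY1 by (simp add: d_def)
    obtain K where K: "compactin T K" "measure \<rho> (topspace T) - d < measure \<rho> K"
      by (rule inner_regular_compact[OF \<rho>(1) openin_topspace _ d]) (auto simp: \<rho>.emeasure_eq_measure)
    have Ks: "K \<in> sets \<rho>" using compactin_borel_of[OF hdT K(1)] by (simp add: sets_\<rho>)
    have "measure \<rho> (space \<rho> - K) = measure \<rho> (space \<rho>) - measure \<rho> K"
      by (rule \<rho>.finite_measure_compl[OF Ks])
    then have small: "measure \<rho> (space \<rho> - K) \<le> d"
      using K(2) by (simp add: space_\<rho> topspace_eq)
    have i1: "integrable \<rho> (\<lambda>g. indicator K g * pairing \<phi> \<psi> g)"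
      using integrable_real_mult_indicator[OF Ks p_int] by (simp add: mult.commute)
    have i2: "integrable \<rho> (\<lambda>g. indicator (space \<rho> - K) g * (X * Y))"
      using Ks by (simp add: \<rho>.emeasure_eq_measure)
    have "(LINT g|\<rho>. pairing \<phi> \<psi> g) \<le> (LINT g|\<rho>. indicator K g * pairing \<phi> \<psi> g + indicator (space \<rho> - K) g * (X * Y))"
    proof (rule integral_mono[OF p_int])
      fix g assume "g \<in> space \<rho>"
      then show "pairing \<phi> \<psi> g \<le> indicator K g * pairing \<phi> \<psi> g + indicator (space \<rho> - K) g * (X * Y)"
        using pairing_le[OF \<phi>(1) \<psi>(1), of g] by (auto simp: indicator_def space_\<rho> X_def Y_def)
    qed (use i1 i2 in simp)
    also have "\<dots> = (LINT g|\<rho>. indicator K g * pairing \<phi> \<psi> g) + measure \<rho> (space \<rho> - K) * (X * Y)"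
      using i1 i2 Ks by (simp add: Int_absorb2)
    also have "\<dots> \<le> C * (X * Y) + d * (X * Y)"
      using comp[OF K(1)] small XY by (intro add_mono mult_right_mono) auto
    also have "\<dots> \<le> C * (X * Y) + e"
    proof -
      have "d * (X * Y) \<le> d * (X * Y + 1)" using d by simp
      also have "\<dots> = e" using XY1 by (simp add: d_def)
      finally show ?thesis by simp
    qed
    finally show ?thesis .
  qed
  then show ?thesis
    unfolding X_def[symmetric] Y_def[symmetric] by (rule field_le_epsilon)
qed

text \<open>A coefficient of \<open>f\<close> and \<open>g\<close> is bounded by that of \<open>\<bar>f\<bar>\<close> and \<open>\<bar>g\<bar>\<close>, and integration against the positive measure
  \<open>\<rho>\<close> preserves the inequality.\<close>

lemma coefficient_cc_bound:
  assumes f: "cc T f" and g: "cc T g"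
  shows "cmod (LINT h|\<rho>. ip m (left.tr h f) g) \<le> C * (l2n m f * l2n m g)"
proof -
  let ?f = "\<lambda>x. cmod (f x)" and ?g = "\<lambda>x. cmod (g x)"
  have cf: "cc T ?f" "cc T ?g"
    by (rule cc_cont_compose[OF f] cc_cont_compose[OF g]; auto intro!: continuous_intros)+
  have le: "cmod (ip m (left.tr h f) g) \<le> pairing ?f ?g h" for h
  proof -
    have "cmod (ip m (left.tr h f) g) \<le> (LINT x|m. cmod (left.tr h f x * cnj (g x)))"
      unfolding ip_def by (rule integral_norm_bound)
    then show ?thesis by (simp add: pairing_def left.tr_def norm_mult)
  qed
  have "integrable \<rho> (\<lambda>h. 1 * ip m (left.tr h f) g)"
    by (intro left.coefficient_bounded_integrable(1)[OF sets_\<rho>] cc_l2 f g) simp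
  then have i: "integrable \<rho> (\<lambda>h. ip m (left.tr h f) g)" by simp
  have "cmod (LINT h|\<rho>. ip m (left.tr h f) g) \<le> (LINT h|\<rho>. cmod (ip m (left.tr h f) g))"
    by (rule integral_norm_bound)
  also have "\<dots> \<le> (LINT h|\<rho>. pairing ?f ?g h)"
    by (intro integral_mono integrable_norm i le pairing_integrable cf)
  also have "\<dots> \<le> C * (l2n m (\<lambda>x. of_real (?f x)) * l2n m (\<lambda>x. of_real (?g x)))"
    by (rule pairing_bound[OF cf(1) _ cf(2)]) auto
  finally show ?thesis by (simp add: l2n_def)
qed

text \<open>Density extends the bound in two steps: first in \<open>f\<close>, with the second argument still continuous, and then in the
  second argument, which approximates the average of \<open>f\<close> itself.\<close>

lemma average_bound:
  assumes f: "f \<in> l2_fun m"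
  shows "l2n m (left.average \<rho> (\<lambda>_. 1) f) \<le> C * l2n m f"
proof -
  let ?A = "left.average \<rho> (\<lambda>_. 1)"
  note Al2 = left.average_l2[OF sets_\<rho> one_integrable] and ipA = left.ip_average[OF sets_\<rho> one_integrable]
  obtain s where s: "\<And>n. cc T (s n)" "(\<lambda>n. l2n m (\<lambda>x. s n x - f x)) \<longlonglongrightarrow> 0"
    using cc_dense_l2[OF lcT hdT left.reg f] by metis
  obtain t where t: "\<And>n. cc T (t n)" "(\<lambda>n. l2n m (\<lambda>x. t n x - ?A f x)) \<longlonglongrightarrow> 0"
    using cc_dense_l2[OF lcT hdT left.reg Al2[OF f]] by blast
  note sl2 = cc_l2[OF s(1)] and tl2 = cc_l2[OF t(1)]
  have 1: "cmod (ip m (?A f) (t n)) \<le> C * (l2n m f * l2n m (t n))" for n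
  proof -
    have "cmod (ip m (?A (s k)) (t n)) \<le> C * (l2n m (s k) * l2n m (t n))" for k
      using coefficient_cc_bound[OF s(1) t(1), of k n] ipA[OF sl2 tl2, of k n] by simp
    moreover have "(\<lambda>k. ip m (?A (s k)) (t n)) \<longlonglongrightarrow> ip m (?A f) (t n)"
    proof (rule tendsto_ip_left[OF Al2[OF sl2] Al2[OF f] tl2])
      have eq: "l2n m (\<lambda>x. ?A (s k) x - ?A f x) = l2n m (?A (\<lambda>x. s k x - f x))" for k
      proof -
        have d: "(\<lambda>x. s k x - f x) \<in> l2_fun m" by (rule l2_fun_diff[OF sl2 f])
        have "l2_class m (?A (\<lambda>x. (s k x - f x) + f x)) = l2_class m (\<lambda>x. ?A (\<lambda>x. s k x - f x) x + ?A f x)"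
          by (rule left.average_add[OF sets_\<rho> one_integrable d f])
        then have "AE x in m. ?A (s k) x = ?A (\<lambda>x. s k x - f x) x + ?A f x"
          using l2_class_eq_iff[OF Al2[OF sl2] l2_fun_add[OF Al2[OF d] Al2[OF f]]] by simp
        then have "AE x in m. ?A (s k) x - ?A f x = ?A (\<lambda>x. s k x - f x) x"
          by eventually_elim simp
        then have "l2_class m (\<lambda>x. ?A (s k) x - ?A f x) = l2_class m (?A (\<lambda>x. s k x - f x))"
          using l2_class_eq_iff[OF l2_fun_diff[OF Al2[OF sl2] Al2[OF f]] Al2[OF d]] by simp
        then show ?thesis
          using hnorm_L2_class[OF l2_fun_diff[OF Al2[OF sl2] Al2[OF f]], of k] hnorm_L2_class[OF Al2[OF d]] by metis
      qed
      show "(\<lambda>k. l2n m (\<lambda>x. ?A (s k) x - ?A f x)) \<longlonglongrightarrow> 0"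
        unfolding eq
      proof (rule Lim_null_comparison)
        show "\<forall>\<^sub>F k in sequentially. norm (l2n m (?A (\<lambda>x. s k x - f x)))
            \<le> (LINT h|\<rho>. cmod 1) * l2n m (\<lambda>x. s k x - f x)"
          using left.l2n_average_le[OF sets_\<rho> one_integrable l2_fun_diff[OF sl2 f]] by simp
        show "(\<lambda>k. (LINT h|\<rho>. cmod 1) * l2n m (\<lambda>x. s k x - f x)) \<longlonglongrightarrow> 0"
          by (rule tendsto_mult_right_zero[OF s(2)])
      qed
    qed
    moreover have "(\<lambda>k. l2n m (s k)) \<longlonglongrightarrow> l2n m f"
      by (rule tendsto_l2n[OF sl2 f s(2)])
    ultimately show ?thesis
      by (intro LIMSEQ_le[of "\<lambda>k. cmod (ip m (?A (s k)) (t n))" _ "\<lambda>k. C * (l2n m (s k) * l2n m (t n))"])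
        (auto intro!: tendsto_intros)
  qed
  have "(\<lambda>n. ip m (t n) (?A f)) \<longlonglongrightarrow> ip m (?A f) (?A f)"
    by (rule tendsto_ip_left[OF tl2 Al2[OF f] Al2[OF f] t(2)])
  then have "(\<lambda>n. cmod (ip m (t n) (?A f))) \<longlonglongrightarrow> cmod (ip m (?A f) (?A f))"
    by (rule tendsto_norm)
  moreover have "(\<lambda>n. C * (l2n m f * l2n m (t n))) \<longlonglongrightarrow> C * (l2n m f * l2n m (?A f))"
    by (intro tendsto_intros tendsto_l2n[OF tl2 Al2[OF f] t(2)])
  moreover have "cmod (ip m (t n) (?A f)) \<le> C * (l2n m f * l2n m (t n))" for n
    using 1[of n] ip_commute[of m "t n" "?A f"] by simp
  ultimately have "cmod (ip m (?A f) (?A f)) \<le> C * (l2n m f * l2n m (?A f))"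
    by (intro LIMSEQ_le[of "\<lambda>n. cmod (ip m (t n) (?A f))" _ "\<lambda>n. C * (l2n m f * l2n m (t n))"]) auto
  then have "l2n m (?A f) * l2n m (?A f) \<le> (C * l2n m f) * l2n m (?A f)"
    by (simp only: ip_self norm_of_real abs_power2 power2_eq_square mult.assoc)
  then show ?thesis
    using C(1) l2n_nonneg[of m "?A f"] by (cases "l2n m (?A f) = 0") (auto simp: mult_le_cancel_right)
qed

end

context free_orbit
begin

lemma opnorm_regular_le_opnorm_koopman:
  assumes \<rho>: "regular_borel_measure T \<rho>" "finite_measure \<rho>"
  shows "opnorm (L2 m) (integrated_op (L2 m) (left_regular G m) \<rho>)
    \<le> opnorm (L2_0 M) (integrated_op (L2_0 M) (koopman G act M) \<rho>)"
proof -
  note \<rho>s = regularD(1)[OF \<rho>(1)]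
  note ge = opnorm_L2_0_ge[OF \<rho>s \<rho>(2) M_prob]
  interpret koopman_bound G T act S M m x0 \<rho> "opnorm (L2_0 M) (integrated_op (L2_0 M) (koopman G act M) \<rho>)"
    by (intro koopman_bound.intro koopman_bound_axioms.intro free_orbit_axioms \<rho> ge)
  have "left_regular G m = koopman G (\<lambda>g x. g \<otimes> x) m"
    by (intro ext) (simp add: left_regular_def koopman_def)
  then show ?thesis
    using left.opnorm_L2_le[OF \<rho>s \<rho>(2) ge(2) average_bound] by simp
qed

end

section \<open>Closed subgroups acting on the coset space of a lattice\<close>

theorem corollary1:
  fixes G :: "('a, 'b) monoid_scheme" (structure)
    and T :: "'a topology"
    and H \<Gamma> :: "'a set"
    and \<mu>\<^sub>G \<mu>\<^sub>H \<mu> :: "'a measure"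
    and \<nu> :: "'a set measure"
  assumes "topological_group G T" and "locally_compact_space T" and "Hausdorff_space T"
    and "left_haar_measure G T \<mu>\<^sub>G"
    and "subgroup H G" and "closedin T H"
    and "unimodular (G\<lparr>carrier := H\<rparr>) (subtopology T H)"
    and "emeasure \<mu>\<^sub>G H = 0"
    and "lattice_in G T \<Gamma>" and "H \<inter> \<Gamma> = {\<one>}"
    and "regular_borel_measure (coset_topology G T \<Gamma>) \<nu>" and "prob_space \<nu>"
    and "invariant_measure G (\<lambda>g C. g <# C) \<nu>"
    and "left_haar_measure (G\<lparr>carrier := H\<rparr>) (subtopology T H) \<mu>\<^sub>H"
    and "regular_borel_measure (subtopology T H) \<mu>" and "finite_measure \<mu>"
  shows "opnorm (L2_0 \<nu>) (integrated_op (L2_0 \<nu>) (koopman (G\<lparr>carrier := H\<rparr>) (\<lambda>h C. h <# C) \<nu>) \<mu>)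
    \<ge> opnorm (L2 \<mu>\<^sub>H) (integrated_op (L2 \<mu>\<^sub>H) (left_regular (G\<lparr>carrier := H\<rparr>) \<mu>\<^sub>H) \<mu>)"
proof -
  interpret topological_group G T by (rule assms(1))
  let ?H = "G\<lparr>carrier := H\<rparr>" and ?TH = "subtopology T H" and ?X = "coset_topology G T \<Gamma>"
  note lc = assms(2) and hd = assms(3) and H = assms(5) and \<nu> = assms(11,13)
  have \<Gamma>: "subgroup \<Gamma> G" "subtopology T \<Gamma> = discrete_topology \<Gamma>"
    using assms(9) by (simp_all add: lattice_in_def)
  have \<Gamma>G: "\<Gamma> \<subseteq> carrier G" by (rule subgroup.subset[OF \<Gamma>(1)])
  have HG: "H \<subseteq> carrier G" by (rule subgroup.subset[OF H])
  interpret X: mp_action G T "\<lambda>g (C :: 'a set). g <# C" ?X \<nu>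
    by (rule coset_action[OF \<Gamma> hd \<nu>])
  interpret HX: mp_action ?H ?TH "\<lambda>g (C :: 'a set). g <# C" ?X \<nu>
    by (rule X.restrict_subgroup[OF H])
  interpret \<nu>: prob_space \<nu> by (rule assms(12))
  have one: "\<one> <# \<Gamma> = \<Gamma>"
    using \<Gamma>G by (force simp: l_coset_def)
  have \<Gamma>X: "\<Gamma> \<in> topspace ?X"
    using one by (auto simp: topspace_coset intro!: image_eqI[of _ _ \<one>])
  have "regular_borel_measure T \<mu>\<^sub>G"
    using assms(4) by (simp add: left_haar_measure_def)
  then have Hclosed: "H \<in> sets \<mu>\<^sub>G"
    using closedin_borel_of[OF assms(6)] by (simp add: regularD(1))
  have "free_orbit ?H ?TH (\<lambda>g (C :: 'a set). g <# C) ?X \<nu> \<mu>\<^sub>H \<Gamma>"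
  proof unfold_locales
    show "locally_compact_space ?TH"
      by (rule locally_compact_space_closed_subset[OF lc assms(6)])
    show "Hausdorff_space ?TH" by (rule Hausdorff_space_subtopology[OF hd])
    show "left_haar_measure ?H ?TH \<mu>\<^sub>H" by (rule assms(14))
    show "\<Gamma> \<in> topspace ?X" by (rule \<Gamma>X)
    show "t = \<one>\<^bsub>?H\<^esub>" if "t \<in> carrier ?H" "t <# \<Gamma> = \<Gamma>" for t
    proof -
      have t: "t \<in> H" "t \<in> carrier G" using that(1) HG by auto
      then have "t \<in> \<Gamma>" using lcos_self[OF t(2) \<Gamma>(1)] that(2) by simp
      then show ?thesis using t assms(10) by auto
    qed
    show "\<exists>U. openin ?X U \<and> \<Gamma> \<in> U \<and> measure \<nu> (\<Union>q\<in>Q. (\<lambda>C. q <# C) ` U) \<le> e"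
      if Q: "compactin ?TH Q" and e: "e > 0" for Q and e :: real
    proof -
      have QT: "compactin T Q" "Q \<subseteq> H" using Q by (simp_all add: compactin_subtopology)
      \<comment> \<open>The null set needed is \<open>Q\<^sup>-\<^sup>1\<close>, which lies in \<open>H\<close> because \<open>H\<close> is a group.\<close>
      have "m_inv G ` Q \<subseteq> H" using QT(2) H by (auto simp: subgroup.m_inv_closed)
      then have "emeasure \<mu>\<^sub>G (m_inv G ` Q) = 0"
        using emeasure_mono[of _ H \<mu>\<^sub>G] Hclosed assms(8) by (metis le_zero_eq)
      then show ?thesis
        using coset_small_tube[OF lc hd assms(4) \<Gamma> \<nu> assms(12) QT(1) _ e] by metis
    qed
    show "0 < measure \<nu> U" if U: "openin ?X U" "\<Gamma> \<in> U" for U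
    proof -
      have "\<exists>g\<in>carrier G. g <# x = y" if xy: "x \<in> topspace ?X" "y \<in> topspace ?X" for x y
      proof -
        obtain a b where ab: "a \<in> carrier G" "x = a <# \<Gamma>" "b \<in> carrier G" "y = b <# \<Gamma>"
          using xy by (auto simp: topspace_coset)
        then have "(b \<otimes> inv a) <# x = y"
          by (simp add: l_coset_mult[OF \<Gamma>(1)] m_assoc)
        then show ?thesis using ab by blast
      qed
      then have "emeasure \<nu> U > 0"
        using U \<nu>.emeasure_space_1 by (intro X.open_positive) auto
      then show ?thesis by (simp add: \<nu>.emeasure_eq_measure)
    qed
  qed
  then interpret free_orbit ?H ?TH "\<lambda>g (C :: 'a set). g <# C" ?X \<nu> \<mu>\<^sub>H \<Gamma> .
  show ?thesis
    by (rule opnorm_regular_le_opnorm_koopman[OF assms(15,16)])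
qed

end
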